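(* Let $\mathfrak g$ be a simple finite-dimensional complex Lie algebra with dual Coxeter number $g$, let $\ell\ge 1$ be an integer, and let $V_\lambda$ be an irreducible representation of $\mathfrak g$ with highest weight $\lambda$ satisfying $(\lambda,\theta)\le \ell$, where $\theta$ is the highest root. Then the Neveu-Schwarz algebra $\mathfrak{Vir}_{1/2}$ acts unitarily on $H^\lambda=L(V_\lambda,\ell)\otimes \mathcal F_{NS}^{\mathfrak g}$ (through the operators $L_n$, $G_m$ described in the context), and the minimal submodule of $H^\lambda$ containing the cyclic vector $\Omega^\lambda$ is isomorphic to $L(c,h)$ with $$c=\frac32\cdot\frac{\ell+\frac13 g}{\ell+g}\dim(\mathfrak g),\qquad h=\frac{c_{V_\lambda}}{2(\ell+g)},$$ where $c_{V_\lambda}$ is the eigenvalue of the Casimir element on $V_\lambda$.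
   Context: Lie algebra data. $\mathfrak g$ has a basis $(X_a)_{1\le a\le N}$, $N=\dim\mathfrak g$, with $[X_a,X_b]=i\sum_c\Gamma_{ab}^cX_c$, $\Gamma_{ab}^c\in\mathbb R$ totally antisymmetric, normalized so that $\mathcal C=\sum_aX_a^2$ is exactly the Casimir (normalization in which the highest root has squared length 2). $\mathcal C$ acts on an irreducible representation $V$ by a scalar $c_V$; the dual Coxeter number is $g=c_{\mathfrak g}/2$ (adjoint representation), and $\sum_{a,c}\Gamma_{ac}^b\Gamma_{ac}^d=2g\,\delta_{bd}$. Boson algebra. $\widehat{\mathfrak g}_+$ is spanned by $X^a_n$ ($n\in\mathbb Z$) and a central $\mathcal L$, with $[X_m^a,X_n^b]=i\sum_c\Gamma_{ab}^cX^c_{m+n}+m\,\delta_{ab}\delta_{m+n,0}\mathcal L$, $(X_n^a)^\star=X_{-n}^a$. $L(V_\lambda,\ell)$ is its irreducible unitary highest weight representation with $\mathcal L=\ell$ and lowest energy subspace $V_\lambda$ (annihilated by $X^a_n$, $n>0$). Fermion algebra. $\widehat{\mathfrak g}_-$ is generated by $\psi^a_m$, $m\in\mathbb Z+\frac12$, with $[\psi^a_m,\psi^b_n]_+=\delta_{ab}\delta_{m+n,0}$, $(\psi^a_m)^\star=\psi^a_{-m}$. $\mathcal F_{NS}^{\mathfrak g}$ is its irreducible unitary representation generated by a unit vector $\Omega$ with $\psi^a_m\Omega=0$ for $m>0$. All representation spaces are prehilbert spaces (algebraic direct sums of finite-dimensional energy spaces). On $H^\lambda$, the $X^a_n$ act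 on the first tensor factor and the $\psi^a_m$ act on the second. $\Omega^\lambda$ is the tensor product of a unit highest weight vector of $V_\lambda$ with $\Omega$. Fields. For a formal series $A(z)=\sum_{n\in\mathbb Z}A(n)z^{-n-1}$ with operator coefficients, and $A,B$ mutually local with sign $\varepsilon\in\mathbb Z_2$ (sign $\bar 1$ for two $\psi$'s, $\bar0$ for $X$ with anything and for the even fields $S^c$ below with anything), put $[X,Y]_{\varepsilon}=XY-(-1)^{\varepsilon}YX$ and $A_nB(z)=\sum_m(A_nB)(m)z^{-m-1}$, where for $n\ge0$: $(A_nB)(m)=\sum_{p=0}^n(-1)^p\binom np[A(n-p),B(m+p)]_\varepsilon$; for $n<0$: $(A_nB)(m)=\sum_{p\ge0}\binom{p-n-1}{p}\big(A(n-p)B(m+p)-(-1)^{\varepsilon+n}B(m+n-p)A(p)\big)$. Let $\psi^a(z)=\sum_{n\in\mathbb Z}\psi^a_{n+1/2}z^{-n-1}$, $X^a(z)=\sum_{n\in\mathbb Z}X^a_nz^{-n-1}$, $S^c=-\frac i2\sum_{a,b}\Gamma_{ab}^c\,\psi^a_{-1}\psi^b$ (operation $A_{-1}B$ on fields). The operators $L_n$ ($n\in\mathbb Z$) and $G_m$ ($m\in\mathbb Z+\frac12$) on $H^\lambda$ are defined by $$\sum_nL_nz^{-n-2}=\tfrac12\sum_a\psi^a_{-2}\psi^a(z)+\tfrac1{2(\ell+g)}\sum_aX^a_{-1}X^a(z),$$ $$\sum_{m}G_mz^{-m-3/2}=(\ell+g)^{-1/2}\sum_a\Big(\psi^a_{-1}X^a(z)+\tfrac13\psi^a_{-1}S^a(z)\Big),$$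 where the subscripts denote the operations $A_nB$ on fields. Neveu-Schwarz algebra. $\mathfrak{Vir}_{1/2}$ has basis $L_n$ ($n\in\mathbb Z$), $G_m$ ($m\in\mathbb Z+\frac12$), $C$ central, with $[L_m,L_n]=(m-n)L_{m+n}+\frac C{12}(m^3-m)\delta_{m+n,0}$, $[G_m,L_n]=(m-\frac n2)G_{m+n}$, $[G_m,G_n]_+=2L_{m+n}+\frac C3(m^2-\frac14)\delta_{m+n,0}$, and $L_n^\star=L_{-n}$, $G_m^\star=G_{-m}$, $C^\star=C$. An action is unitary if it respects $\star$. The Verma module $V(c,h)$ is freely generated by a vector $\Omega\neq0$ with $L_0\Omega=h\Omega$, $C\Omega=c\Omega$, $L_n\Omega=G_m\Omega=0$ for $n,m>0$; it carries the canonical sesquilinear form with $(\Omega,\Omega)=1$ for which $L_n^\star=L_{-n}$, $G_m^\star=G_{-m}$. $K(c,h)$ is the kernel of the form (the maximal proper submodule) and $L(c,h)=V(c,h)/K(c,h)$. *)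

theory Defs
  imports Complex_Main "HOL-Library.Poly_Mapping"
begin

section \<open>Complex vector spaces and prehilbert spaces\<close>

class complex_vector = ab_group_add +
  fixes scaleC :: "complex \<Rightarrow> 'a \<Rightarrow> 'a"  (infixr "*\<^sub>C" 75)
  assumes scaleC_add_right: "a *\<^sub>C (x + y) = a *\<^sub>C x + a *\<^sub>C y"
    and scaleC_add_left: "(a + b) *\<^sub>C x = a *\<^sub>C x + b *\<^sub>C x"
    and scaleC_scaleC: "a *\<^sub>C b *\<^sub>C x = (a * b) *\<^sub>C x"
    and scaleC_one: "1 *\<^sub>C x = x"

interpretation cvec: vector_space "scaleC :: complex \<Rightarrow> 'a \<Rightarrow> 'a::complex_vector"
  by unfold_locales (rule scaleC_add_right scaleC_add_left scaleC_scaleC scaleC_one)+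

abbreviation clinear :: "('a::complex_vector \<Rightarrow> 'b::complex_vector) \<Rightarrow> bool" where
  "clinear \<equiv> Vector_Spaces.linear scaleC scaleC"

definition cbilinear :: "('a::complex_vector \<Rightarrow> 'b::complex_vector \<Rightarrow> 'c::complex_vector) \<Rightarrow> bool"
  where "cbilinear f \<longleftrightarrow> (\<forall>x. clinear (f x)) \<and> (\<forall>y. clinear (\<lambda>x. f x y))"

definition finite_dim :: "'a::complex_vector set \<Rightarrow> bool" where
  "finite_dim S \<longleftrightarrow> (\<exists>B. finite B \<and> S = cvec.span B)"

text \<open>The inner product is linear in its first and conjugate-linear in its second argument.
  No completeness is required.\<close>

class complex_prehilbert = complex_vector +
  fixes cinner :: "'a \<Rightarrow> 'a \<Rightarrow> complex"
  assumes cinner_add_left: "cinner (x + y) z = cinner x z + cinner y z"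
    and cinner_scaleC_left: "cinner (a *\<^sub>C x) z = a * cinner x z"
    and cinner_commute: "cinner x y = cnj (cinner y x)"
    and cinner_ge_zero: "0 \<le> Re (cinner x x)"
    and cinner_eq_zero: "cinner x x = 0 \<Longrightarrow> x = 0"

definition adjoint_pair ::
  "('a::complex_prehilbert \<Rightarrow> 'a) \<Rightarrow> ('a \<Rightarrow> 'a) \<Rightarrow> bool" where
  "adjoint_pair S T \<longleftrightarrow> (\<forall>u v. cinner (S u) v = cinner u (T v))"

definition invariant_under :: "('a::complex_vector \<Rightarrow> 'a) set \<Rightarrow> 'a set \<Rightarrow> bool" where
  "invariant_under ops S \<longleftrightarrow> cvec.subspace S \<and> (\<forall>T\<in>ops. \<forall>v\<in>S. T v \<in> S)"

definition irreducible_under :: "('a::complex_vector \<Rightarrow> 'a) set \<Rightarrow> bool" where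
  "irreducible_under ops \<longleftrightarrow> (\<exists>v::'a. v \<noteq> 0) \<and>
     (\<forall>S. invariant_under ops S \<longrightarrow> S = {0} \<or> S = UNIV)"

definition generated_by :: "('a::complex_vector \<Rightarrow> 'a) set \<Rightarrow> 'a \<Rightarrow> 'a set" where
  "generated_by ops v = \<Inter>{S. invariant_under ops S \<and> v \<in> S}"


section \<open>Simple Lie algebras\<close>

definition lie_algebra :: "('g::complex_vector \<Rightarrow> 'g \<Rightarrow> 'g) \<Rightarrow> bool" where
  "lie_algebra br \<longleftrightarrow> cbilinear br \<and> (\<forall>x. br x x = 0) \<and>
     (\<forall>x y z. br x (br y z) + br y (br z x) + br z (br x y) = 0)"

definition simple_lie_algebra :: "('g::complex_vector \<Rightarrow> 'g \<Rightarrow> 'g) \<Rightarrow> bool" where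
  "simple_lie_algebra br \<longleftrightarrow> lie_algebra br \<and> finite_dim (UNIV :: 'g set) \<and>
     (\<exists>x y. br x y \<noteq> 0) \<and>
     (\<forall>I. cvec.subspace I \<and> (\<forall>x. \<forall>y\<in>I. br x y \<in> I) \<longrightarrow> I = {0} \<or> I = UNIV)"

definition cartan_subalgebra :: "('g::complex_vector \<Rightarrow> 'g \<Rightarrow> 'g) \<Rightarrow> 'g set \<Rightarrow> bool" where
  "cartan_subalgebra br \<hh> \<longleftrightarrow> cvec.subspace \<hh> \<and>
     (\<forall>x\<in>\<hh>. \<forall>y\<in>\<hh>. br x y = 0) \<and>
     (\<forall>x. (\<forall>y\<in>\<hh>. br y x = 0) \<longrightarrow> x \<in> \<hh>) \<and>
     (\<forall>x\<in>\<hh>. cvec.span {y. \<exists>c. br x y = c *\<^sub>C y} = UNIV)"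

text \<open>A functional on a Cartan subalgebra is a function on the whole Lie algebra of which only the
  values on the subalgebra matter; roots are normalized to vanish elsewhere, so that each root is
  represented by exactly one function.\<close>

definition roots :: "('g::complex_vector \<Rightarrow> 'g \<Rightarrow> 'g) \<Rightarrow> 'g set \<Rightarrow> ('g \<Rightarrow> complex) set" where
  "roots br \<hh> = {\<alpha>. (\<forall>x. x \<notin> \<hh> \<longrightarrow> \<alpha> x = 0) \<and> (\<exists>y\<in>\<hh>. \<alpha> y \<noteq> 0) \<and>
     (\<exists>x. x \<noteq> 0 \<and> (\<forall>y\<in>\<hh>. br y x = \<alpha> y *\<^sub>C x))}"

definition nonneg_comb :: "('g \<Rightarrow> complex) set \<Rightarrow> ('g \<Rightarrow> complex) \<Rightarrow> bool" where
  "nonneg_comb \<Delta> \<alpha> \<longleftrightarrow> (\<exists>k::('g \<Rightarrow> complex) \<Rightarrow> nat. \<forall>x. \<alpha> x = (\<Sum>\<delta>\<in>\<Delta>. of_nat (k \<delta>) * \<delta> x))"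

definition root_base ::
  "('g::complex_vector \<Rightarrow> 'g \<Rightarrow> 'g) \<Rightarrow> 'g set \<Rightarrow> ('g \<Rightarrow> complex) set \<Rightarrow> bool" where
  "root_base br \<hh> \<Delta> \<longleftrightarrow> finite \<Delta> \<and> \<Delta> \<subseteq> roots br \<hh> \<and>
     (\<forall>c. (\<forall>x. (\<Sum>\<delta>\<in>\<Delta>. c \<delta> * \<delta> x) = 0) \<longrightarrow> (\<forall>\<delta>\<in>\<Delta>. c \<delta> = 0)) \<and>
     (\<forall>\<alpha>\<in>roots br \<hh>. nonneg_comb \<Delta> \<alpha> \<or> nonneg_comb \<Delta> (\<lambda>x. - \<alpha> x))"

definition highest_root ::
  "('g::complex_vector \<Rightarrow> 'g \<Rightarrow> 'g) \<Rightarrow> 'g set \<Rightarrow> ('g \<Rightarrow> complex) set \<Rightarrow> ('g \<Rightarrow> complex) \<Rightarrow> bool" where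
  "highest_root br \<hh> \<Delta> \<theta> \<longleftrightarrow> \<theta> \<in> roots br \<hh> \<and>
     (\<forall>\<alpha>\<in>roots br \<hh>. nonneg_comb \<Delta> (\<lambda>x. \<theta> x - \<alpha> x))"

text \<open>\<open>\<Gamma> a b c\<close> is the structure constant with lower indices a, b and upper index c.\<close>

definition structure_basis ::
  "('g::complex_vector \<Rightarrow> 'g \<Rightarrow> 'g) \<Rightarrow> ('n::finite \<Rightarrow> 'g) \<Rightarrow> ('n \<Rightarrow> 'n \<Rightarrow> 'n \<Rightarrow> real) \<Rightarrow> bool" where
  "structure_basis br X \<Gamma> \<longleftrightarrow>
     inj X \<and> cvec.independent (range X) \<and> cvec.span (range X) = UNIV \<and>
     (\<forall>a b c. \<Gamma> b a c = - \<Gamma> a b c \<and> \<Gamma> a c b = - \<Gamma> a b c) \<and>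
     (\<forall>a b. br (X a) (X b) = \<i> *\<^sub>C (\<Sum>c\<in>UNIV. of_real (\<Gamma> a b c) *\<^sub>C X c))"

text \<open>The bilinear form for which \<open>X\<close> is orthonormal. It is invariant because the structure
  constants are totally antisymmetric, and the sum of the squares of the \<open>X a\<close> is its Casimir
  element. \<open>weight_form\<close> is the form it induces on the dual of the Cartan subalgebra; it is
  real on weights of finite-dimensional representations.\<close>

definition basis_form :: "('n::finite \<Rightarrow> 'g::complex_vector) \<Rightarrow> 'g \<Rightarrow> 'g \<Rightarrow> complex" where
  "basis_form X x y = (\<Sum>a\<in>UNIV. cvec.representation (range X) x (X a) *
                                 cvec.representation (range X) y (X a))"

definition weight_vec ::
  "('n::finite \<Rightarrow> 'g::complex_vector) \<Rightarrow> 'g set \<Rightarrow> ('g \<Rightarrow> complex) \<Rightarrow> 'g" where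
  "weight_vec X \<hh> \<mu> = (THE t. t \<in> \<hh> \<and> (\<forall>y\<in>\<hh>. basis_form X t y = \<mu> y))"

definition weight_form ::
  "('n::finite \<Rightarrow> 'g::complex_vector) \<Rightarrow> 'g set \<Rightarrow> ('g \<Rightarrow> complex) \<Rightarrow> ('g \<Rightarrow> complex) \<Rightarrow> complex" where
  "weight_form X \<hh> \<mu> \<nu> = basis_form X (weight_vec X \<hh> \<mu>) (weight_vec X \<hh> \<nu>)"

definition irreducible_rep ::
  "('g::complex_vector \<Rightarrow> 'g \<Rightarrow> 'g) \<Rightarrow> ('g \<Rightarrow> 'v::complex_vector \<Rightarrow> 'v) \<Rightarrow> bool" where
  "irreducible_rep br \<rho> \<longleftrightarrow> cbilinear \<rho> \<and>
     (\<forall>x y v. \<rho> (br x y) v = \<rho> x (\<rho> y v) - \<rho> y (\<rho> x v)) \<and>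
     finite_dim (UNIV :: 'v set) \<and> irreducible_under (range \<rho>)"

definition highest_weight_vector ::
  "('g::complex_vector \<Rightarrow> 'g \<Rightarrow> 'g) \<Rightarrow> 'g set \<Rightarrow> ('g \<Rightarrow> complex) set \<Rightarrow>
   ('g \<Rightarrow> 'v::complex_vector \<Rightarrow> 'v) \<Rightarrow> ('g \<Rightarrow> complex) \<Rightarrow> 'v \<Rightarrow> bool" where
  "highest_weight_vector br \<hh> \<Delta> \<rho> \<mu> v \<longleftrightarrow> v \<noteq> 0 \<and> (\<forall>y\<in>\<hh>. \<rho> y v = \<mu> y *\<^sub>C v) \<and>
     (\<forall>\<alpha>\<in>roots br \<hh>. nonneg_comb \<Delta> \<alpha> \<longrightarrow>
        (\<forall>x. (\<forall>y\<in>\<hh>. br y x = \<alpha> y *\<^sub>C x) \<longrightarrow> \<rho> x v = 0))"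

text \<open>The scalar is real: for the inner product of a compact real form, the \<open>X a\<close> act by
  self-adjoint operators.\<close>

definition casimir_scalar ::
  "('n::finite \<Rightarrow> 'g::complex_vector) \<Rightarrow> ('g \<Rightarrow> 'v::complex_vector \<Rightarrow> 'v) \<Rightarrow> real" where
  "casimir_scalar X \<rho> = (THE c. \<forall>v. (\<Sum>a\<in>UNIV. \<rho> (X a) (\<rho> (X a) v)) = of_real c *\<^sub>C v)"

definition dual_coxeter ::
  "('g::complex_vector \<Rightarrow> 'g \<Rightarrow> 'g) \<Rightarrow> ('n::finite \<Rightarrow> 'g) \<Rightarrow> real" where
  "dual_coxeter br X = casimir_scalar X br / 2"


section \<open>The boson and fermion algebras and their representations\<close>

definition energy_grading :: "(int \<Rightarrow> 'a::complex_vector set) \<Rightarrow> bool" where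
  "energy_grading E \<longleftrightarrow> (\<forall>j. finite_dim (E j)) \<and> (\<forall>j<0. E j = {0}) \<and>
     cvec.span (\<Union>j. E j) = UNIV \<and>
     (\<forall>J f. finite J \<and> (\<forall>j\<in>J. f j \<in> E j) \<and> (\<Sum>j\<in>J. f j) = 0 \<longrightarrow> (\<forall>j\<in>J. f j = 0))"

text \<open>\<open>X a n\<close> is the action of the n-th mode of the a-th generator; the central element acts by
  \<open>\<l>\<close>.\<close>

definition boson_rep ::
  "('n::finite \<Rightarrow> 'n \<Rightarrow> 'n \<Rightarrow> real) \<Rightarrow> nat \<Rightarrow> ('n \<Rightarrow> int \<Rightarrow> 'h::complex_vector \<Rightarrow> 'h) \<Rightarrow> bool" where
  "boson_rep \<Gamma> \<l> X \<longleftrightarrow> (\<forall>a n. clinear (X a n)) \<and>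
     (\<forall>a b m n v. X a m (X b n v) - X b n (X a m v) =
        \<i> *\<^sub>C (\<Sum>c\<in>UNIV. of_real (\<Gamma> a b c) *\<^sub>C X c (m + n) v) +
        (if a = b \<and> m + n = 0 then (of_int m * of_nat \<l>) *\<^sub>C v else 0))"

text \<open>The module \<open>L(V,\<l>)\<close>, where \<open>V\<close> is the representation \<open>\<rho>\<close> of the Lie algebra with basis
  \<open>Xb\<close>; \<open>\<iota>\<close> identifies \<open>V\<close> with the lowest energy subspace, which is annihilated by the modes
  of positive index because there are no vectors of negative energy.\<close>

definition boson_module ::
  "('n::finite \<Rightarrow> 'g::complex_vector) \<Rightarrow> ('n \<Rightarrow> 'n \<Rightarrow> 'n \<Rightarrow> real) \<Rightarrow>
   ('g \<Rightarrow> 'v::complex_vector \<Rightarrow> 'v) \<Rightarrow> nat \<Rightarrow>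
   ('n \<Rightarrow> int \<Rightarrow> 'h::complex_prehilbert \<Rightarrow> 'h) \<Rightarrow> ('v \<Rightarrow> 'h) \<Rightarrow> bool" where
  "boson_module Xb \<Gamma> \<rho> \<l> X \<iota> \<longleftrightarrow>
     boson_rep \<Gamma> \<l> X \<and> (\<forall>a n. adjoint_pair (X a n) (X a (- n))) \<and>
     irreducible_under {X a n | a n. True} \<and>
     clinear \<iota> \<and> inj \<iota> \<and> (\<forall>a v. \<iota> (\<rho> (Xb a) v) = X a 0 (\<iota> v)) \<and>
     (\<exists>E. energy_grading E \<and> E 0 = range \<iota> \<and> (\<forall>a n j. X a n ` E j \<subseteq> E (j - n)))"

text \<open>Half-integral modes are indexed by integers: \<open>\<psi> a k\<close> has mode number \<open>k + 1/2\<close>, so that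
  \<open>\<psi> a k\<close> is the coefficient of \<open>z\<^sup>-\<^sup>k\<^sup>-\<^sup>1\<close> in the field of \<open>\<psi>\<close>. Taking adjoints sends \<open>k\<close> to
  \<open>- k - 1\<close>. In the grading, \<open>E j\<close> is the space of energy \<open>j / 2\<close>.\<close>

definition fermion_rep :: "('n::finite \<Rightarrow> int \<Rightarrow> 'f::complex_vector \<Rightarrow> 'f) \<Rightarrow> bool" where
  "fermion_rep \<psi> \<longleftrightarrow> (\<forall>a k. clinear (\<psi> a k)) \<and>
     (\<forall>a b k l v. \<psi> a k (\<psi> b l v) + \<psi> b l (\<psi> a k v) = (if a = b \<and> k + l + 1 = 0 then v else 0))"

definition fermion_module ::
  "('n::finite \<Rightarrow> int \<Rightarrow> 'f::complex_prehilbert \<Rightarrow> 'f) \<Rightarrow> 'f \<Rightarrow> bool" where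
  "fermion_module \<psi> \<Omega> \<longleftrightarrow>
     fermion_rep \<psi> \<and> (\<forall>a k. adjoint_pair (\<psi> a k) (\<psi> a (- k - 1))) \<and>
     irreducible_under {\<psi> a k | a k. True} \<and>
     generated_by {\<psi> a k | a k. True} \<Omega> = UNIV \<and>
     cinner \<Omega> \<Omega> = 1 \<and> (\<forall>a. \<forall>k\<ge>0. \<psi> a k \<Omega> = 0) \<and>
     (\<exists>E. energy_grading E \<and> E 0 = cvec.span {\<Omega>} \<and>
        (\<forall>a k j. \<psi> a k ` E j \<subseteq> E (j - (2 * k + 1))))"


section \<open>Algebraic tensor products of prehilbert spaces\<close>

definition tensor_product ::
  "('a::complex_prehilbert \<Rightarrow> 'b::complex_prehilbert \<Rightarrow> 'c::complex_prehilbert) \<Rightarrow> bool" where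
  "tensor_product ten \<longleftrightarrow> cbilinear ten \<and> cvec.span {ten x y | x y. True} = UNIV \<and>
     (\<forall>A B. cvec.independent A \<and> cvec.independent B \<longrightarrow>
        inj_on (\<lambda>(x, y). ten x y) (A \<times> B) \<and>
        cvec.independent ((\<lambda>(x, y). ten x y) ` (A \<times> B))) \<and>
     (\<forall>x x' y y'. cinner (ten x y) (ten x' y') = cinner x x' * cinner y y')"

definition act_fst ::
  "('a::complex_vector \<Rightarrow> 'b::complex_vector \<Rightarrow> 'c::complex_vector) \<Rightarrow> ('a \<Rightarrow> 'a) \<Rightarrow> 'c \<Rightarrow> 'c" where
  "act_fst ten T = (THE T'. clinear T' \<and> (\<forall>x y. T' (ten x y) = ten (T x) y))"

definition act_snd ::
  "('a::complex_vector \<Rightarrow> 'b::complex_vector \<Rightarrow> 'c::complex_vector) \<Rightarrow> ('b \<Rightarrow> 'b) \<Rightarrow> 'c \<Rightarrow> 'c" where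
  "act_snd ten T = (THE T'. clinear T' \<and> (\<forall>x y. T' (ten x y) = ten x (T y)))"


section \<open>Fields\<close>

text \<open>A formal series is given by its coefficients: \<open>A n\<close> is the coefficient of \<open>z\<^sup>-\<^sup>n\<^sup>-\<^sup>1\<close>.\<close>

type_synonym 'a fseries = "int \<Rightarrow> 'a \<Rightarrow> 'a"

definition sbracket :: "nat \<Rightarrow> ('a::complex_vector \<Rightarrow> 'a) \<Rightarrow> ('a \<Rightarrow> 'a) \<Rightarrow> 'a \<Rightarrow> 'a" where
  "sbracket \<epsilon> S T v = S (T v) - ((- 1) ^ \<epsilon>) *\<^sub>C T (S v)"

text \<open>The n-th product of A and B, where \<open>\<epsilon>\<close> is the sign with which A and B are mutually local.
  For negative n the sum over p is infinite, but only finitely many summands do not vanish on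
  a given vector of a positive energy space; \<^const>\<open>Sum_any\<close> sums over these.\<close>

definition field_prod ::
  "nat \<Rightarrow> 'a::complex_vector fseries \<Rightarrow> int \<Rightarrow> 'a fseries \<Rightarrow> 'a fseries" where
  "field_prod \<epsilon> A n B m v =
     (if n \<ge> 0 then
        (\<Sum>p\<le>nat n. ((- 1) ^ p * of_nat (nat n choose p)) *\<^sub>C
            sbracket \<epsilon> (A (n - int p)) (B (m + int p)) v)
      else
        Sum_any (\<lambda>p::nat. of_nat (nat (int p - n - 1) choose p) *\<^sub>C
            (A (n - int p) (B (m + int p) v)
             - ((- 1) powi (int \<epsilon> + n)) *\<^sub>C B (m + n - int p) (A (int p) v))))"

definition S_field ::
  "('n::finite \<Rightarrow> 'n \<Rightarrow> 'n \<Rightarrow> real) \<Rightarrow> ('n \<Rightarrow> 'a::complex_vector fseries) \<Rightarrow> 'n \<Rightarrow> 'a fseries" where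
  "S_field \<Gamma> \<psi> c m v = (- (\<i> / 2)) *\<^sub>C
     (\<Sum>a\<in>UNIV. \<Sum>b\<in>UNIV. of_real (\<Gamma> a b c) *\<^sub>C field_prod 1 (\<psi> a) (-1) (\<psi> b) m v)"

text \<open>\<open>L\<^sub>n\<close> is the coefficient of \<open>z\<^sup>-\<^sup>n\<^sup>-\<^sup>2\<close>, i.e. the one with index \<open>n + 1\<close>. The odd operators are
  indexed like the fermions: \<open>G_op \<dots> r\<close> has mode number \<open>r + 1/2\<close>, and it is the coefficient of
  \<open>z\<^sup>-\<^sup>r\<^sup>-\<^sup>2\<close>, i.e. the one with index \<open>r + 1\<close>.\<close>

definition L_op ::
  "real \<Rightarrow> nat \<Rightarrow> ('n::finite \<Rightarrow> 'a::complex_vector fseries) \<Rightarrow> ('n \<Rightarrow> 'a fseries) \<Rightarrow>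
   int \<Rightarrow> 'a \<Rightarrow> 'a" where
  "L_op g \<l> X \<psi> n v =
     (1 / 2) *\<^sub>C (\<Sum>a\<in>UNIV. field_prod 1 (\<psi> a) (-2) (\<psi> a) (n + 1) v) +
     of_real (1 / (2 * (real \<l> + g))) *\<^sub>C (\<Sum>a\<in>UNIV. field_prod 0 (X a) (-1) (X a) (n + 1) v)"

definition G_op ::
  "('n::finite \<Rightarrow> 'n \<Rightarrow> 'n \<Rightarrow> real) \<Rightarrow> real \<Rightarrow> nat \<Rightarrow>
   ('n \<Rightarrow> 'a::complex_vector fseries) \<Rightarrow> ('n \<Rightarrow> 'a fseries) \<Rightarrow> int \<Rightarrow> 'a \<Rightarrow> 'a" where
  "G_op \<Gamma> g \<l> X \<psi> r v = of_real (1 / sqrt (real \<l> + g)) *\<^sub>C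
     (\<Sum>a\<in>UNIV. field_prod 0 (\<psi> a) (-1) (X a) (r + 1) v +
               (1 / 3) *\<^sub>C field_prod 0 (\<psi> a) (-1) (S_field \<Gamma> \<psi> a) (r + 1) v)"


section \<open>The Neveu-Schwarz algebra\<close>

text \<open>The relations of the Neveu-Schwarz algebra for the operators \<open>L n\<close>, \<open>G r\<close> (mode number
  \<open>r + 1/2\<close>) and \<open>C\<close>, modulo a subspace \<open>K\<close>.\<close>

definition ns_relations ::
  "'a::complex_vector set \<Rightarrow> (int \<Rightarrow> 'a \<Rightarrow> 'a) \<Rightarrow> (int \<Rightarrow> 'a \<Rightarrow> 'a) \<Rightarrow> ('a \<Rightarrow> 'a) \<Rightarrow> bool" where
  "ns_relations K L G C \<longleftrightarrow>
     (\<forall>n v. L n (C v) - C (L n v) \<in> K) \<and>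
     (\<forall>r v. G r (C v) - C (G r v) \<in> K) \<and>
     (\<forall>m n v. L m (L n v) - L n (L m v)
        - (of_int (m - n) *\<^sub>C L (m + n) v
           + (if m + n = 0 then (of_int (m ^ 3 - m) / 12) *\<^sub>C C v else 0)) \<in> K) \<and>
     (\<forall>r n v. G r (L n v) - L n (G r v)
        - ((of_int r + 1 / 2) - of_int n / 2) *\<^sub>C G (r + n) v \<in> K) \<and>
     (\<forall>r s v. G r (G s v) + G s (G r v)
        - (2 *\<^sub>C L (r + s + 1) v
           + (if r + s + 1 = 0 then (((of_int r + 1 / 2) ^ 2 - 1 / 4) / 3) *\<^sub>C C v else 0)) \<in> K)"

definition ns_ops ::
  "(int \<Rightarrow> 'a \<Rightarrow> 'a) \<Rightarrow> (int \<Rightarrow> 'a \<Rightarrow> 'a) \<Rightarrow> ('a \<Rightarrow> 'a) \<Rightarrow> ('a \<Rightarrow> 'a) set" where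
  "ns_ops L G C = range L \<union> range G \<union> {C}"

definition ns_action ::
  "(int \<Rightarrow> 'a::complex_vector \<Rightarrow> 'a) \<Rightarrow> (int \<Rightarrow> 'a \<Rightarrow> 'a) \<Rightarrow> ('a \<Rightarrow> 'a) \<Rightarrow> bool" where
  "ns_action L G C \<longleftrightarrow> (\<forall>T\<in>ns_ops L G C. clinear T) \<and> ns_relations {0} L G C"

definition unitary_ns_action ::
  "(int \<Rightarrow> 'a::complex_prehilbert \<Rightarrow> 'a) \<Rightarrow> (int \<Rightarrow> 'a \<Rightarrow> 'a) \<Rightarrow> ('a \<Rightarrow> 'a) \<Rightarrow> bool" where
  "unitary_ns_action L G C \<longleftrightarrow> ns_action L G C \<and>
     (\<forall>n. adjoint_pair (L n) (L (- n))) \<and> (\<forall>r. adjoint_pair (G r) (G (- r - 1))) \<and>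
     adjoint_pair C C"

text \<open>Vector spaces with operators \<open>L\<^sub>n\<close>, \<open>G\<^sub>r\<close>, \<open>C\<close>, given by an explicit carrier. This makes it
  possible to form quotients by subspaces that depend on parameters.\<close>

record 'a ns_space =
  ns_carrier :: "'a set"
  ns_add :: "'a \<Rightarrow> 'a \<Rightarrow> 'a"
  ns_smult :: "complex \<Rightarrow> 'a \<Rightarrow> 'a"
  ns_L :: "int \<Rightarrow> 'a \<Rightarrow> 'a"
  ns_G :: "int \<Rightarrow> 'a \<Rightarrow> 'a"
  ns_C :: "'a \<Rightarrow> 'a"

definition ns_subspace ::
  "(int \<Rightarrow> 'a::complex_vector \<Rightarrow> 'a) \<Rightarrow> (int \<Rightarrow> 'a \<Rightarrow> 'a) \<Rightarrow> ('a \<Rightarrow> 'a) \<Rightarrow> 'a set \<Rightarrow> 'a ns_space" where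
  "ns_subspace L G C S =
     \<lparr>ns_carrier = S, ns_add = (+), ns_smult = scaleC, ns_L = L, ns_G = G, ns_C = C\<rparr>"

definition ns_isomorphic :: "'a ns_space \<Rightarrow> 'b ns_space \<Rightarrow> bool" where
  "ns_isomorphic M N \<longleftrightarrow> (\<exists>\<phi>. bij_betw \<phi> (ns_carrier M) (ns_carrier N) \<and>
     (\<forall>u\<in>ns_carrier M.
        (\<forall>v\<in>ns_carrier M. \<phi> (ns_add M u v) = ns_add N (\<phi> u) (\<phi> v)) \<and>
        (\<forall>a. \<phi> (ns_smult M a u) = ns_smult N a (\<phi> u)) \<and>
        (\<forall>n. \<phi> (ns_L M n u) = ns_L N n (\<phi> u)) \<and>
        (\<forall>r. \<phi> (ns_G M r u) = ns_G N r (\<phi> u)) \<and>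
        \<phi> (ns_C M u) = ns_C N (\<phi> u)))"

text \<open>The operations of a quotient are defined on representatives: if \<open>K\<close> is invariant, the unions
  below are unions of a single coset.\<close>

definition ns_coset :: "'a ns_space \<Rightarrow> 'a set \<Rightarrow> 'a \<Rightarrow> 'a set" where
  "ns_coset M K v = {ns_add M v k | k. k \<in> K}"

definition ns_quotient :: "'a ns_space \<Rightarrow> 'a set \<Rightarrow> 'a set ns_space" where
  "ns_quotient M K =
     \<lparr>ns_carrier = ns_coset M K ` ns_carrier M,
      ns_add = (\<lambda>A B. \<Union>u\<in>A. \<Union>v\<in>B. ns_coset M K (ns_add M u v)),
      ns_smult = (\<lambda>a A. \<Union>u\<in>A. ns_coset M K (ns_smult M a u)),
      ns_L = (\<lambda>n A. \<Union>u\<in>A. ns_coset M K (ns_L M n u)),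
      ns_G = (\<lambda>r A. \<Union>u\<in>A. ns_coset M K (ns_G M r u)),
      ns_C = (\<lambda>A. \<Union>u\<in>A. ns_coset M K (ns_C M u))\<rparr>"


subsection \<open>Verma modules and their irreducible quotients\<close>

instantiation complex :: complex_vector
begin
definition scaleC_complex :: "complex \<Rightarrow> complex \<Rightarrow> complex" where
  "scaleC_complex a x = a * x"
instance by standard (simp_all add: scaleC_complex_def algebra_simps)
end

instantiation poly_mapping :: (type, complex_vector) complex_vector
begin
definition scaleC_poly_mapping :: "complex \<Rightarrow> ('a \<Rightarrow>\<^sub>0 'b) \<Rightarrow> ('a \<Rightarrow>\<^sub>0 'b)" where
  "scaleC_poly_mapping a = Poly_Mapping.map (scaleC a)"
instance
proof -
  have [simp]: "Poly_Mapping.lookup (a *\<^sub>C x) k = a *\<^sub>C Poly_Mapping.lookup x k" for a and x :: "'a \<Rightarrow>\<^sub>0 'b" and k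
    by (simp add: scaleC_poly_mapping_def Poly_Mapping.map.rep_eq when_def)
  show "OFCLASS('a \<Rightarrow>\<^sub>0 'b, complex_vector_class)"
    by standard (rule poly_mapping_eqI,
      simp add: lookup_add scaleC_add_right scaleC_add_left scaleC_scaleC scaleC_one)+
qed
end

text \<open>The free vector space on the words in the generators, i.e. the free associative algebra,
  on which a generator acts by left multiplication.\<close>

datatype ns_gen = Lgen int | Ggen int | Cgen

type_synonym ns_free = "ns_gen list \<Rightarrow>\<^sub>0 complex"

definition left_mult :: "ns_gen \<Rightarrow> ns_free \<Rightarrow> ns_free" where
  "left_mult x t = (\<Sum>w\<in>Poly_Mapping.keys t. Poly_Mapping.single (x # w) (Poly_Mapping.lookup t w))"

definition free_one :: ns_free where
  "free_one = Poly_Mapping.single [] 1"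

abbreviation "free_L \<equiv> \<lambda>n. left_mult (Lgen n)"
abbreviation "free_G \<equiv> \<lambda>r. left_mult (Ggen r)"
abbreviation "free_C \<equiv> left_mult Cgen"

text \<open>The Verma module is the quotient of the free algebra by the smallest left ideal modulo which
  the relations of the Neveu-Schwarz algebra hold and the class of 1 satisfies the defining
  conditions of the generating vector.\<close>

definition verma_ideal :: "real \<Rightarrow> real \<Rightarrow> ns_free set" where
  "verma_ideal c h = \<Inter>{K. invariant_under (ns_ops free_L free_G free_C) K \<and>
     ns_relations K free_L free_G free_C \<and>
     free_L 0 free_one - of_real h *\<^sub>C free_one \<in> K \<and>
     free_C free_one - of_real c *\<^sub>C free_one \<in> K \<and>
     (\<forall>n>0. free_L n free_one \<in> K) \<and> (\<forall>r\<ge>0. free_G r free_one \<in> K)}"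

definition verma :: "real \<Rightarrow> real \<Rightarrow> ns_free set ns_space" where
  "verma c h = ns_quotient (ns_subspace free_L free_G free_C UNIV) (verma_ideal c h)"

definition verma_vector :: "real \<Rightarrow> real \<Rightarrow> ns_free set" where
  "verma_vector c h = ns_coset (ns_subspace free_L free_G free_C UNIV) (verma_ideal c h) free_one"

definition canonical_form :: "'a ns_space \<Rightarrow> 'a \<Rightarrow> ('a \<Rightarrow> 'a \<Rightarrow> complex) \<Rightarrow> bool" where
  "canonical_form M \<Omega> B \<longleftrightarrow> B \<Omega> \<Omega> = 1 \<and>
     (\<forall>u\<in>ns_carrier M. \<forall>v\<in>ns_carrier M.
        (\<forall>w\<in>ns_carrier M. B (ns_add M u v) w = B u w + B v w \<and>
                           B w (ns_add M u v) = B w u + B w v) \<and>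
        (\<forall>a. B (ns_smult M a u) v = a * B u v \<and> B u (ns_smult M a v) = cnj a * B u v) \<and>
        (\<forall>n. B (ns_L M n u) v = B u (ns_L M (- n) v)) \<and>
        (\<forall>r. B (ns_G M r u) v = B u (ns_G M (- r - 1) v)) \<and>
        B (ns_C M u) v = B u (ns_C M v))"

text \<open>The canonical form is unique on the carrier of the Verma module.\<close>

definition verma_form :: "real \<Rightarrow> real \<Rightarrow> ns_free set \<Rightarrow> ns_free set \<Rightarrow> complex" where
  "verma_form c h = (SOME B. canonical_form (verma c h) (verma_vector c h) B)"

definition verma_kernel :: "real \<Rightarrow> real \<Rightarrow> ns_free set set" where
  "verma_kernel c h = {u \<in> ns_carrier (verma c h).
     \<forall>v\<in>ns_carrier (verma c h). verma_form c h u v = 0}"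

definition ns_irreducible :: "real \<Rightarrow> real \<Rightarrow> ns_free set set ns_space" where
  "ns_irreducible c h = ns_quotient (verma c h) (verma_kernel c h)"

end

theory Submission
  imports Defs "HOL-Computational_Algebra.Fundamental_Theorem_Algebra"
begin

text \<open>The brackets of \<open>L n\<close> and \<open>G r\<close> with the fermions \<open>\<psi>\<close> are computed directly; in particular
  \<open>{G, \<psi>}\<close> is, up to a factor, the total current \<open>J = X + S\<close>. Everything else is soft. Since
  \<open>[G, J]\<close> and \<open>[G, L]\<close> are odd, they are determined by their anticommutators with the fermions.
  Consequently \<open>D r s = {G r, G s} - 2 L\<close> commutes with all \<open>X\<close> and \<open>\<psi>\<close>, hence with \<open>L 0\<close>,
  and being homogeneous it vanishes off the diagonal. Bracketing with \<open>L m\<close> gives a recursion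
  for the diagonal terms, whose two initial values are read off lowest energy vectors, and then
  also \<open>[L, L]\<close>. For the cyclic module, the inner product pulls back to a canonical form on the
  Verma module, and there is only one; as the inner product is definite, its kernel is the kernel
  of the map from the Verma module.\<close>

section \<open>Normally ordered products of fields\<close>

text \<open>\<open>G\<close> is cubic in the fermions, so expanding \<open>{G, G}\<close> would mean
  reordering products of six modes. The shape of the proof comes from avoiding this: explicit
  computations bracket only with operators that act linearly on the modes, up to scalars
  (\<open>\<psi>\<close>, \<open>X\<close>, \<open>S\<close>). Such a bracket maps a normally
  ordered sum to normally ordered sums whose cutoff has moved by finitely many places. What replaces
  the expansion is positivity together with cyclicity. A defect operator that supercommutes with
  enough modes is determined by its values on a few vectors; if it is odd, definiteness of the inner
  product forces these values to vanish, and if it is even, they are computed on lowest energy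
  vectors, where almost every mode acts by zero. Positivity also carries the grading identity for
  \<open>L n\<close> from positive to negative \<open>n\<close> by adjunction. The numbers
  \<open>h\<close> and \<open>c\<close> therefore enter only through two evaluations on such
  vectors: the Casimir operator gives \<open>h\<close>, and \<open>L 2 (L (- 2) u)\<close> gives
  \<open>c\<close>.\<close>

lemma clinearI:
  assumes "\<And>x y. T (x + y) = T x + T y" and "\<And>a x. T (a *\<^sub>C x) = a *\<^sub>C T x"
  shows "clinear T"
  by (unfold_locales) (use assms in auto)

lemma clinear_add: "clinear T \<Longrightarrow> T (x + y) = T x + T y"
  and clinear_scaleC: "clinear T \<Longrightarrow> T (a *\<^sub>C x) = a *\<^sub>C T x"
  and clinear_zero: "clinear T \<Longrightarrow> T 0 = 0"
  and clinear_diff: "clinear T \<Longrightarrow> T (x - y) = T x - T y"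
  and clinear_uminus: "clinear T \<Longrightarrow> T (- x) = - T x"
  and clinear_sum: "clinear T \<Longrightarrow> T (\<Sum>i\<in>I. F i) = (\<Sum>i\<in>I. T (F i))"
  by (auto simp: linear_iff_module_hom module_hom.add module_hom.scale module_hom.zero
    module_hom.diff module_hom.neg module_hom.sum)

lemmas clinear_simps = clinear_add clinear_scaleC clinear_zero clinear_diff clinear_uminus clinear_sum

definition field :: "'a::complex_vector fseries \<Rightarrow> bool" where
  "field A \<longleftrightarrow> (\<forall>j. clinear (A j)) \<and> (\<forall>v. \<exists>M. \<forall>j\<ge>M. A j v = 0)"

lemma field_linear: "field A \<Longrightarrow> clinear (A j)"
  by (simp add: field_def)

lemma field_bound:
  assumes "field A" obtains M where "\<And>j. j \<ge> M \<Longrightarrow> A j v = 0"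
  using assms unfolding field_def by blast

lemma fieldI:
  assumes "\<And>j. clinear (A j)" and "\<And>v. \<exists>M. \<forall>j\<ge>M. A j v = 0"
  shows "field A"
  using assms by (simp add: field_def)

definition nterm :: "complex \<Rightarrow> 'a::complex_vector fseries \<Rightarrow> 'a fseries \<Rightarrow> (int \<Rightarrow> complex) \<Rightarrow>
    int \<Rightarrow> int \<Rightarrow> 'a \<Rightarrow> int \<Rightarrow> 'a" where
  "nterm \<sigma> A B f c N v j =
     f j *\<^sub>C (if j < c then A j (B (N - j) v) else \<sigma> *\<^sub>C B (N - j) (A j v))"

text \<open>The modes of the two factors add up to \<open>N\<close>. A mode of \<open>A\<close> acts last iff its index is below
  the cutoff \<open>c\<close>, and \<open>\<sigma>\<close> is the sign of the transposition. Reindexing a sum shifts \<open>c\<close>; the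
  anomalous terms of all commutators below arise from moving it back to its original position.\<close>

definition nop :: "complex \<Rightarrow> 'a::complex_vector fseries \<Rightarrow> 'a fseries \<Rightarrow> (int \<Rightarrow> complex) \<Rightarrow>
    int \<Rightarrow> int \<Rightarrow> 'a \<Rightarrow> 'a" where
  "nop \<sigma> A B f c N v = Sum_any (nterm \<sigma> A B f c N v)"

abbreviation nop1 where "nop1 \<sigma> A B \<equiv> nop \<sigma> A B (\<lambda>j. 1) 0"

text \<open>On both sides of the cutoff, the mode acting first has large index far out: below
  \<open>c\<close> it is \<open>N - j\<close>, from \<open>c\<close> on it is \<open>j\<close>.
  Local finiteness of the two fields then leaves finitely many terms.\<close>

lemma nterm_finite:
  assumes "field A" "field B"
  shows "finite {j. nterm \<sigma> A B f c N v j \<noteq> 0}"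
proof -
  obtain M where M: "\<And>j. j \<ge> M \<Longrightarrow> A j v = 0" by (rule field_bound[OF assms(1), of v]) auto
  obtain K where K: "\<And>j. j \<ge> K \<Longrightarrow> B j v = 0" by (rule field_bound[OF assms(2), of v]) auto
  have "{j. nterm \<sigma> A B f c N v j \<noteq> 0} \<subseteq> {N - K..M} \<union> {c..M} \<union> {N - K..c}"
  proof
    fix j assume "j \<in> {j. nterm \<sigma> A B f c N v j \<noteq> 0}"
    then have j: "nterm \<sigma> A B f c N v j \<noteq> 0" by simp
    show "j \<in> {N - K..M} \<union> {c..M} \<union> {N - K..c}"
    proof (cases "j < c")
      case True
      then have "B (N - j) v \<noteq> 0"
        using j by (auto simp: nterm_def clinear_zero[OF field_linear[OF assms(1)]])
      then have "N - j < K" using K by (meson not_le)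
      then show ?thesis using True by auto
    next
      case False
      then have "A j v \<noteq> 0"
        using j by (auto simp: nterm_def clinear_zero[OF field_linear[OF assms(2)]])
      then have "j < M" using M by (meson not_le)
      then show ?thesis using False by auto
    qed
  qed
  then show ?thesis by (rule finite_subset) auto
qed

lemma Sum_any_scaleC:
  fixes f :: "'b \<Rightarrow> 'a::complex_vector"
  shows "Sum_any (\<lambda>j. k *\<^sub>C f j) = k *\<^sub>C Sum_any f"
proof (cases "k = 0")
  case False
  then have "{j. k *\<^sub>C f j \<noteq> 0} = {j. f j \<noteq> 0}" by auto
  then show ?thesis by (simp add: Sum_any.expand_set cvec.scale_sum_right)
qed simp

lemma Sum_any_clinear:
  assumes "clinear T" "finite {j. f j \<noteq> 0}"
  shows "T (Sum_any f) = Sum_any (\<lambda>j. T (f j))"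
proof -
  have "Sum_any (\<lambda>j. T (f j)) = (\<Sum>j | f j \<noteq> 0. T (f j))"
    using assms by (intro Sum_any.expand_superset) (auto simp: clinear_zero)
  then show ?thesis
    using assms(1) by (simp add: Sum_any.expand_set clinear_sum)
qed

lemma Sum_any_reindex:
  assumes "bij h"
  shows "Sum_any (\<lambda>j. f (h j)) = Sum_any f"
proof -
  have "f \<circ> h = (\<lambda>j. f (h j))" by auto
  then show ?thesis
    using Sum_any.reindex_cong[OF assms, of f "\<lambda>j. f (h j)"] by simp
qed

lemma Sum_any_mem:
  assumes "cvec.subspace U" "\<And>j. f j \<in> U"
  shows "Sum_any f \<in> U"
  using assms by (auto simp: Sum_any.expand_set intro: cvec.subspace_sum)

lemma nop_clinear:
  assumes "field A" "field B"
  shows "clinear (nop \<sigma> A B f c N)"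
proof (rule clinearI)
  note lin = clinear_simps[OF field_linear[OF assms(1)]] clinear_simps[OF field_linear[OF assms(2)]]
  note fin = nterm_finite[OF assms, of \<sigma> f c N]
  fix x y k
  have "nterm \<sigma> A B f c N (x + y) = (\<lambda>j. nterm \<sigma> A B f c N x j + nterm \<sigma> A B f c N y j)"
    by (auto simp: nterm_def lin algebra_simps)
  then show "nop \<sigma> A B f c N (x + y) = nop \<sigma> A B f c N x + nop \<sigma> A B f c N y"
    using Sum_any.distrib[OF fin fin] by (simp add: nop_def)
  have "nterm \<sigma> A B f c N (k *\<^sub>C x) = (\<lambda>j. k *\<^sub>C nterm \<sigma> A B f c N x j)"
    by (auto simp: nterm_def lin mult_ac)
  then show "nop \<sigma> A B f c N (k *\<^sub>C x) = k *\<^sub>C nop \<sigma> A B f c N x"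
    by (simp add: nop_def Sum_any_scaleC)
qed

lemma nop_mem:
  assumes "cvec.subspace U" "\<And>j. A j (B (N - j) v) \<in> U" "\<And>j. B (N - j) (A j v) \<in> U"
  shows "nop \<sigma> A B f c N v \<in> U"
  unfolding nop_def
  by (rule Sum_any_mem) (auto simp: nterm_def assms cvec.subspace_scale)

lemma nop_eq_0:
  assumes "\<And>j. j < c \<Longrightarrow> f j *\<^sub>C A j (B (N - j) v) = 0" "\<And>j. j \<ge> c \<Longrightarrow> f j *\<^sub>C B (N - j) (A j v) = 0"
  shows "nop \<sigma> A B f c N v = 0"
proof -
  have "nterm \<sigma> A B f c N v j = 0" for j
    using assms[of j] by (auto simp: nterm_def)
  then show ?thesis unfolding nop_def by simp
qed

lemma nop_finite_sum:
  assumes "finite F" "\<And>j. j \<notin> F \<Longrightarrow> nterm \<sigma> A B f c N v j = 0"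
  shows "nop \<sigma> A B f c N v = (\<Sum>j\<in>F. nterm \<sigma> A B f c N v j)"
  unfolding nop_def using assms by (intro Sum_any.expand_superset) auto

text \<open>\<open>Q\<close> need not be homogeneous: only its commutation rules with the two fields matter, and the
  signs in them may differ.\<close>

lemma nop_comm:
  assumes A: "field A" and B: "field B" and A': "field A'" and B': "field B'" and Q: "clinear Q"
    and QA: "\<And>j w. Q (A j w) = \<tau>A *\<^sub>C A j (Q w) + A' j w"
    and QB: "\<And>j w. Q (B j w) = \<tau>B *\<^sub>C B j (Q w) + B' j w"
    and \<tau>: "\<tau>A * \<tau>A = 1"
  shows "Q (nop \<sigma> A B f c N v) = (\<tau>A * \<tau>B) *\<^sub>C nop \<sigma> A B f c N (Q v)
     + nop (\<sigma> * \<tau>B) A' B f c N v + \<tau>A *\<^sub>C nop (\<sigma> * \<tau>A) A B' f c N v"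
proof -
  let ?t1 = "nterm \<sigma> A B f c N (Q v)" and ?t2 = "nterm (\<sigma> * \<tau>B) A' B f c N v"
    and ?t3 = "nterm (\<sigma> * \<tau>A) A B' f c N v"
  note lin = clinear_add[OF field_linear[OF A]] clinear_scaleC[OF field_linear[OF A]]
    clinear_add[OF field_linear[OF B]] clinear_scaleC[OF field_linear[OF B]]
  have e: "Q (nterm \<sigma> A B f c N v j) = (\<tau>A * \<tau>B) *\<^sub>C ?t1 j + ?t2 j + \<tau>A *\<^sub>C ?t3 j" for j
  proof (cases "j < c")
    case True
    then show ?thesis
      by (simp add: nterm_def clinear_scaleC[OF Q] QA QB lin scaleC_add_right scaleC_scaleC mult_ac add_ac)
  next
    case False
    moreover have "\<tau>A * (\<sigma> * (\<tau>A * f j)) = \<sigma> * f j"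
      using \<tau> by (metis mult.assoc mult.commute mult_1)
    ultimately show ?thesis
      by (simp add: nterm_def clinear_scaleC[OF Q] QA QB lin scaleC_add_right scaleC_scaleC mult_ac add_ac)
  qed
  have fin: "finite {j. k *\<^sub>C nterm \<sigma>' C D f c N w j \<noteq> 0}" if "field C" "field D" for k \<sigma>' w C D
    by (rule finite_subset[OF _ nterm_finite[OF that]]) auto
  note f1 = fin[OF A B, of "\<tau>A * \<tau>B" \<sigma> "Q v"] and f2 = nterm_finite[OF A' B, of "\<sigma> * \<tau>B" f c N v]
    and f3 = fin[OF A B', of "\<tau>A" "\<sigma> * \<tau>A" v]
  have f12: "finite {j. (\<tau>A * \<tau>B) *\<^sub>C ?t1 j + ?t2 j \<noteq> 0}"
    by (rule finite_subset[OF _ finite_UnI[OF f1 f2]]) auto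
  have "Q (nop \<sigma> A B f c N v) = Sum_any (\<lambda>j. (\<tau>A * \<tau>B) *\<^sub>C ?t1 j + ?t2 j + \<tau>A *\<^sub>C ?t3 j)"
    unfolding nop_def Sum_any_clinear[OF Q nterm_finite[OF A B]] e ..
  then show ?thesis
    unfolding Sum_any.distrib[OF f12 f3] Sum_any.distrib[OF f1 f2] Sum_any_scaleC nop_def .
qed

lemma nop_commute:
  assumes "field A" "field B" "clinear Q"
    and "\<tau>A * \<tau>A = 1"
    and "\<And>j w. Q (A j w) = \<tau>A *\<^sub>C A j (Q w)" and "\<And>j w. Q (B j w) = \<tau>B *\<^sub>C B j (Q w)"
  shows "Q (nop \<sigma> A B f c N v) = (\<tau>A * \<tau>B) *\<^sub>C nop \<sigma> A B f c N (Q v)"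
proof -
  have "field (\<lambda>j v. 0 :: 'a)" by (auto simp: field_def intro: clinearI)
  moreover have "nop \<sigma>' (\<lambda>j v. 0) B f c N v = 0" "nop \<sigma>' A (\<lambda>j v. 0) f c N v = 0" for \<sigma>'
    using assms(1,2) by (auto intro!: nop_eq_0 simp: clinear_zero field_linear)
  ultimately show ?thesis
    using nop_comm[OF assms(1,2) _ _ assms(3), of "\<lambda>j v. 0" "\<lambda>j v. 0" \<tau>A \<tau>B \<sigma> f c N v] assms(4-6)
    by simp
qed

lemma nop_shift_left:
  "nop \<sigma> (\<lambda>j. A (j + m)) B f c N v = nop \<sigma> A B (\<lambda>j. f (j - m)) (c + m) (N + m) v"
proof -
  have "bij (\<lambda>j. j + m)"
    by (rule bijI) (auto simp: inj_def surj_def intro: exI[of _ "_ - m"])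
  moreover have "nterm \<sigma> A B (\<lambda>j. f (j - m)) (c + m) (N + m) v (j + m) =
      nterm \<sigma> (\<lambda>j. A (j + m)) B f c N v j" for j
  proof -
    have "N + m - (j + m) = N - j" by simp
    then show ?thesis by (simp only: nterm_def) simp
  qed
  ultimately show ?thesis
    using Sum_any_reindex[of "\<lambda>j. j + m" "nterm \<sigma> A B (\<lambda>j. f (j - m)) (c + m) (N + m) v"]
    by (simp add: nop_def)
qed

lemma nop_shift_right:
  "nop \<sigma> A (\<lambda>j. B (j + m)) f c N v = nop \<sigma> A B f c (N + m) v"
proof -
  have e: "N - j + m = N + m - j" for j by simp
  have "nterm \<sigma> A (\<lambda>j. B (j + m)) f c N v = nterm \<sigma> A B f c (N + m) v"
    by (rule ext) (simp only: nterm_def e)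
  then show ?thesis by (simp add: nop_def)
qed

lemma nop_scale_left:
  assumes "field B"
  shows "nop \<sigma> (\<lambda>j v. g j *\<^sub>C A j v) B f c N v = nop \<sigma> A B (\<lambda>j. f j * g j) c N v"
proof -
  have "nterm \<sigma> (\<lambda>j v. g j *\<^sub>C A j v) B f c N v = nterm \<sigma> A B (\<lambda>j. f j * g j) c N v"
    by (rule ext) (simp add: nterm_def clinear_scaleC[OF field_linear[OF assms]] mult_ac)
  then show ?thesis by (simp add: nop_def)
qed

lemma nop_scale_right:
  assumes "field A"
  shows "nop \<sigma> A (\<lambda>j v. g j *\<^sub>C B j v) f c N v = nop \<sigma> A B (\<lambda>j. f j * g (N - j)) c N v"
proof -
  have "nterm \<sigma> A (\<lambda>j v. g j *\<^sub>C B j v) f c N v = nterm \<sigma> A B (\<lambda>j. f j * g (N - j)) c N v"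
    by (rule ext) (simp add: nterm_def clinear_scaleC[OF field_linear[OF assms]] mult_ac)
  then show ?thesis by (simp add: nop_def)
qed

lemma nop_scale: "nop \<sigma> A B (\<lambda>j. k * f j) c N v = k *\<^sub>C nop \<sigma> A B f c N v"
  unfolding nop_def by (subst Sum_any_scaleC[symmetric]) (simp add: nterm_def)

lemma nop_addI:
  assumes "field A1" "field B1" "field A2" "field B2"
    and "\<And>j. nterm \<sigma> A B f c N v j = nterm \<sigma> A1 B1 f1 c N v j + nterm \<sigma> A2 B2 f2 c N v j"
  shows "nop \<sigma> A B f c N v = nop \<sigma> A1 B1 f1 c N v + nop \<sigma> A2 B2 f2 c N v"
  unfolding nop_def ext[of "nterm \<sigma> A B f c N v", OF assms(5)]
  by (rule Sum_any.distrib; rule nterm_finite; rule assms)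

lemma nop_weight_add:
  assumes "field A" "field B"
  shows "nop \<sigma> A B (\<lambda>j. f j + g j) c N v = nop \<sigma> A B f c N v + nop \<sigma> A B g c N v"
  by (rule nop_addI) (simp_all add: assms nterm_def scaleC_add_left)

text \<open>The reflection \<open>j -> N - j\<close> exchanges the two factors, and
  \<open>j < c\<close> turns into \<open>N - j \<ge> N - c + 1\<close>; this is the new
  cutoff.\<close>

lemma nop_swap:
  assumes "\<sigma> * \<sigma> = 1"
  shows "nop \<sigma> A B f c N v = \<sigma> *\<^sub>C nop \<sigma> B A (\<lambda>j. f (N - j)) (N - c + 1) N v"
proof -
  have b: "bij (\<lambda>j. N - j)"
    by (rule bijI) (auto simp: inj_def surj_def intro: exI[of _ "N - _"])
  have \<sigma>: "\<sigma> * (\<sigma> * k) = k" for k using assms by (metis mult.assoc mult_1)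
  have "nterm \<sigma> A B f c N v (N - j) = \<sigma> *\<^sub>C nterm \<sigma> B A (\<lambda>j. f (N - j)) (N - c + 1) N v j" for j
    using \<sigma> by (simp add: nterm_def scaleC_scaleC mult_ac)
  with Sum_any_reindex[OF b, of "nterm \<sigma> A B f c N v"] show ?thesis
    by (simp add: nop_def Sum_any_scaleC)
qed

text \<open>Only the term at \<open>c\<close> changes its order, which costs one
  supercommutator.\<close>

lemma nop_cutoff_Suc:
  assumes "field A" "field B"
  shows "nop \<sigma> A B f (c + 1) N v =
    nop \<sigma> A B f c N v + f c *\<^sub>C (A c (B (N - c) v) - \<sigma> *\<^sub>C B (N - c) (A c v))"
proof -
  have e: "nterm \<sigma> A B f (c + 1) N v j = nterm \<sigma> A B f c N v j +
     (if j = c then f c *\<^sub>C (A c (B (N - c) v) - \<sigma> *\<^sub>C B (N - c) (A c v)) else 0)" for j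
    by (auto simp: nterm_def algebra_simps)
  have "finite {j. (if j = c then f c *\<^sub>C (A c (B (N - c) v) - \<sigma> *\<^sub>C B (N - c) (A c v)) else 0) \<noteq> 0}"
    by (rule finite_subset[of _ "{c}"]) auto
  then show ?thesis
    unfolding nop_def e using nterm_finite[OF assms] by (subst Sum_any.distrib) auto
qed

text \<open>If the supercommutator is the same at every index, each step contributes equally, so a
  shift by \<open>m\<close> costs \<open>m\<close> times as much. This is the common origin of the
  factors \<open>m\<close> in central terms and in the renormalization of the level.\<close>

lemma nop_cutoff:
  assumes "field A" "field B"
    and K: "\<And>j. f j *\<^sub>C (A j (B (N - j) v) - \<sigma> *\<^sub>C B (N - j) (A j v)) = K"
  shows "nop \<sigma> A B f (c + m) N v = nop \<sigma> A B f c N v + of_int m *\<^sub>C K"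
proof -
  have nat: "nop \<sigma> A B f (c + int n) N v = nop \<sigma> A B f c N v + of_nat n *\<^sub>C K" for n c
  proof (induction n)
    case (Suc n)
    then show ?case
      using nop_cutoff_Suc[OF assms(1,2), of \<sigma> f "c + int n" N v] K[of "c + int n"]
      by (simp add: algebra_simps ac_simps)
  qed simp
  show ?thesis
  proof (cases "m \<ge> 0")
    case True then show ?thesis using nat[of c "nat m"] by simp
  next
    case False
    then show ?thesis using nat[of "c + m" "nat (- m)"] by (simp add: algebra_simps)
  qed
qed

lemma field_shift: "field A \<Longrightarrow> field (\<lambda>j. A (j + m))"
  unfolding field_def
proof (intro conjI allI; elim conjE)
  fix v assume "\<forall>v. \<exists>M. \<forall>j\<ge>M. A j v = 0"
  then obtain M where "\<forall>j\<ge>M. A j v = 0" by blast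
  then show "\<exists>M. \<forall>j\<ge>M. A (j + m) v = 0" by (intro exI[of _ "M - m"]) auto
qed simp

lemma field_scale: "field A \<Longrightarrow> field (\<lambda>j v. g j *\<^sub>C A j v)"
  unfolding field_def
proof (intro conjI allI; elim conjE)
  fix v assume "\<forall>v. \<exists>M. \<forall>j\<ge>M. A j v = 0"
  then show "\<exists>M. \<forall>j\<ge>M. g j *\<^sub>C A j v = 0" by (metis cvec.scale_zero_right)
next
  fix j assume "\<forall>j. clinear (A j)"
  then show "clinear (\<lambda>v. g j *\<^sub>C A j v)"
    by (intro clinearI) (simp_all add: clinear_simps algebra_simps mult_ac)
qed

lemma field_add:
  assumes "field A" "field B" shows "field (\<lambda>j v. A j v + B j v)"
proof (rule fieldI)
  show "clinear (\<lambda>v. A j v + B j v)" for j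
    using assms by (auto intro!: clinearI simp: clinear_simps field_linear algebra_simps)
  fix v
  obtain M where M: "\<And>j. j \<ge> M \<Longrightarrow> A j v = 0" by (rule field_bound[OF assms(1), of v]) auto
  obtain K where K: "\<And>j. j \<ge> K \<Longrightarrow> B j v = 0" by (rule field_bound[OF assms(2), of v]) auto
  show "\<exists>M. \<forall>j\<ge>M. A j v + B j v = 0"
    using M K by (intro exI[of _ "max M K"]) auto
qed

lemma field_zero: "field (\<lambda>j v. 0)"
  by (auto simp: field_def intro: clinearI)

lemma field_sum:
  assumes "\<And>a. a \<in> I \<Longrightarrow> field (A a)" shows "field (\<lambda>j v. \<Sum>a\<in>I. A a j v)"
  using assms by (induction I rule: infinite_finite_induct) (auto intro: field_zero field_add)

lemma field_delta: "field (\<lambda>j v. if j = j0 then k *\<^sub>C v else 0)"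
proof (rule fieldI)
  show "clinear (\<lambda>v. if j = j0 then k *\<^sub>C v else 0)" for j
    by (auto intro!: clinearI simp: algebra_simps mult_ac)
  show "\<exists>M. \<forall>j\<ge>M. (if j = j0 then k *\<^sub>C v else 0) = 0" for v
    by (rule exI[of _ "j0 + 1"]) auto
qed

lemma field_nop:
  assumes "field A" "field B" shows "field (\<lambda>n. nop \<sigma> A B f c (n + k))"
proof (rule fieldI)
  show "clinear (nop \<sigma> A B f c (n + k))" for n by (rule nop_clinear[OF assms])
  fix v
  obtain M where M: "\<And>j. j \<ge> M \<Longrightarrow> A j v = 0" by (rule field_bound[OF assms(1), of v]) auto
  obtain K where K: "\<And>j. j \<ge> K \<Longrightarrow> B j v = 0" by (rule field_bound[OF assms(2), of v]) auto
  have "\<exists>K. \<forall>i\<ge>K. B i (A j v) = 0" for j using assms(2) by (auto simp: field_def)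
  then obtain H where H: "\<And>j i. i \<ge> H j \<Longrightarrow> B i (A j v) = 0" by metis
  \<comment> \<open>The index beyond which \<open>B\<close> kills \<open>A j v\<close> depends on
    \<open>j\<close>, but only the finitely many \<open>j\<close> between \<open>c\<close> and
    \<open>M\<close> matter. As \<open>B\<close> has index \<open>n + k - j\<close>, the bound to be
    exceeded is \<open>H j + j\<close>.\<close>
  define R where "R = Max (insert 0 ((\<lambda>j. H j + j) ` {c..M}))"
  have R: "H j + j \<le> R" if "c \<le> j" "j \<le> M" for j unfolding R_def using that by (intro Max_ge) auto
  have "nop \<sigma> A B f c (n + k) v = 0" if "n \<ge> max (R - k) (K + c - k)" for n
  proof (rule nop_eq_0)
    show "f j *\<^sub>C A j (B (n + k - j) v) = 0" if "j < c" for j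
      using K[of "n + k - j"] that \<open>n \<ge> _\<close> by (simp add: clinear_zero[OF field_linear[OF assms(1)]])
    show "f j *\<^sub>C B (n + k - j) (A j v) = 0" if "j \<ge> c" for j
    proof (cases "j \<le> M")
      case True
      then show ?thesis using H[of j "n + k - j"] R[of j] that \<open>n \<ge> _\<close> by simp
    next
      case False
      then show ?thesis using M[of j] by (simp add: clinear_zero[OF field_linear[OF assms(2)]])
    qed
  qed
  then show "\<exists>M. \<forall>n\<ge>M. nop \<sigma> A B f c (n + k) v = 0" by blast
qed

lemma nop_add_left:
  assumes "field A" "field A'" "field B"
  shows "nop \<sigma> (\<lambda>j v. A j v + A' j v) B f c N v = nop \<sigma> A B f c N v + nop \<sigma> A' B f c N v"
  by (rule nop_addI) (simp_all add: assms nterm_def clinear_add[OF field_linear[OF assms(3)]] scaleC_add_right)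

lemma nop_add_right:
  assumes "field A" "field B" "field B'"
  shows "nop \<sigma> A (\<lambda>j v. B j v + B' j v) f c N v = nop \<sigma> A B f c N v + nop \<sigma> A B' f c N v"
  by (rule nop_addI) (simp_all add: assms nterm_def clinear_add[OF field_linear[OF assms(1)]] scaleC_add_right)

lemma nop_zero_left: "field B \<Longrightarrow> nop \<sigma> (\<lambda>j v. 0) B f c N v = 0"
  and nop_zero_right: "field A \<Longrightarrow> nop \<sigma> A (\<lambda>j v. 0) f c N v = 0"
  by (auto intro!: nop_eq_0 simp: clinear_zero field_linear)

lemma nop_sum_left:
  assumes "\<And>a. a \<in> I \<Longrightarrow> field (A a)" "field B"
  shows "nop \<sigma> (\<lambda>j v. \<Sum>a\<in>I. A a j v) B f c N v = (\<Sum>a\<in>I. nop \<sigma> (A a) B f c N v)"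
  using assms by (induction I rule: infinite_finite_induct) (auto simp: nop_zero_left nop_add_left field_sum)

lemma nop_sum_right:
  assumes "field A" "\<And>a. a \<in> I \<Longrightarrow> field (B a)"
  shows "nop \<sigma> A (\<lambda>j v. \<Sum>a\<in>I. B a j v) f c N v = (\<Sum>a\<in>I. nop \<sigma> A (B a) f c N v)"
  using assms by (induction I rule: infinite_finite_induct) (auto simp: nop_zero_right nop_add_right field_sum)

lemma field_comb:
  assumes "\<And>c. field (A c)" shows "field (\<lambda>j w. \<Sum>c\<in>I. k c *\<^sub>C A c (j + m) w)"
  by (intro field_sum field_scale field_shift assms)

lemma nop_comb_left:
  assumes A: "\<And>c. field (A c)" and B: "field B"
  shows "nop \<sigma> (\<lambda>j w. \<Sum>c\<in>I. k c *\<^sub>C A c (j + m) w) B f s N v =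
    (\<Sum>c\<in>I. k c *\<^sub>C nop \<sigma> (A c) B (\<lambda>j. f (j - m)) (s + m) (N + m) v)"
proof -
  have "nop \<sigma> (\<lambda>j w. k c *\<^sub>C A c (j + m) w) B f s N v =
    k c *\<^sub>C nop \<sigma> (A c) B (\<lambda>j. f (j - m)) (s + m) (N + m) v" for c
    by (simp only: nop_scale_left[OF B] nop_shift_left mult.commute[of _ "k c"] nop_scale)
  then show ?thesis by (simp only: nop_sum_left field_scale field_shift A B)
qed

lemma nop_comb_right:
  assumes A: "field A" and B: "\<And>c. field (B c)"
  shows "nop \<sigma> A (\<lambda>j w. \<Sum>c\<in>I. k c *\<^sub>C B c (j + m) w) f s N v =
    (\<Sum>c\<in>I. k c *\<^sub>C nop \<sigma> A (B c) f s (N + m) v)"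
proof -
  have "nop \<sigma> A (\<lambda>j w. k c *\<^sub>C B c (j + m) w) f s N v = k c *\<^sub>C nop \<sigma> A (B c) f s (N + m) v" for c
    by (simp only: nop_scale_right[OF A] nop_shift_right mult.commute[of _ "k c"] nop_scale)
  then show ?thesis by (simp only: nop_sum_right field_scale field_shift A B)
qed

lemma nop_delta_left:
  assumes "field B"
  shows "nop \<sigma> (\<lambda>j v. if j = j0 then k *\<^sub>C v else 0) B f c N v =
    (f j0 * k * (if j0 < c then 1 else \<sigma>)) *\<^sub>C B (N - j0) v"
  by (subst nop_finite_sum[of "{j0}"])
    (auto simp: nterm_def clinear_simps[OF field_linear[OF assms]] mult_ac)

lemma nop_delta_right:
  assumes "field A"
  shows "nop \<sigma> A (\<lambda>j v. if j = j0 then k *\<^sub>C v else 0) f c N v =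
    (f (N - j0) * k * (if N - j0 < c then 1 else \<sigma>)) *\<^sub>C A (N - j0) v"
  by (subst nop_finite_sum[of "{N - j0}"])
    (auto simp: nterm_def clinear_simps[OF field_linear[OF assms]] mult_ac)

section \<open>Inner products and adjoints of normally ordered products\<close>

lemma cinner_zero_left [simp]: "cinner 0 x = 0"
  using cinner_add_left[of 0 0 x] by simp

lemma cinner_zero_right [simp]: "cinner x 0 = 0"
  by (metis cinner_commute cinner_zero_left complex_cnj_zero)

lemma cinner_add_right: "cinner x (y + z) = cinner x y + cinner x z"
  by (metis cinner_add_left cinner_commute complex_cnj_add)

lemma cinner_scaleC_right: "cinner x (a *\<^sub>C y) = cnj a * cinner x y"
  by (metis cinner_scaleC_left cinner_commute complex_cnj_mult)

lemma cinner_uminus_left: "cinner (- x) y = - cinner x y"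
  using cinner_add_left[of x "- x" y] by (simp add: eq_neg_iff_add_eq_0 add.commute)

lemma cinner_uminus_right: "cinner x (- y) = - cinner x y"
  using cinner_add_right[of x y "- y"] by (simp add: eq_neg_iff_add_eq_0 add.commute)

lemma cinner_diff_left: "cinner (x - y) z = cinner x z - cinner y z"
  using cinner_add_left[of x "- y" z] by (simp add: cinner_uminus_left)

lemma cinner_diff_right: "cinner x (y - z) = cinner x y - cinner x z"
  by (metis cinner_diff_left cinner_commute complex_cnj_diff)

lemma cinner_sum_left: "cinner (\<Sum>i\<in>I. F i) y = (\<Sum>i\<in>I. cinner (F i) y)"
  by (induction I rule: infinite_finite_induct) (auto simp: cinner_add_left)

lemma cinner_sum_right: "cinner y (\<Sum>i\<in>I. F i) = (\<Sum>i\<in>I. cinner y (F i))"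
  by (induction I rule: infinite_finite_induct) (auto simp: cinner_add_right)

lemmas cinner_simps = cinner_add_left cinner_add_right cinner_scaleC_left cinner_scaleC_right
  cinner_uminus_left cinner_uminus_right cinner_diff_left cinner_diff_right cinner_sum_left cinner_sum_right

lemma cinner_Sum_any_left:
  assumes "finite {j. F j \<noteq> 0}"
  shows "cinner (Sum_any F) y = Sum_any (\<lambda>j. cinner (F j) y)"
proof -
  have "Sum_any (\<lambda>j. cinner (F j) y) = (\<Sum>j | F j \<noteq> 0. cinner (F j) y)"
    using assms by (intro Sum_any.expand_superset) auto
  then show ?thesis by (simp add: Sum_any.expand_set cinner_sum_left)
qed

lemma cinner_Sum_any_right:
  assumes "finite {j. F j \<noteq> 0}"
  shows "cinner y (Sum_any F) = Sum_any (\<lambda>j. cinner y (F j))"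
proof -
  have "Sum_any (\<lambda>j. cinner y (F j)) = (\<Sum>j | F j \<noteq> 0. cinner y (F j))"
    using assms by (intro Sum_any.expand_superset) auto
  then show ?thesis by (simp add: Sum_any.expand_set cinner_sum_right)
qed

text \<open>Taking adjoints reverses the order of the factors, and the substitution
  \<open>j -> \<alpha> - j\<close> restores the shape of the sum; the overall
  \<open>\<sigma>\<close> comes from the reversed order. The offsets \<open>\<alpha>\<close> and
  \<open>\<rho>\<close> are 0 for currents and -1 for fermions, because of their shifted
  indexing.\<close>

lemma nop_adjoint:
  assumes A: "field A" and B: "field B" and A': "field A'" and B': "field B'"
    and adA: "\<And>j. adjoint_pair (A j) (A' (\<alpha> - j))" and adB: "\<And>j. adjoint_pair (B j) (B' (\<rho> - j))"
    and \<sigma>: "\<sigma> = 1 \<or> \<sigma> = - 1" and f: "\<And>j. cnj (f j) = f j"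
  shows "cinner (nop \<sigma> A B f c N u) v =
    \<sigma> * cinner u (nop \<sigma> A' B' (\<lambda>j. f (\<alpha> - j)) (\<alpha> - c + 1) (\<rho> + \<alpha> - N) v)"
proof -
  have b: "bij (\<lambda>j. \<alpha> - j)"
    by (rule bijI) (auto simp: inj_def surj_def intro: exI[of _ "\<alpha> - _"])
  have "cinner (nterm \<sigma> A B f c N u (\<alpha> - j)) v =
     \<sigma> * cinner u (nterm \<sigma> A' B' (\<lambda>j. f (\<alpha> - j)) (\<alpha> - c + 1) (\<rho> + \<alpha> - N) v j)" for j
  proof -
    have e: "\<rho> - (N - (\<alpha> - j)) = \<rho> + \<alpha> - N - j" by simp
    have "cinner (B (N - (\<alpha> - j)) x) y = cinner x (B' (\<rho> + \<alpha> - N - j) y)" for x y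
      using adB[of "N - (\<alpha> - j)", unfolded e] by (simp add: adjoint_pair_def)
    moreover have "cinner (A (\<alpha> - j) x) y = cinner x (A' j y)" for x y
      using adA[of "\<alpha> - j"] by (simp add: adjoint_pair_def)
    ultimately show ?thesis
      using \<sigma> by (auto simp: nterm_def cinner_simps f)
  qed
  then have "Sum_any (\<lambda>j. cinner (nterm \<sigma> A B f c N u j) v) =
     Sum_any (\<lambda>j. \<sigma> * cinner u (nterm \<sigma> A' B' (\<lambda>j. f (\<alpha> - j)) (\<alpha> - c + 1) (\<rho> + \<alpha> - N) v j))"
    using Sum_any_reindex[OF b, of "\<lambda>j. cinner (nterm \<sigma> A B f c N u j) v"] by simp
  then show ?thesis
    unfolding nop_def cinner_Sum_any_left[OF nterm_finite[OF A B]] cinner_Sum_any_right[OF nterm_finite[OF A' B']]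
    using Sum_any_scaleC[of \<sigma> "\<lambda>j. cinner u (nterm \<sigma> A' B' (\<lambda>j. f (\<alpha> - j)) (\<alpha> - c + 1) (\<rho> + \<alpha> - N) v j)"]
    by (simp add: scaleC_complex_def)
qed

section \<open>The products of order -1 and -2 as normally ordered sums\<close>

lemma Sum_any_int_split:
  fixes g :: "int \<Rightarrow> 'a::ab_group_add"
  assumes "finite {j. g j \<noteq> 0}"
  shows "Sum_any g = Sum_any (\<lambda>p. g (- 1 - int p)) + Sum_any (\<lambda>p. g (int p))"
proof -
  obtain M where M: "{j. g j \<noteq> 0} \<subseteq> {- int M..<int M}"
  proof -
    define K where "K = Max (insert 0 (abs ` {j. g j \<noteq> 0}))"
    have K: "\<bar>j\<bar> \<le> K" if "g j \<noteq> 0" for j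
      unfolding K_def using assms that by (intro Max_ge) auto
    have "{j. g j \<noteq> 0} \<subseteq> {- int (nat K + 1)..<int (nat K + 1)}"
      using K by fastforce
    then show thesis by (rule that)
  qed
  have "(\<Sum>j\<in>{- int M..<int M}. g j) = (\<Sum>p<M. g (- 1 - int p)) + (\<Sum>p<M. g (int p))"
  proof (induction M)
    case (Suc M)
    have "{- int (Suc M)..<int (Suc M)} = insert (- 1 - int M) (insert (int M) {- int M..<int M})"
      by auto
    then show ?case by (simp add: Suc algebra_simps)
  qed simp
  moreover have "Sum_any g = (\<Sum>j\<in>{- int M..<int M}. g j)"
    using M by (intro Sum_any.expand_superset) auto
  moreover have "Sum_any (\<lambda>p. g (- 1 - int p)) = (\<Sum>p<M. g (- 1 - int p))"
    using M by (intro Sum_any.expand_superset) force+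
  moreover have "Sum_any (\<lambda>p. g (int p)) = (\<Sum>p<M. g (int p))"
    using M by (intro Sum_any.expand_superset) force+
  ultimately show ?thesis by simp
qed

lemma finite_vimage_inj: "finite {j. g j \<noteq> 0} \<Longrightarrow> inj h \<Longrightarrow> finite {p. g (h p) \<noteq> 0}"
  using finite_vimageI[of "{j. g j \<noteq> 0}" h] by (simp add: vimage_def)

lemma Sum_any_Suc:
  fixes g :: "nat \<Rightarrow> 'a::ab_group_add"
  assumes "finite {j. g j \<noteq> 0}" "g 0 = 0"
  shows "Sum_any (\<lambda>p. g (Suc p)) = Sum_any g"
proof -
  obtain M where M: "{j. g j \<noteq> 0} \<subseteq> {..<Suc M}"
    using assms(1) by (metis finite_nat_set_iff_bounded lessThan_iff less_Suc_eq subsetI)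
  have "Sum_any g = (\<Sum>j<Suc M. g j)" using M by (intro Sum_any.expand_superset) auto
  also have "\<dots> = (\<Sum>j<M. g (Suc j))" by (subst sum.lessThan_Suc_shift) (simp add: assms(2))
  also have "\<dots> = Sum_any (\<lambda>p. g (Suc p))"
    using M by (intro Sum_any.expand_superset[symmetric]) force+
  finally show ?thesis by simp
qed

text \<open>All binomial coefficients are 1, and the two halves of the defining sum are the indices
  \<open>- 1 - p\<close> and \<open>p\<close> on either side of the cutoff 0.\<close>

lemma field_prod_neg1:
  assumes "field A" "field B"
  shows "field_prod \<epsilon> A (-1) B m v = nop ((- 1) ^ \<epsilon>) A B (\<lambda>j. 1) 0 (m - 1) v"
proof -
  let ?g = "nterm ((- 1) ^ \<epsilon>) A B (\<lambda>j. 1) 0 (m - 1) v"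
  note fin = nterm_finite[OF assms, of "(- 1) ^ \<epsilon>" "\<lambda>j. 1" 0 "m - 1" v]
  have s: "- ((- 1 :: complex) powi (int \<epsilon> - 1)) = (- 1) ^ \<epsilon>"
    by (simp add: power_int_diff)
  have "nop ((- 1) ^ \<epsilon>) A B (\<lambda>j. 1) 0 (m - 1) v = Sum_any (\<lambda>p. ?g (- 1 - int p) + ?g (int p))"
    unfolding nop_def Sum_any_int_split[OF fin]
    by (subst Sum_any.distrib) (auto intro!: finite_vimage_inj[OF fin] simp: inj_def)
  also have "\<dots> = field_prod \<epsilon> A (-1) B m v"
    unfolding field_prod_def
    by (simp add: nterm_def s[symmetric] algebra_simps)
  finally show ?thesis by simp
qed

text \<open>The binomial coefficient is \<open>p + 1\<close>. This is \<open>- 1 - j\<close> at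
  \<open>j = - 2 - p\<close> and its negative at \<open>j = p\<close>; since the sign of the second
  half is opposite to that for order -1, one weight serves both halves. The weight vanishes at
  \<open>j = - 1\<close>, so the first half may start there, which is what
  \<open>Sum_any_Suc\<close> exploits.\<close>

lemma field_prod_neg2:
  assumes "field A" "field B"
  shows "field_prod \<epsilon> A (-2) B m v = nop ((- 1) ^ \<epsilon>) A B (\<lambda>j. of_int (- 1 - j)) 0 (m - 2) v"
proof -
  let ?g = "nterm ((- 1) ^ \<epsilon>) A B (\<lambda>j. of_int (- 1 - j)) 0 (m - 2) v"
  note fin = nterm_finite[OF assms, of "(- 1) ^ \<epsilon>" "\<lambda>j. of_int (- 1 - j)" 0 "m - 2" v]
  have fin1: "finite {p. ?g (- 1 - int p) \<noteq> 0}" "finite {p. ?g (- 1 - int (Suc p)) \<noteq> 0}"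
    "finite {p. ?g (int p) \<noteq> 0}"
    by (rule finite_vimage_inj[OF fin]; auto simp: inj_def)+
  have s: "(- 1 :: complex) powi (int \<epsilon> - 2) = (- 1) ^ \<epsilon>"
    by (simp add: power_int_diff)
  have e: "?g (- 1 - int (Suc p)) + ?g (int p) = of_nat (nat (int p - (-2) - 1) choose p) *\<^sub>C
            (A (-2 - int p) (B (m + int p) v) - ((- 1) powi (int \<epsilon> + -2)) *\<^sub>C B (m + -2 - int p) (A (int p) v))" for p
  proof -
    have i: "- 1 - int (Suc p) = - 2 - int p" "m - 2 - (- 2 - int p) = m + int p"
      "m - 2 - int p = m + - 2 - int p" "int \<epsilon> + - 2 = int \<epsilon> - 2" "int p - (-2) - 1 = int (Suc p)"
      "nat (int (Suc p)) = Suc p"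
      by simp_all
    show ?thesis
      by (simp only: nterm_def i s binomial_Suc_n) (simp add: algebra_simps)
  qed
  have "nop ((- 1) ^ \<epsilon>) A B (\<lambda>j. of_int (- 1 - j)) 0 (m - 2) v =
    Sum_any (\<lambda>p. ?g (- 1 - int (Suc p)) + ?g (int p))"
    unfolding nop_def Sum_any_int_split[OF fin] Sum_any.distrib[OF fin1(2,3)]
    by (subst Sum_any_Suc[OF fin1(1)]) (auto simp: nterm_def)
  also have "\<dots> = field_prod \<epsilon> A (-2) B m v"
    unfolding field_prod_def e by simp
  finally show ?thesis by simp
qed

section \<open>The Sugawara construction\<close>

text \<open>\<open>W\<close> plays the role of the product of the boson module with the fermionic vacuum, \<open>W0\<close> that of
  its lowest energy subspace.\<close>

locale super_current =
  fixes \<Gamma> :: "'n::finite \<Rightarrow> 'n \<Rightarrow> 'n \<Rightarrow> real" and g cV :: real and \<l> :: nat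
    and X \<psi> :: "'n \<Rightarrow> int \<Rightarrow> 't::complex_prehilbert \<Rightarrow> 't" and W W0 :: "'t set"
  assumes \<Gamma>_swap12: "\<Gamma> b a c = - \<Gamma> a b c" and \<Gamma>_swap23: "\<Gamma> a c b = - \<Gamma> a b c"
    and \<Gamma>_jacobi: "(\<Sum>e\<in>UNIV. \<Gamma> a b e * \<Gamma> e c d + \<Gamma> b c e * \<Gamma> e a d + \<Gamma> c a e * \<Gamma> e b d) = 0"
    and \<Gamma>_contract: "(\<Sum>a\<in>UNIV. \<Sum>c\<in>UNIV. \<Gamma> a c b * \<Gamma> a c d) = (if b = d then 2 * g else 0)"
    and level_pos: "real \<l> + g > 0"
    and field_X: "field (X a)" and field_\<psi>: "field (\<psi> a)"
    and X_X: "X a m (X b n v) = X b n (X a m v) + \<i> *\<^sub>C (\<Sum>c\<in>UNIV. of_real (\<Gamma> a b c) *\<^sub>C X c (m + n) v) +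
        (if a = b \<and> m + n = 0 then (of_int m * of_nat \<l>) *\<^sub>C v else 0)"
    and \<psi>_\<psi>: "\<psi> a k (\<psi> b j v) = - \<psi> b j (\<psi> a k v) + (if a = b \<and> k + j + 1 = 0 then v else 0)"
    and X_\<psi>: "X a m (\<psi> b k v) = \<psi> b k (X a m v)"
    and adj_X: "adjoint_pair (X a n) (X a (- n))" and adj_\<psi>: "adjoint_pair (\<psi> a k) (\<psi> a (- k - 1))"
    and W_\<psi>: "w \<in> W \<Longrightarrow> k \<ge> 0 \<Longrightarrow> \<psi> a k w = 0" and W_X: "w \<in> W \<Longrightarrow> X a n w \<in> W"
    and W_generates: "cvec.subspace U \<Longrightarrow> W \<subseteq> U \<Longrightarrow> (\<And>a k y. y \<in> U \<Longrightarrow> \<psi> a k y \<in> U) \<Longrightarrow> U = UNIV"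
    and W0_W: "W0 \<subseteq> W" and W0_X: "u \<in> W0 \<Longrightarrow> n > 0 \<Longrightarrow> X a n u = 0"
    and W0_X0: "u \<in> W0 \<Longrightarrow> X a 0 u \<in> W0"
    and W0_generates: "cvec.subspace U \<Longrightarrow> W0 \<subseteq> U \<Longrightarrow> (\<And>a k y. y \<in> U \<Longrightarrow> \<psi> a k y \<in> U) \<Longrightarrow>
      (\<And>a n y. y \<in> U \<Longrightarrow> X a n y \<in> U) \<Longrightarrow> U = UNIV"
    and W0_casimir: "u \<in> W0 \<Longrightarrow> (\<Sum>a\<in>UNIV. X a 0 (X a 0 u)) = of_real cV *\<^sub>C u"
begin

section \<open>Structure constants and the fermionic currents\<close>

abbreviation \<gamma> :: "'n \<Rightarrow> 'n \<Rightarrow> 'n \<Rightarrow> complex" where "\<gamma> a b c \<equiv> complex_of_real (\<Gamma> a b c)"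

lemma \<gamma>_swap12: "\<gamma> b a c = - \<gamma> a b c" and \<gamma>_swap23: "\<gamma> a c b = - \<gamma> a b c"
  by (simp_all add: \<Gamma>_swap12[of b] \<Gamma>_swap23[of a c])

lemma \<gamma>_rotate: "\<gamma> b c a = \<gamma> a b c"
  using \<Gamma>_swap12[of b a c] \<Gamma>_swap23[of b c a] by simp

lemma \<gamma>_diag: "\<gamma> a a b = 0" "\<gamma> a b b = 0"
  using \<Gamma>_swap12[of a a b] \<Gamma>_swap23[of a b b] by simp_all

lemma \<gamma>_contract: "(\<Sum>a\<in>UNIV. \<Sum>c\<in>UNIV. \<gamma> a c b * \<gamma> a c d) = (if b = d then 2 * of_real g else 0)"
  using arg_cong[OF \<Gamma>_contract[of b d], of complex_of_real] by (simp split: if_splits)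

lemma \<gamma>_jacobi: "(\<Sum>e\<in>UNIV. \<gamma> a b e * \<gamma> e c d) + (\<Sum>e\<in>UNIV. \<gamma> b c e * \<gamma> e a d) + (\<Sum>e\<in>UNIV. \<gamma> c a e * \<gamma> e b d) = 0"
  using arg_cong[OF \<Gamma>_jacobi[of a b c d], of complex_of_real] by (simp add: sum.distrib)

lemmas lin_X = clinear_simps[OF field_linear[OF field_X]]
lemmas lin_\<psi> = clinear_simps[OF field_linear[OF field_\<psi>]]

abbreviation S where "S \<equiv> S_field \<Gamma> \<psi>"

lemma S_eq: "S a n v = (- (\<i> / 2)) *\<^sub>C
    (\<Sum>b\<in>UNIV. \<Sum>c\<in>UNIV. \<gamma> b c a *\<^sub>C nop1 (- 1) (\<psi> b) (\<psi> c) (n - 1) v)"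
  by (simp add: S_field_def field_prod_neg1 field_\<psi>)

lemma field_S: "field (S a)"
proof -
  have "field (\<lambda>n v. (- (\<i> / 2)) *\<^sub>C
    (\<Sum>b\<in>UNIV. \<Sum>c\<in>UNIV. \<gamma> b c a *\<^sub>C nop1 (- 1) (\<psi> b) (\<psi> c) (n + - 1) v))"
    by (intro field_scale field_sum field_nop field_\<psi>)
  then show ?thesis by (simp add: S_eq[abs_def])
qed

lemmas lin_S = clinear_simps[OF field_linear[OF field_S]]

text \<open>The contribution to \<open>L n\<close> of the bosons, up to the factor \<open>1 / (2 (\<l> + g))\<close>, and of the
  fermions, up to the factor \<open>1 / 2\<close>.\<close>

definition LX :: "int \<Rightarrow> 't \<Rightarrow> 't" where
  "LX n v = (\<Sum>a\<in>UNIV. nop1 1 (X a) (X a) n v)"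

definition L\<psi> :: "int \<Rightarrow> 't \<Rightarrow> 't" where
  "L\<psi> n v = (\<Sum>a\<in>UNIV. nop (- 1) (\<psi> a) (\<psi> a) (\<lambda>j. of_int (- 1 - j)) 0 (n - 1) v)"

lemma field_L\<psi>: "field L\<psi>"
proof -
  have "field (\<lambda>n v. \<Sum>a\<in>UNIV. nop (- 1) (\<psi> a) (\<psi> a) (\<lambda>j. of_int (- 1 - j)) 0 (n + - 1) v)"
    by (intro field_sum field_nop field_\<psi>)
  then show ?thesis by (simp add: L\<psi>_def[abs_def])
qed

lemma field_LX: "field LX"
proof -
  have "field (\<lambda>n v. \<Sum>a\<in>UNIV. nop1 1 (X a) (X a) (n + 0) v)"
    by (intro field_sum field_nop field_X)
  then show ?thesis by (simp add: LX_def[abs_def])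
qed

section \<open>Brackets of fermions and currents with quadratic expressions\<close>

lemma \<psi>_rule: "\<psi> a k (\<psi> b j w) = (- 1) *\<^sub>C \<psi> b j (\<psi> a k w) +
    (if j = - k - 1 then (if a = b then 1 else 0) *\<^sub>C w else 0)"
  unfolding \<psi>_\<psi>[of a k] by auto

text \<open>Contraction with either factor. The contracted mode has index \<open>- k - 1\<close> and
  leaves \<open>N + k + 1\<close> for the other, so the weight, which belongs to the first factor,
  is taken at \<open>- k - 1\<close> or at \<open>N + k + 1\<close>. Passing the fermion through
  turns the sign parameter -1 into 1, which makes the cutoff irrelevant in the contracted
  terms.\<close>

lemma \<psi>_nop_\<psi>\<psi>:
  "\<psi> b k (nop (- 1) (\<psi> c) (\<psi> d) f 0 N v) = nop (- 1) (\<psi> c) (\<psi> d) f 0 N (\<psi> b k v) +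
     (if b = c then f (- k - 1) *\<^sub>C \<psi> d (N + k + 1) v else 0) -
     (if b = d then f (N + k + 1) *\<^sub>C \<psi> c (N + k + 1) v else 0)"
proof -
  have "\<psi> b k (nop (- 1) (\<psi> c) (\<psi> d) f 0 N v) = ((- 1) * (- 1)) *\<^sub>C nop (- 1) (\<psi> c) (\<psi> d) f 0 N (\<psi> b k v)
     + nop ((- 1) * (- 1)) (\<lambda>j w. if j = - k - 1 then (if b = c then 1 else 0) *\<^sub>C w else 0) (\<psi> d) f 0 N v
     + (- 1) *\<^sub>C nop ((- 1) * (- 1)) (\<psi> c) (\<lambda>j w. if j = - k - 1 then (if b = d then 1 else 0) *\<^sub>C w else 0) f 0 N v"
    by (rule nop_comm) (use field_linear[OF field_\<psi>] in \<open>simp_all add: field_\<psi> field_delta \<psi>_rule[of b]\<close>)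
  then show ?thesis
    unfolding nop_delta_left[OF field_\<psi>] nop_delta_right[OF field_\<psi>]
    by (auto simp: algebra_simps cong: if_cong)
qed

lemma scaleC_if: "k *\<^sub>C (if P then x else 0) = (if P then k *\<^sub>C x else (0 :: 't))"
  by simp

text \<open>By antisymmetry of \<open>\<Gamma>\<close> the two contractions agree, which cancels the
  1/2 in the definition of \<open>S\<close>: the fermions transform in the adjoint
  representation.\<close>

lemma \<psi>_S: "\<psi> b k (S a m v) = S a m (\<psi> b k v) - \<i> *\<^sub>C (\<Sum>c\<in>UNIV. \<gamma> a b c *\<^sub>C \<psi> c (m + k) v)"
proof -
  have "(\<Sum>c\<in>UNIV. \<Sum>d\<in>UNIV. \<gamma> c d a *\<^sub>C ((if b = c then \<psi> d (m + k) v else 0) -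
      (if b = d then \<psi> c (m + k) v else 0))) =
    (\<Sum>c\<in>UNIV. if b = c then (\<Sum>d\<in>UNIV. \<gamma> c d a *\<^sub>C \<psi> d (m + k) v) else 0) -
    (\<Sum>c\<in>UNIV. \<Sum>d\<in>UNIV. if b = d then \<gamma> c d a *\<^sub>C \<psi> c (m + k) v else 0)"
    unfolding sum_subtractf[symmetric]
    by (intro sum.cong refl) (auto simp: cvec.scale_right_diff_distrib sum_subtractf scaleC_if)
  also have "\<dots> = (\<Sum>d\<in>UNIV. \<gamma> b d a *\<^sub>C \<psi> d (m + k) v) - (\<Sum>c\<in>UNIV. \<gamma> c b a *\<^sub>C \<psi> c (m + k) v)"
    by simp
  also have "\<dots> = (\<Sum>c\<in>UNIV. 2 *\<^sub>C (\<gamma> a b c *\<^sub>C \<psi> c (m + k) v))"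
    unfolding sum_subtractf[symmetric]
    by (intro sum.cong refl) (simp add: \<gamma>_rotate[of b _ a] \<gamma>_swap12[of _ b a] scaleC_add_left[symmetric])
  finally have e: "(\<Sum>c\<in>UNIV. \<Sum>d\<in>UNIV. \<gamma> c d a *\<^sub>C ((if b = c then \<psi> d (m + k) v else 0) -
      (if b = d then \<psi> c (m + k) v else 0))) = 2 *\<^sub>C (\<Sum>c\<in>UNIV. \<gamma> a b c *\<^sub>C \<psi> c (m + k) v)"
    by (simp add: cvec.scale_sum_right)
  have "\<psi> b k (S a m v) = (- (\<i> / 2)) *\<^sub>C (\<Sum>c\<in>UNIV. \<Sum>d\<in>UNIV. \<gamma> c d a *\<^sub>C
      (nop1 (- 1) (\<psi> c) (\<psi> d) (m - 1) (\<psi> b k v) + ((if b = c then \<psi> d (m + k) v else 0) -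
      (if b = d then \<psi> c (m + k) v else 0))))"
  proof -
    have "m - 1 + k + 1 = m + k" by simp
    then show ?thesis by (simp only: S_eq lin_\<psi> \<psi>_nop_\<psi>\<psi> add_diff_eq scaleC_one)
  qed
  also have "\<dots> = S a m (\<psi> b k v) + (- (\<i> / 2)) *\<^sub>C 2 *\<^sub>C (\<Sum>c\<in>UNIV. \<gamma> a b c *\<^sub>C \<psi> c (m + k) v)"
    unfolding S_eq e[symmetric] by (simp add: scaleC_add_right sum.distrib)
  finally show ?thesis by simp
qed

lemma S_\<psi>: "S a m (\<psi> b k v) = \<psi> b k (S a m v) + \<i> *\<^sub>C (\<Sum>c\<in>UNIV. \<gamma> a b c *\<^sub>C \<psi> c (m + k) v)"
  by (simp add: \<psi>_S)

lemma commute_S: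
  assumes "clinear Q" "\<And>a k w. Q (\<psi> a k w) = \<tau> *\<^sub>C \<psi> a k (Q w)" "\<tau> * \<tau> = 1"
  shows "Q (S a m v) = S a m (Q v)"
proof -
  have "Q (nop1 (- 1) (\<psi> b) (\<psi> c) N v) = nop1 (- 1) (\<psi> b) (\<psi> c) N (Q v)" for b c N
  proof -
    have "Q (nop1 (- 1) (\<psi> b) (\<psi> c) N v) = (\<tau> * \<tau>) *\<^sub>C nop1 (- 1) (\<psi> b) (\<psi> c) N (Q v)"
      by (rule nop_commute[OF field_\<psi> field_\<psi> assms(1,3)]) (rule assms(2))+
    then show ?thesis by (simp only: assms(3) scaleC_one)
  qed
  then show ?thesis
    by (simp only: S_eq clinear_scaleC[OF assms(1)] clinear_sum[OF assms(1)])
qed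

lemma X_S: "X a m (S b n v) = S b n (X a m v)"
  by (rule commute_S[of _ 1]) (simp_all add: X_\<psi> field_linear[OF field_X])

text \<open>The two contractions carry the weights \<open>k\<close> and \<open>- 1 - n - k\<close>,
  and they enter with opposite signs. The coefficient is twice the mode number of
  \<open>\<psi> b k\<close> plus \<open>n\<close>.\<close>

lemma \<psi>_L\<psi>: "\<psi> b k (L\<psi> n v) = L\<psi> n (\<psi> b k v) + of_int (2 * k + 1 + n) *\<^sub>C \<psi> b (n + k) v"
proof -
  have "\<psi> b k (L\<psi> n v) = (\<Sum>a\<in>UNIV. nop (- 1) (\<psi> a) (\<psi> a) (\<lambda>j. of_int (- 1 - j)) 0 (n - 1) (\<psi> b k v) +
    (if b = a then of_int (2 * k + 1 + n) *\<^sub>C \<psi> a (n + k) v else 0))"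
    unfolding L\<psi>_def lin_\<psi> \<psi>_nop_\<psi>\<psi>
  proof (intro sum.cong refl)
    fix a
    have i: "n - 1 + k + 1 = n + k" by simp
    have e: "of_int (- 1 - (- k - 1)) *\<^sub>C x - of_int (- 1 - (n + k)) *\<^sub>C x = of_int (2 * k + 1 + n) *\<^sub>C x" for x :: 't
      by (simp add: cvec.scale_left_diff_distrib[symmetric])
    show "nop (- 1) (\<psi> a) (\<psi> a) (\<lambda>j. of_int (- 1 - j)) 0 (n - 1) (\<psi> b k v) +
        (if b = a then of_int (- 1 - (- k - 1)) *\<^sub>C \<psi> a (n - 1 + k + 1) v else 0) -
        (if b = a then of_int (- 1 - (n - 1 + k + 1)) *\<^sub>C \<psi> a (n - 1 + k + 1) v else 0) =
      nop (- 1) (\<psi> a) (\<psi> a) (\<lambda>j. of_int (- 1 - j)) 0 (n - 1) (\<psi> b k v) +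
        (if b = a then of_int (2 * k + 1 + n) *\<^sub>C \<psi> a (n + k) v else 0)"
      unfolding i e[symmetric] by (simp only: add_diff_eq split: if_split) simp
  qed
  then show ?thesis by (simp add: sum.distrib L\<psi>_def)
qed

text \<open>The two terms from the derivation cancel by antisymmetry, except that the weight in the first
  one is shifted by \<open>m\<close>.\<close>

lemma S_L\<psi>: "S a m (L\<psi> n v) = L\<psi> n (S a m v) + of_int (2 * m) *\<^sub>C S a (m + n) v"
proof -
  let ?f = "\<lambda>j. of_int (- 1 - j) :: complex"
  let ?N = "n + m - 1"
  let ?D = "\<lambda>b j w. \<Sum>c\<in>UNIV. (\<i> * \<gamma> a b c) *\<^sub>C \<psi> c (j + m) w"
  have N: "n - 1 + m = ?N" by simp
  have fD: "field (?D b)" for b by (rule field_comb[OF field_\<psi>])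
  have rule: "S a m (\<psi> b j w) = 1 *\<^sub>C \<psi> b j (S a m w) + ?D b j w" for b j w
    by (simp add: S_\<psi> cvec.scale_sum_right add.commute)
  \<comment> \<open>The cutoff may be moved back for free: for \<open>b = c\<close> the structure
    constant vanishes, and otherwise the two fermions anticommute exactly.\<close>
  have cut: "\<gamma> a b c *\<^sub>C nop (- 1) (\<psi> c) (\<psi> b) h m ?N v = \<gamma> a b c *\<^sub>C nop (- 1) (\<psi> c) (\<psi> b) h 0 ?N v" for b c h
  proof (cases "b = c")
    case False
    then have "nop (- 1) (\<psi> c) (\<psi> b) h (0 + m) ?N v = nop (- 1) (\<psi> c) (\<psi> b) h 0 ?N v + of_int m *\<^sub>C 0"
      by (intro nop_cutoff field_\<psi>) (simp add: \<psi>_\<psi>[of c])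
    then show ?thesis by simp
  qed (simp add: \<gamma>_diag)
  have shl: "nop (- 1) (?D b) (\<psi> b) ?f 0 (n - 1) v =
    (\<Sum>c\<in>UNIV. (\<i> * \<gamma> a b c) *\<^sub>C (nop (- 1) (\<psi> c) (\<psi> b) ?f 0 ?N v + of_int m *\<^sub>C nop1 (- 1) (\<psi> c) (\<psi> b) ?N v))" for b
  proof -
    have f: "?f (j - m) = ?f j + of_int m * 1" for j by simp
    show ?thesis
      by (simp only: nop_comb_left[where A = \<psi>, OF field_\<psi> field_\<psi>] N f add_0,
          simp only: scaleC_scaleC[symmetric] cut,
          simp only: nop_weight_add field_\<psi> nop_scale[of _ _ _ "of_int m" "\<lambda>j. 1"])
  qed
  have shr: "nop (- 1) (\<psi> b) (?D b) ?f 0 (n - 1) v =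
    (\<Sum>c\<in>UNIV. (\<i> * \<gamma> a b c) *\<^sub>C nop (- 1) (\<psi> b) (\<psi> c) ?f 0 ?N v)" for b
    by (simp only: nop_comb_right[where B = \<psi>, OF field_\<psi> field_\<psi>] N)
  have "S a m (L\<psi> n v) = (\<Sum>b\<in>UNIV. (1 * 1) *\<^sub>C nop (- 1) (\<psi> b) (\<psi> b) ?f 0 (n - 1) (S a m v) +
      nop (- 1 * 1) (?D b) (\<psi> b) ?f 0 (n - 1) v + 1 *\<^sub>C nop (- 1 * 1) (\<psi> b) (?D b) ?f 0 (n - 1) v)"
    unfolding L\<psi>_def lin_S
    by (intro sum.cong refl nop_comm) (simp_all only: field_\<psi> fD field_linear[OF field_S] rule mult_1)
  also have "\<dots> = L\<psi> n (S a m v) + ((\<Sum>b\<in>UNIV. \<Sum>c\<in>UNIV. (\<i> * \<gamma> a b c) *\<^sub>C nop (- 1) (\<psi> c) (\<psi> b) ?f 0 ?N v) +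
     (\<Sum>b\<in>UNIV. \<Sum>c\<in>UNIV. (\<i> * \<gamma> a b c) *\<^sub>C nop (- 1) (\<psi> b) (\<psi> c) ?f 0 ?N v)) +
     (\<Sum>b\<in>UNIV. \<Sum>c\<in>UNIV. (\<i> * \<gamma> a b c) *\<^sub>C of_int m *\<^sub>C nop1 (- 1) (\<psi> c) (\<psi> b) ?N v)"
    by (simp only: mult_1_right scaleC_one shl shr sum.distrib L\<psi>_def scaleC_add_right add_ac)
  also have "(\<Sum>b\<in>UNIV. \<Sum>c\<in>UNIV. (\<i> * \<gamma> a b c) *\<^sub>C nop (- 1) (\<psi> b) (\<psi> c) ?f 0 ?N v) =
     - (\<Sum>b\<in>UNIV. \<Sum>c\<in>UNIV. (\<i> * \<gamma> a b c) *\<^sub>C nop (- 1) (\<psi> c) (\<psi> b) ?f 0 ?N v)"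
    unfolding sum_negf[symmetric]
  proof (subst sum.swap, intro sum.cong refl)
    show "(\<i> * \<gamma> a c b) *\<^sub>C z = - ((\<i> * \<gamma> a b c) *\<^sub>C z)" for b c and z :: 't
      by (subst \<gamma>_swap23) simp
  qed
  also have "(\<Sum>b\<in>UNIV. \<Sum>c\<in>UNIV. (\<i> * \<gamma> a b c) *\<^sub>C of_int m *\<^sub>C nop1 (- 1) (\<psi> c) (\<psi> b) ?N v) =
     of_int (2 * m) *\<^sub>C S a (m + n) v"
  proof -
    have "\<gamma> a c b = - \<gamma> b c a" for b c
      using \<gamma>_swap23[of a c b] \<gamma>_rotate[of b c a] by simp
    then show ?thesis
      unfolding S_eq add.commute[of m n] by (subst sum.swap) (simp add: cvec.scale_sum_right mult_ac)
  qed
  finally show ?thesis by simp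
qed

text \<open>The shift to \<open>\<l> + g\<close> arises here. The two derivation terms cancel by
  antisymmetry once the cutoff of the first is moved back from \<open>m\<close> to 0; this costs
  \<open>m\<close> times a commutator, whose structure constants contract to \<open>2 * g\<close>.
  The central terms of the two factors contribute \<open>\<l>\<close> each.\<close>

lemma X_LX: "X b m (LX n v) = LX n (X b m v) + (2 * of_int m * of_real (real \<l> + g)) *\<^sub>C X b (m + n) v"
proof -
  let ?N = "n + m"
  let ?C = "\<lambda>a j w. \<Sum>c\<in>UNIV. (\<i> * \<gamma> b a c) *\<^sub>C X c (j + m) w"
  let ?Z = "\<lambda>a j w. if j = - m then (if b = a then of_int m * of_nat \<l> else 0) *\<^sub>C w else (0 :: 't)"
  let ?T = "\<lambda>c a. nop1 1 (X c) (X a) ?N v"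
  let ?K = "\<lambda>c a. \<i> *\<^sub>C (\<Sum>d\<in>UNIV. \<gamma> c a d *\<^sub>C X d ?N v)"
  have fC: "field (?C a)" for a by (rule field_comb[OF field_X])
  have rule: "X b m (X a j w) = 1 *\<^sub>C X a j (X b m w) + (?C a j w + ?Z a j w)" for a j w
    unfolding X_X[of b m] by (auto simp: cvec.scale_sum_right add.commute)
  \<comment> \<open>As the coefficient vanishes for \<open>a = c\<close>, the central term of
    \<open>X_X\<close> does not enter the correction.\<close>
  have cut: "\<gamma> b a c *\<^sub>C nop 1 (X c) (X a) (\<lambda>j. 1) m ?N v = \<gamma> b a c *\<^sub>C (?T c a + of_int m *\<^sub>C ?K c a)" for a c
  proof (cases "a = c")
    case False
    have "nop 1 (X c) (X a) (\<lambda>j. 1) (0 + m) ?N v = ?T c a + of_int m *\<^sub>C ?K c a"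
      using False by (intro nop_cutoff field_X) (simp add: X_X[of c])
    then show ?thesis by simp
  qed (simp add: \<gamma>_diag)
  have shl: "nop1 1 (?C a) (X a) n v = (\<Sum>c\<in>UNIV. (\<i> * \<gamma> b a c) *\<^sub>C (?T c a + of_int m *\<^sub>C ?K c a))" for a
    by (simp only: nop_comb_left[where A = X, OF field_X field_X] add_0) (simp only: scaleC_scaleC[symmetric] cut)
  have shr: "nop1 1 (X a) (?C a) n v = (\<Sum>c\<in>UNIV. (\<i> * \<gamma> b a c) *\<^sub>C ?T a c)" for a
    by (rule nop_comb_right[OF field_X field_X])
  have z: "nop1 1 (?Z a) (X a) n v = (if b = a then (of_int m * of_nat \<l>) *\<^sub>C X a ?N v else 0)"
    "nop1 1 (X a) (?Z a) n v = (if b = a then (of_int m * of_nat \<l>) *\<^sub>C X a ?N v else 0)" for a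
    by (auto simp: nop_delta_left nop_delta_right field_X)
  have "X b m (LX n v) = (\<Sum>a\<in>UNIV. (1 * 1) *\<^sub>C nop1 1 (X a) (X a) n (X b m v) +
      nop1 (1 * 1) (\<lambda>j w. ?C a j w + ?Z a j w) (X a) n v +
      1 *\<^sub>C nop1 (1 * 1) (X a) (\<lambda>j w. ?C a j w + ?Z a j w) n v)"
    unfolding LX_def lin_X
    by (intro sum.cong refl nop_comm)
      (simp_all only: field_X fC field_delta field_add field_linear[OF field_X] rule mult_1)
  also have "\<dots> = (\<Sum>a\<in>UNIV. nop1 1 (X a) (X a) n (X b m v) +
      (nop1 1 (?C a) (X a) n v + nop1 1 (?Z a) (X a) n v) +
      (nop1 1 (X a) (?C a) n v + nop1 1 (X a) (?Z a) n v))"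
    by (simp only: mult_1 scaleC_one nop_add_left[OF fC field_delta field_X] nop_add_right[OF field_X fC field_delta])
  also have "\<dots> = LX n (X b m v) + ((\<Sum>a\<in>UNIV. \<Sum>c\<in>UNIV. (\<i> * \<gamma> b a c) *\<^sub>C ?T c a) +
      (\<Sum>a\<in>UNIV. \<Sum>c\<in>UNIV. (\<i> * \<gamma> b a c) *\<^sub>C ?T a c)) +
     ((\<Sum>a\<in>UNIV. \<Sum>c\<in>UNIV. (\<i> * \<gamma> b a c) *\<^sub>C of_int m *\<^sub>C ?K c a) +
     ((\<Sum>a\<in>UNIV. if b = a then (of_int m * of_nat \<l>) *\<^sub>C X a ?N v else 0) +
     (\<Sum>a\<in>UNIV. if b = a then (of_int m * of_nat \<l>) *\<^sub>C X a ?N v else 0)))"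
    by (simp only: shl shr z sum.distrib LX_def scaleC_add_right add_ac)
  also have "(\<Sum>a\<in>UNIV. \<Sum>c\<in>UNIV. (\<i> * \<gamma> b a c) *\<^sub>C ?T a c) = - (\<Sum>a\<in>UNIV. \<Sum>c\<in>UNIV. (\<i> * \<gamma> b a c) *\<^sub>C ?T c a)"
    unfolding sum_negf[symmetric]
  proof (subst sum.swap, intro sum.cong refl)
    show "(\<i> * \<gamma> b c a) *\<^sub>C z = - ((\<i> * \<gamma> b a c) *\<^sub>C z)" for a c and z :: 't
      by (subst \<gamma>_swap23) simp
  qed
  also have "(\<Sum>a\<in>UNIV. if b = a then (of_int m * of_nat \<l>) *\<^sub>C X a ?N v else 0) = (of_int m * of_nat \<l>) *\<^sub>C X b ?N v"
    by simp
  also have "(\<Sum>a\<in>UNIV. \<Sum>c\<in>UNIV. (\<i> * \<gamma> b a c) *\<^sub>C of_int m *\<^sub>C ?K c a) = (of_int m * (2 * of_real g)) *\<^sub>C X b ?N v"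
  proof -
    have e: "(\<i> * \<gamma> b a c) *\<^sub>C of_int m *\<^sub>C ?K c a = (\<Sum>d\<in>UNIV. (of_int m * (\<gamma> a c b * \<gamma> a c d)) *\<^sub>C X d ?N v)" for a c
    proof -
      have "\<gamma> b a c = \<gamma> a c b" "\<gamma> c a d = - \<gamma> a c d" for d
        using \<gamma>_rotate[of a c b] \<gamma>_swap12[of c a d] by auto
      then show ?thesis by (simp add: cvec.scale_sum_right mult_ac)
    qed
    have "(\<Sum>a\<in>UNIV. \<Sum>c\<in>UNIV. (\<i> * \<gamma> b a c) *\<^sub>C of_int m *\<^sub>C ?K c a) =
      (\<Sum>a\<in>UNIV. \<Sum>d\<in>UNIV. \<Sum>c\<in>UNIV. (of_int m * (\<gamma> a c b * \<gamma> a c d)) *\<^sub>C X d ?N v)"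
      unfolding e by (rule sum.cong[OF refl], rule sum.swap)
    also have "\<dots> = (\<Sum>d\<in>UNIV. \<Sum>a\<in>UNIV. \<Sum>c\<in>UNIV. (of_int m * (\<gamma> a c b * \<gamma> a c d)) *\<^sub>C X d ?N v)"
      by (rule sum.swap)
    also have "\<dots> = (\<Sum>d\<in>UNIV. (of_int m * (\<Sum>a\<in>UNIV. \<Sum>c\<in>UNIV. \<gamma> a c b * \<gamma> a c d)) *\<^sub>C X d ?N v)"
      by (simp only: cvec.scale_sum_left sum_distrib_left)
    also have "\<dots> = (\<Sum>d\<in>UNIV. if b = d then (of_int m * (2 * of_real g)) *\<^sub>C X d ?N v else 0)"
      unfolding \<gamma>_contract by (intro sum.cong refl) auto
    finally show ?thesis by simp
  qed
  also have "(of_int m * (2 * of_real g)) *\<^sub>C x + ((of_int m * of_nat \<l>) *\<^sub>C x + (of_int m * of_nat \<l>) *\<^sub>C x) =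
    (2 * of_int m * of_real (real \<l> + g)) *\<^sub>C x" for x :: 't
    unfolding scaleC_add_left[symmetric] by (rule arg_cong[where f = "\<lambda>k. k *\<^sub>C x"]) (simp add: algebra_simps)
  finally show ?thesis by (simp add: add.commute[of n m])
qed

text \<open>The fermionic currents have level \<open>g\<close>. The derivation terms combine by the
  Jacobi identity; moving the cutoff back adds \<open>m\<close> times a contraction of two fermions,
  and that scalar is the central term.\<close>

lemma S_S: "S a m (S e n v) = S e n (S a m v) + \<i> *\<^sub>C (\<Sum>c\<in>UNIV. \<gamma> a e c *\<^sub>C S c (m + n) v) +
    (if a = e \<and> m + n = 0 then (of_int m * of_real g) *\<^sub>C v else 0)"
proof -
  let ?N = "n + m - 1"
  let ?D = "\<lambda>b j w. \<Sum>d\<in>UNIV. (\<i> * \<gamma> a b d) *\<^sub>C \<psi> d (j + m) w"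
  let ?T = "\<lambda>b c. nop1 (- 1) (\<psi> b) (\<psi> c) ?N v"
  let ?K = "\<lambda>d c. if d = c \<and> m + n = 0 then v else 0"
  have N: "n - 1 + m = ?N" by simp
  have fD: "field (?D b)" for b by (rule field_comb[OF field_\<psi>])
  have rule: "S a m (\<psi> b j w) = 1 *\<^sub>C \<psi> b j (S a m w) + ?D b j w" for b j w
    by (simp add: S_\<psi> cvec.scale_sum_right add.commute)
  have cut: "nop (- 1) (\<psi> d) (\<psi> c) (\<lambda>j. 1) m ?N v = ?T d c + of_int m *\<^sub>C ?K d c" for d c
  proof -
    have "nop (- 1) (\<psi> d) (\<psi> c) (\<lambda>j. 1) (0 + m) ?N v = ?T d c + of_int m *\<^sub>C ?K d c"
      by (intro nop_cutoff field_\<psi>) (auto simp: \<psi>_\<psi>[of d])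
    then show ?thesis by simp
  qed
  have shl: "nop1 (- 1) (?D b) (\<psi> c) (n - 1) v =
      (\<Sum>d\<in>UNIV. (\<i> * \<gamma> a b d) *\<^sub>C (?T d c + of_int m *\<^sub>C ?K d c))" for b c
    by (simp only: nop_comb_left[where A = \<psi>, OF field_\<psi> field_\<psi>] add_0 N cut)
  have shr: "nop1 (- 1) (\<psi> b) (?D c) (n - 1) v = (\<Sum>d\<in>UNIV. (\<i> * \<gamma> a c d) *\<^sub>C ?T b d)" for b c
    by (simp only: nop_comb_right[where B = \<psi>, OF field_\<psi> field_\<psi>] N)
  let ?B = "\<lambda>b c. \<gamma> b c e *\<^sub>C (\<Sum>d\<in>UNIV. \<gamma> a b d *\<^sub>C ?T d c)"
  let ?B' = "\<lambda>b c. \<gamma> b c e *\<^sub>C (\<Sum>d\<in>UNIV. \<gamma> a c d *\<^sub>C ?T b d)"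
  let ?B'' = "\<lambda>b c. \<gamma> b c e *\<^sub>C (\<Sum>d\<in>UNIV. \<gamma> a b d *\<^sub>C of_int m *\<^sub>C ?K d c)"
  have "S a m (S e n v) = (- (\<i> / 2)) *\<^sub>C (\<Sum>b\<in>UNIV. \<Sum>c\<in>UNIV. \<gamma> b c e *\<^sub>C
     ((1 * 1) *\<^sub>C nop1 (- 1) (\<psi> b) (\<psi> c) (n - 1) (S a m v) +
      nop1 (- 1 * 1) (?D b) (\<psi> c) (n - 1) v + 1 *\<^sub>C nop1 (- 1 * 1) (\<psi> b) (?D c) (n - 1) v))"
    unfolding S_eq[of e] lin_S
    by (intro arg_cong[where f = "scaleC _"] sum.cong refl nop_comm)
      (simp_all only: field_\<psi> fD field_linear[OF field_S] rule mult_1)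
  also have "\<dots> = S e n (S a m v) + (- (\<i> / 2)) *\<^sub>C \<i> *\<^sub>C (((\<Sum>b\<in>UNIV. \<Sum>c\<in>UNIV. ?B b c) + (\<Sum>b\<in>UNIV. \<Sum>c\<in>UNIV. ?B' b c)) +
     (\<Sum>b\<in>UNIV. \<Sum>c\<in>UNIV. ?B'' b c))"
    unfolding S_eq[of e] mult_1_right scaleC_one shl shr
    by (simp only: scaleC_add_right sum.distrib cvec.scale_sum_right scaleC_scaleC mult_ac add_ac)
  also have "(\<Sum>b\<in>UNIV. \<Sum>c\<in>UNIV. ?B'' b c) = (if a = e \<and> m + n = 0 then (2 * of_int m * of_real g) *\<^sub>C v else 0)"
  proof -
    have "?B'' b c = (if m + n = 0 then (of_int m * (\<gamma> b c e * \<gamma> b c a)) *\<^sub>C v else 0)" for b c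
    proof -
      have "(\<Sum>d\<in>UNIV. \<gamma> a b d *\<^sub>C of_int m *\<^sub>C ?K d c) = (\<Sum>d\<in>UNIV. if d = c then (if m + n = 0 then (\<gamma> a b d * of_int m) *\<^sub>C v else 0) else 0)"
        by (intro sum.cong refl) auto
      then show ?thesis using \<gamma>_rotate[of b c a] by (simp add: mult_ac)
    qed
    then have "(\<Sum>b\<in>UNIV. \<Sum>c\<in>UNIV. ?B'' b c) = (if m + n = 0 then (of_int m * (\<Sum>b\<in>UNIV. \<Sum>c\<in>UNIV. \<gamma> b c e * \<gamma> b c a)) *\<^sub>C v else 0)"
      by (simp only: cvec.scale_sum_left sum_distrib_left split: if_split) simp
    then show ?thesis unfolding \<gamma>_contract by (auto simp: mult_ac)
  qed
  also have "(\<Sum>b\<in>UNIV. \<Sum>c\<in>UNIV. ?B b c) + (\<Sum>b\<in>UNIV. \<Sum>c\<in>UNIV. ?B' b c) = 2 *\<^sub>C (\<Sum>f\<in>UNIV. \<gamma> a e f *\<^sub>C \<i> *\<^sub>C S f (m + n) v)"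
  proof -
    have "(\<Sum>b\<in>UNIV. \<Sum>c\<in>UNIV. ?B b c) = (\<Sum>c\<in>UNIV. \<Sum>b\<in>UNIV. \<Sum>d\<in>UNIV. (\<gamma> b c e * \<gamma> a b d) *\<^sub>C ?T d c)"
      by (subst sum.swap) (simp add: cvec.scale_sum_right)
    also have "\<dots> = (\<Sum>c\<in>UNIV. \<Sum>d\<in>UNIV. \<Sum>b\<in>UNIV. (\<gamma> b c e * \<gamma> a b d) *\<^sub>C ?T d c)"
      by (rule sum.cong[OF refl], rule sum.swap)
    also have "\<dots> = (\<Sum>d\<in>UNIV. \<Sum>c\<in>UNIV. \<Sum>b\<in>UNIV. (\<gamma> b c e * \<gamma> a b d) *\<^sub>C ?T d c)"
      by (rule sum.swap)
    finally have 1: "(\<Sum>b\<in>UNIV. \<Sum>c\<in>UNIV. ?B b c) = (\<Sum>d\<in>UNIV. \<Sum>c\<in>UNIV. (\<Sum>b\<in>UNIV. \<gamma> b c e * \<gamma> a b d) *\<^sub>C ?T d c)"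
      by (simp add: cvec.scale_sum_left)
    have "(\<Sum>b\<in>UNIV. \<Sum>c\<in>UNIV. ?B' b c) = (\<Sum>d\<in>UNIV. \<Sum>b\<in>UNIV. \<Sum>c\<in>UNIV. (\<gamma> d b e * \<gamma> a b c) *\<^sub>C ?T d c)"
      by (simp add: cvec.scale_sum_right)
    also have "\<dots> = (\<Sum>d\<in>UNIV. \<Sum>c\<in>UNIV. \<Sum>b\<in>UNIV. (\<gamma> d b e * \<gamma> a b c) *\<^sub>C ?T d c)"
      by (rule sum.cong[OF refl], rule sum.swap)
    finally have 2: "(\<Sum>b\<in>UNIV. \<Sum>c\<in>UNIV. ?B' b c) = (\<Sum>d\<in>UNIV. \<Sum>c\<in>UNIV. (\<Sum>b\<in>UNIV. \<gamma> d b e * \<gamma> a b c) *\<^sub>C ?T d c)"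
      by (simp add: cvec.scale_sum_left)
    \<comment> \<open>The Jacobi identity after rotating the indices; it collects two products of
      structure constants into the one that belongs to the bracket of the currents.\<close>
    have jac: "(\<Sum>b\<in>UNIV. \<gamma> b c e * \<gamma> a b d) + (\<Sum>b\<in>UNIV. \<gamma> d b e * \<gamma> a b c) = (\<Sum>f\<in>UNIV. \<gamma> a e f * \<gamma> d c f)" for c d
    proof -
      have "(\<Sum>b\<in>UNIV. \<gamma> a c b * \<gamma> b d e) = (\<Sum>b\<in>UNIV. \<gamma> d b e * \<gamma> a b c)"
        by (intro sum.cong refl) (simp add: \<gamma>_swap23[of a c] \<gamma>_swap12[of _ d e])
      moreover have "(\<Sum>b\<in>UNIV. \<gamma> d a b * \<gamma> b c e) = (\<Sum>b\<in>UNIV. \<gamma> b c e * \<gamma> a b d)"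
        by (intro sum.cong refl) (simp add: \<gamma>_rotate[of a _ d, symmetric])
      moreover have "(\<Sum>b\<in>UNIV. \<gamma> c d b * \<gamma> b a e) = - (\<Sum>b\<in>UNIV. \<gamma> a e b * \<gamma> d c b)"
        unfolding sum_negf[symmetric]
        by (intro sum.cong refl) (simp add: \<gamma>_swap12[of c d] \<gamma>_swap12[of _ a e] \<gamma>_swap23[of a e])
      ultimately show ?thesis using \<gamma>_jacobi[of a c d e] by (simp add: algebra_simps)
    qed
    have M: "m + n - 1 = ?N" by simp
    have "2 *\<^sub>C (\<Sum>f\<in>UNIV. \<gamma> a e f *\<^sub>C \<i> *\<^sub>C S f (m + n) v) = (\<Sum>f\<in>UNIV. \<Sum>d\<in>UNIV. \<Sum>c\<in>UNIV. (\<gamma> a e f * \<gamma> d c f) *\<^sub>C ?T d c)"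
      unfolding S_eq M by (simp add: cvec.scale_sum_right)
    also have "\<dots> = (\<Sum>d\<in>UNIV. \<Sum>f\<in>UNIV. \<Sum>c\<in>UNIV. (\<gamma> a e f * \<gamma> d c f) *\<^sub>C ?T d c)"
      by (rule sum.swap)
    also have "\<dots> = (\<Sum>d\<in>UNIV. \<Sum>c\<in>UNIV. \<Sum>f\<in>UNIV. (\<gamma> a e f * \<gamma> d c f) *\<^sub>C ?T d c)"
      by (rule sum.cong[OF refl], rule sum.swap)
    also have "\<dots> = (\<Sum>d\<in>UNIV. \<Sum>c\<in>UNIV. (\<Sum>f\<in>UNIV. \<gamma> a e f * \<gamma> d c f) *\<^sub>C ?T d c)"
      by (simp add: cvec.scale_sum_left)
    finally have 3: "2 *\<^sub>C (\<Sum>f\<in>UNIV. \<gamma> a e f *\<^sub>C \<i> *\<^sub>C S f (m + n) v) =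
      (\<Sum>d\<in>UNIV. \<Sum>c\<in>UNIV. (\<Sum>f\<in>UNIV. \<gamma> a e f * \<gamma> d c f) *\<^sub>C ?T d c)" .
    show ?thesis
      unfolding 1 2 3 jac[symmetric] by (simp only: scaleC_add_left sum.distrib)
  qed
  finally show ?thesis
    by (simp add: scaleC_add_right cvec.scale_sum_right mult_ac)
qed


section \<open>The operators \<open>L\<close>, \<open>G\<close> and \<open>J\<close> and their
  brackets with modes\<close>

abbreviation \<kappa> :: complex where "\<kappa> \<equiv> of_real (1 / sqrt (real \<l> + g))"
abbreviation L where "L \<equiv> L_op g \<l> X \<psi>"
abbreviation G where "G \<equiv> G_op \<Gamma> g \<l> X \<psi>"
definition J where "J a n v = X a n v + S a n v"

lemma L_eq: "L n v = (1 / 2) *\<^sub>C L\<psi> n v + of_real (1 / (2 * (real \<l> + g))) *\<^sub>C LX n v"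
  by (simp add: L_op_def field_prod_neg1[OF field_X field_X] field_prod_neg2[OF field_\<psi> field_\<psi>] L\<psi>_def LX_def)

lemma G_eq: "G r v = \<kappa> *\<^sub>C ((\<Sum>a\<in>UNIV. nop1 1 (\<psi> a) (X a) r v) +
    (1 / 3) *\<^sub>C (\<Sum>a\<in>UNIV. nop1 1 (\<psi> a) (S a) r v))"
  by (simp add: G_op_def field_prod_neg1[OF field_\<psi> field_X] field_prod_neg1[OF field_\<psi> field_S]
      sum.distrib cvec.scale_sum_right)

lemma field_L: "field L"
proof -
  have "field (\<lambda>n v. (1 / 2) *\<^sub>C L\<psi> n v + of_real (1 / (2 * (real \<l> + g))) *\<^sub>C LX n v)"
    by (intro field_add field_scale field_L\<psi> field_LX)
  then show ?thesis by (simp only: L_eq[abs_def])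
qed

lemma field_G: "field G"
proof -
  have 1: "field (\<lambda>r v. nop1 1 (\<psi> a) (X a) r v)" for a
    using field_nop[OF field_\<psi> field_X, of 1 a a "\<lambda>j. 1" 0 0] by simp
  have 2: "field (\<lambda>r v. nop1 1 (\<psi> a) (S a) r v)" for a
    using field_nop[OF field_\<psi> field_S, of 1 a a "\<lambda>j. 1" 0 0] by simp
  have "field (\<lambda>r v. \<kappa> *\<^sub>C ((\<Sum>a\<in>UNIV. nop1 1 (\<psi> a) (X a) r v) +
    (1 / 3) *\<^sub>C (\<Sum>a\<in>UNIV. nop1 1 (\<psi> a) (S a) r v)))"
    by (intro field_scale field_add field_sum 1 2)
  then show ?thesis by (simp only: G_eq[abs_def])
qed

lemma field_J: "field (J a)"
  unfolding J_def[abs_def] by (intro field_add field_X field_S)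

lemmas lin_L = clinear_simps[OF field_linear[OF field_L]]
lemmas lin_G = clinear_simps[OF field_linear[OF field_G]]
lemmas lin_J = clinear_simps[OF field_linear[OF field_J]]

lemma X_L\<psi>: "X b m (L\<psi> n v) = L\<psi> n (X b m v)"
proof -
  have "X b m (nop (- 1) (\<psi> a) (\<psi> a) f 0 (n - 1) v) = (1 * 1) *\<^sub>C nop (- 1) (\<psi> a) (\<psi> a) f 0 (n - 1) (X b m v)" for a f
    by (rule nop_commute) (simp_all add: field_\<psi> X_\<psi> field_linear[OF field_X])
  then show ?thesis by (simp add: L\<psi>_def lin_X)
qed

lemma \<psi>_LX: "\<psi> b m (LX n v) = LX n (\<psi> b m v)"
proof -
  have "\<psi> b m (nop 1 (X a) (X a) f 0 n v) = (1 * 1) *\<^sub>C nop 1 (X a) (X a) f 0 n (\<psi> b m v)" for a f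
    by (rule nop_commute) (simp_all add: field_X X_\<psi>[symmetric] field_linear[OF field_\<psi>])
  then show ?thesis by (simp add: LX_def lin_\<psi>)
qed

lemma LX_S: "LX n (S a m v) = S a m (LX n v)"
  by (rule commute_S[of _ 1]) (simp_all add: \<psi>_LX field_linear[OF field_LX])

lemma L_\<psi>: "L n (\<psi> b k v) = \<psi> b k (L n v) - (of_int k + 1 / 2 + of_int n / 2) *\<^sub>C \<psi> b (n + k) v"
proof -
  have e: "(1 / 2) *\<^sub>C of_int (2 * k + 1 + n) *\<^sub>C x = (of_int k + 1 / 2 + of_int n / 2) *\<^sub>C x" for x :: 't
    unfolding scaleC_scaleC by (rule arg_cong[where f = "\<lambda>k. k *\<^sub>C x"]) (simp add: field_simps)
  show ?thesis
    unfolding L_eq lin_\<psi> \<psi>_L\<psi> \<psi>_LX scaleC_add_right e by simp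
qed

lemma L_X: "L n (X b m v) = X b m (L n v) - of_int m *\<^sub>C X b (m + n) v"
proof -
  have e: "of_real (1 / (2 * (real \<l> + g))) *\<^sub>C (2 * of_int m * of_real (real \<l> + g)) *\<^sub>C x = of_int m *\<^sub>C x" for x :: 't
  proof -
    have yy: "of_real (1 / (2 * y)) * (2 * of_int m * of_real y) = (of_int m :: complex)" if "y \<noteq> 0" for y
      using that by (simp add: field_simps)
    have "real \<l> + g \<noteq> 0" using level_pos by simp
    from arg_cong[OF yy[OF this], of "\<lambda>k. k *\<^sub>C x"] show ?thesis by (simp only: scaleC_scaleC)
  qed
  show ?thesis
    unfolding L_eq lin_X X_L\<psi> X_LX scaleC_add_right e by simp
qed

lemma L_S: "L n (S b m v) = S b m (L n v) - of_int m *\<^sub>C S b (m + n) v"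
proof -
  have e: "(1 / 2) *\<^sub>C of_int (2 * m) *\<^sub>C x = of_int m *\<^sub>C x" for x :: 't by simp
  show ?thesis
    unfolding L_eq lin_S S_L\<psi> LX_S scaleC_add_right e by simp
qed

lemma L_J: "L n (J b m v) = J b m (L n v) - of_int m *\<^sub>C J b (m + n) v"
  by (simp add: J_def lin_L L_X L_S algebra_simps)

lemma J_\<psi>: "J a m (\<psi> b k v) = \<psi> b k (J a m v) + \<i> *\<^sub>C (\<Sum>c\<in>UNIV. \<gamma> a b c *\<^sub>C \<psi> c (m + k) v)"
  by (simp add: J_def lin_\<psi> X_\<psi> S_\<psi>)

lemma J_J: "J a m (J b n v) = J b n (J a m v) + \<i> *\<^sub>C (\<Sum>c\<in>UNIV. \<gamma> a b c *\<^sub>C J c (m + n) v) +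
    (if a = b \<and> m + n = 0 then (of_int m * of_real (real \<l> + g)) *\<^sub>C v else 0)"
proof -
  have "J a m (J b n v) = X a m (X b n v) + S b n (X a m v) + X b n (S a m v) + S a m (S b n v)"
    by (simp add: J_def lin_X lin_S X_S)
  also have "\<dots> = J b n (J a m v) + \<i> *\<^sub>C (\<Sum>c\<in>UNIV. \<gamma> a b c *\<^sub>C J c (m + n) v) +
    ((if a = b \<and> m + n = 0 then (of_int m * of_nat \<l>) *\<^sub>C v else 0) +
     (if a = b \<and> m + n = 0 then (of_int m * of_real g) *\<^sub>C v else 0))"
    unfolding X_X[of a m b n v] S_S[of a m b n v]
    by (simp only: J_def lin_X lin_S scaleC_add_right sum.distrib add_ac)
  finally show ?thesis by (simp add: algebra_simps split: if_splits)
qed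

text \<open>This explains the 1/3 in \<open>G\<close>: in the cubic term the fermion contracts with
  the outer \<open>\<psi> a\<close>, leaving \<open>S b\<close>, and its commutator with the inner
  \<open>S a\<close> sums up to \<open>2 * S b\<close>. With weight 1/3 the total is
  \<open>S b\<close>, which completes \<open>X b\<close> to \<open>J b\<close>.\<close>

lemma G_\<psi>: "G r (\<psi> b k v) = - \<psi> b k (G r v) + \<kappa> *\<^sub>C J b (r + k + 1) v"
proof -
  let ?D = "\<lambda>a j w. if j = - k - 1 then (if b = a then 1 else 0) *\<^sub>C w else (0 :: 't)"
  let ?B = "\<lambda>a j w. \<Sum>c\<in>UNIV. (- \<i> * \<gamma> a b c) *\<^sub>C \<psi> c (j + k) w"
  have fB: "field (?B a)" for a by (rule field_comb[OF field_\<psi>])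
  have X: "\<psi> b k (nop1 1 (\<psi> a) (X a) r v) = - nop1 1 (\<psi> a) (X a) r (\<psi> b k v) +
    (if b = a then X a (r + k + 1) v else 0)" for a
  proof -
    have "\<psi> b k (nop1 1 (\<psi> a) (X a) r v) = (- 1 * 1) *\<^sub>C nop1 1 (\<psi> a) (X a) r (\<psi> b k v) +
      nop1 (1 * 1) (?D a) (X a) r v + (- 1) *\<^sub>C nop1 (1 * - 1) (\<psi> a) (\<lambda>j w. 0) r v"
      by (rule nop_comm) (simp_all add: field_\<psi> field_X field_delta field_zero field_linear[OF field_\<psi>] \<psi>_rule[of b] X_\<psi>)
    then show ?thesis
      unfolding nop_delta_left[OF field_X] nop_zero_right[OF field_\<psi>] by (auto simp: algebra_simps cong: if_cong)
  qed
  have nB: "nop1 (- 1) (\<psi> a) (?B a) r v = (\<Sum>c\<in>UNIV. (- \<i> * \<gamma> a b c) *\<^sub>C nop1 (- 1) (\<psi> a) (\<psi> c) (r + k) v)" for a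
    by (rule nop_comb_right[OF field_\<psi> field_\<psi>])
  have S: "\<psi> b k (nop1 1 (\<psi> a) (S a) r v) = - nop1 1 (\<psi> a) (S a) r (\<psi> b k v) +
    ((if b = a then S a (r + k + 1) v else 0) + (\<Sum>c\<in>UNIV. (\<i> * \<gamma> a b c) *\<^sub>C nop1 (- 1) (\<psi> a) (\<psi> c) (r + k) v))" for a
  proof -
    have "\<psi> b k (S a j w) = 1 *\<^sub>C S a j (\<psi> b k w) + ?B a j w" for j w
      by (simp add: \<psi>_S cvec.scale_sum_right sum_negf)
    then have "\<psi> b k (nop1 1 (\<psi> a) (S a) r v) = (- 1 * 1) *\<^sub>C nop1 1 (\<psi> a) (S a) r (\<psi> b k v) +
      nop1 (1 * 1) (?D a) (S a) r v + (- 1) *\<^sub>C nop1 (1 * - 1) (\<psi> a) (?B a) r v"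
      by (intro nop_comm)
       (simp_all only: field_\<psi> field_S field_delta fB field_linear[OF field_\<psi>] \<psi>_rule[of b] minus_mult_minus mult_1)
    then show ?thesis
      unfolding nop_delta_left[OF field_S] mult_1 nB by (auto simp: algebra_simps sum_negf cong: if_cong)
  qed
  have "(\<Sum>a\<in>UNIV. \<Sum>c\<in>UNIV. (\<i> * \<gamma> a b c) *\<^sub>C nop1 (- 1) (\<psi> a) (\<psi> c) (r + k) v) = 2 *\<^sub>C S b (r + k + 1) v"
  proof -
    have "(\<i> * \<gamma> a b c) *\<^sub>C x = 2 *\<^sub>C (- (\<i> / 2)) *\<^sub>C \<gamma> a c b *\<^sub>C x" for a c and x :: 't
      by (subst \<gamma>_swap23) simp
    then show ?thesis by (simp add: S_eq cvec.scale_sum_right)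
  qed
  then have *: "\<psi> b k (\<Sum>a\<in>UNIV. nop1 1 (\<psi> a) (S a) r v) =
     - (\<Sum>a\<in>UNIV. nop1 1 (\<psi> a) (S a) r (\<psi> b k v)) + 3 *\<^sub>C S b (r + k + 1) v"
    by (simp add: lin_\<psi> S sum.distrib sum_negf sum_subtractf) (simp add: scaleC_add_left[of 1 2, simplified])
  have "\<psi> b k (G r v) = - G r (\<psi> b k v) + \<kappa> *\<^sub>C J b (r + k + 1) v"
    unfolding G_eq J_def lin_\<psi>(1,2) * unfolding lin_\<psi>(6) X
    by (simp add: sum.distrib sum_negf sum_subtractf algebra_simps)
  then show ?thesis by simp
qed

section \<open>Adjoints of \<open>S\<close>, \<open>L\<close> and \<open>G\<close>\<close>

lemma adj_\<psi>': "adjoint_pair (\<psi> a k) (\<psi> a (- 1 - k))"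
proof -
  have "- 1 - k = - k - 1" by simp
  show ?thesis unfolding \<open>- 1 - k = - k - 1\<close> by (rule adj_\<psi>)
qed

lemma adj_S: "adjoint_pair (S a n) (S a (- n))"
proof -
  have *: "cinner (nop1 (- 1) (\<psi> b) (\<psi> c) (n - 1) u) v =
     - 1 * cinner u (nop (- 1) (\<psi> b) (\<psi> c) (\<lambda>j. 1) (- 1 - 0 + 1) (- 1 + - 1 - (n - 1)) v)" for b c u v
    by (rule nop_adjoint) (simp_all add: field_\<psi> adj_\<psi>')
  then have "cinner (nop1 (- 1) (\<psi> b) (\<psi> c) (n - 1) u) v =
     - cinner u (nop1 (- 1) (\<psi> b) (\<psi> c) (- n - 1) v)" for b c u v
  proof -
    have i: "- 1 - 0 + 1 = (0 :: int)" "- 1 + - 1 - (n - 1) = - n - 1" by simp_all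
    show ?thesis using * unfolding i mult_minus_left mult_1 .
  qed
  then show ?thesis
    by (simp add: adjoint_pair_def S_eq cinner_simps sum_negf)
qed

text \<open>Exchanging the equal factors costs a sign and moves the cutoff to \<open>N + 1\<close>.
  Moving it back adds \<open>N + 1\<close> times a contraction that is nonzero only if
  \<open>N + 1 = 0\<close>. Hence the expression is its own negative.\<close>

lemma nop_\<psi>\<psi>_0: "nop1 (- 1) (\<psi> a) (\<psi> a) N v = 0"
proof -
  let ?x = "nop1 (- 1) (\<psi> a) (\<psi> a) N v"
  have "?x = - nop (- 1) (\<psi> a) (\<psi> a) (\<lambda>j. 1) (0 + (N + 1)) N v"
    using nop_swap[of "- 1" "\<psi> a" "\<psi> a" "\<lambda>j. 1" 0 N v] by (simp add: add.commute)
  also have "nop (- 1) (\<psi> a) (\<psi> a) (\<lambda>j. 1) (0 + (N + 1)) N v = ?x + of_int (N + 1) *\<^sub>C (if N + 1 = 0 then v else 0)"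
  proof (intro nop_cutoff field_\<psi>)
    show "1 *\<^sub>C (\<psi> a j (\<psi> a (N - j) v) - (- 1) *\<^sub>C \<psi> a (N - j) (\<psi> a j v)) = (if N + 1 = 0 then v else 0)" for j
      by (subst \<psi>_\<psi>) auto
  qed
  also have "of_int (N + 1) *\<^sub>C (if N + 1 = 0 then v else 0) = 0"
    by (cases "N + 1 = 0") (simp_all only: of_int_0 if_True if_False cvec.scale_zero_left cvec.scale_zero_right)
  finally have "?x = - (?x + 0)" .
  moreover have "y = 0" if "y = - (y + 0)" for y :: 't
  proof -
    have "y + y = 0" using that by (metis add.right_neutral right_minus)
    then show "y = 0" using scaleC_add_left[of 1 1 y] by simp
  qed
  ultimately show ?thesis by blast
qed

lemma adj_L\<psi>: "adjoint_pair (L\<psi> n) (L\<psi> (- n))"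
proof -
  let ?n = "\<lambda>a f. nop (- 1) (\<psi> a) (\<psi> a) f 0 (- n - 1)"
  have i: "- 1 - 0 + 1 = (0 :: int)" "- 1 + - 1 - (n - 1) = - n - 1" by simp_all
  have "cinner (nop (- 1) (\<psi> a) (\<psi> a) (\<lambda>j. of_int (- 1 - j)) 0 (n - 1) u) v =
    cinner u (?n a (\<lambda>j. of_int (- 1 - j)) v)" for a u v
  proof -
    have "cinner (nop (- 1) (\<psi> a) (\<psi> a) (\<lambda>j. of_int (- 1 - j)) 0 (n - 1) u) v =
       - 1 * cinner u (nop (- 1) (\<psi> a) (\<psi> a) (\<lambda>j. of_int (- 1 - (- 1 - j))) (- 1 - 0 + 1) (- 1 + - 1 - (n - 1)) v)"
      by (rule nop_adjoint) (simp_all add: field_\<psi> adj_\<psi>')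
    also have "\<dots> = - cinner u (?n a (\<lambda>j. of_int j) v)"
      unfolding i by simp
    \<comment> \<open>Taking adjoints has changed the weight \<open>- 1 - j\<close> into
      \<open>j\<close>. Up to sign these differ by a constant, and the constant weight contributes
      nothing by \<open>nop_\<psi>\<psi>_0\<close>.\<close>
    also have "?n a (\<lambda>j. of_int j) v = ?n a (\<lambda>j. - 1 * of_int (- 1 - j) + - 1 * 1) v"
      by simp
    also have "\<dots> = - ?n a (\<lambda>j. of_int (- 1 - j)) v"
      unfolding nop_weight_add[OF field_\<psi> field_\<psi>] nop_scale nop_\<psi>\<psi>_0 by simp
    finally show ?thesis by (simp only: cinner_uminus_right minus_minus)
  qed
  then show ?thesis
    by (simp only: adjoint_pair_def L\<psi>_def cinner_simps simp_thms)
qed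

lemma adj_LX: "adjoint_pair (LX n) (LX (- n))"
proof -
  have "cinner (nop1 1 (X a) (X a) n u) v = cinner u (nop1 1 (X a) (X a) (- n) v)" for a u v
  proof -
    have "cinner (nop1 1 (X a) (X a) n u) v =
       1 * cinner u (nop 1 (X a) (X a) (\<lambda>j. 1) (0 - 0 + 1) (0 + 0 - n) v)"
      by (rule nop_adjoint) (simp_all add: field_X adj_X)
    \<comment> \<open>The reflected cutoff is 1. Moving it back to 0 exchanges just this pair, which
      commutes by antisymmetry of \<open>\<Gamma>\<close> and since the factor of the central term
      is 0.\<close>
    moreover have "X a 0 (X a (- n) v) = X a (- n) (X a 0 v)"
      by (subst X_X) (simp add: \<gamma>_diag)
    ultimately show ?thesis
      using nop_cutoff_Suc[OF field_X field_X, of 1 a a "\<lambda>j. 1" 0 "- n" v] by simp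
  qed
  then show ?thesis
    by (simp add: adjoint_pair_def LX_def cinner_simps)
qed

lemma adj_L: "adjoint_pair (L n) (L (- n))"
  using adj_LX[of n] adj_L\<psi>[of n] by (simp add: adjoint_pair_def L_eq cinner_simps)

lemma adj_G: "adjoint_pair (G r) (G (- r - 1))"
proof -
  have "cinner (nop1 1 (\<psi> a) (X a) r u) v =
     1 * cinner u (nop 1 (\<psi> a) (X a) (\<lambda>j. 1) (- 1 - 0 + 1) (0 + - 1 - r) v)" for a u v
    by (rule nop_adjoint) (simp_all add: field_X field_\<psi> adj_X adj_\<psi>')
  moreover have "cinner (nop1 1 (\<psi> a) (S a) r u) v =
     1 * cinner u (nop 1 (\<psi> a) (S a) (\<lambda>j. 1) (- 1 - 0 + 1) (0 + - 1 - r) v)" for a u v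
    by (rule nop_adjoint) (simp_all add: field_S field_\<psi> adj_S adj_\<psi>')
  moreover have "- 1 - r = - r - 1" by simp
  ultimately show ?thesis
    by (simp add: adjoint_pair_def G_eq cinner_simps)
qed

section \<open>Parity, and the vanishing of odd operators\<close>

text \<open>The boolean is the parity of the number of creation operators.\<close>

inductive cword :: "bool \<Rightarrow> 't \<Rightarrow> bool" where
  base: "w \<in> W \<Longrightarrow> cword False w"
| step: "cword p y \<Longrightarrow> k < 0 \<Longrightarrow> cword (\<not> p) (\<psi> a k y)"

definition H :: "bool \<Rightarrow> 't set" where "H p = cvec.span (Collect (cword p))"

lemma H_subspace: "cvec.subspace (H p)"
  by (simp add: H_def)

lemma H_mem: "cword p y \<Longrightarrow> y \<in> H p"
  by (simp add: H_def cvec.span_base)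

lemma H_linear:
  assumes "clinear T" "\<And>y. cword p y \<Longrightarrow> T y \<in> H q" "y \<in> H p"
  shows "T y \<in> H q"
proof -
  have "cvec.subspace {y. T y \<in> H q}"
    using assms(1) H_subspace[of q]
    by (auto simp: cvec.subspace_def clinear_simps)
  then show ?thesis
    using assms(2,3) unfolding H_def[of p] by (metis (mono_tags) cvec.span_induct mem_Collect_eq)
qed

lemma \<psi>_H: "y \<in> H p \<Longrightarrow> \<psi> a k y \<in> H (\<not> p)"
proof (rule H_linear[OF field_linear[OF field_\<psi>]])
  show "\<psi> a k y \<in> H (\<not> p)" if "cword p y" for y p
    using that
  proof (induction arbitrary: a k)
    case (base w)
    show ?case
    proof (cases "k < 0")
      case True then show ?thesis using cword.step[OF cword.base[OF base]] by (simp add: H_mem)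
    next
      case False then show ?thesis using W_\<psi>[OF base] H_subspace by (simp add: cvec.subspace_0)
    qed
  next
    case (step p y j b)
    show ?case
    proof (cases "k < 0")
      case True
      then show ?thesis using cword.step[OF cword.step[OF step(1,2)]] by (intro H_mem)
    next
      case False
      \<comment> \<open>An annihilation operator is moved past the outermost creation operator. The
        induction hypothesis handles the exchanged product, and a contraction gives back
        \<open>y\<close> itself.\<close>
      have "\<psi> b j (\<psi> a k y) \<in> H p"
        using H_linear[OF field_linear[OF field_\<psi>], of "\<not> p" b j "\<not> \<not> p" "\<psi> a k y"] step.IH[of a k]
          cword.step[of "\<not> p" _ j b] step(2) H_mem by auto
      then show ?thesis
        using H_mem[OF step(1)] H_subspace[of p] unfolding \<psi>_\<psi>[of a k]
        by (auto simp: cvec.subspace_0 intro!: cvec.subspace_neg cvec.subspace_diff cvec.subspace_add)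
    qed
  qed
qed

lemma X_H: "y \<in> H p \<Longrightarrow> X a n y \<in> H p"
proof (rule H_linear[OF field_linear[OF field_X]])
  show "X a n y \<in> H p" if "cword p y" for y p
    using that
  proof induction
    case (base w)
    then show ?case by (intro H_mem cword.base W_X)
  next
    case (step p y k b)
    then show ?case by (simp add: X_\<psi> \<psi>_H)
  qed
qed

lemma S_H: "y \<in> H p \<Longrightarrow> S a n y \<in> H p"
  unfolding S_eq using \<psi>_H[of _ "\<not> p"]  \<psi>_H[of _ p]
  by (intro cvec.subspace_scale[OF H_subspace] cvec.subspace_sum[OF H_subspace] nop_mem H_subspace) auto

lemma J_H: "y \<in> H p \<Longrightarrow> J a n y \<in> H p"
  unfolding J_def by (intro cvec.subspace_add[OF H_subspace] X_H S_H)

lemma L_H: "y \<in> H p \<Longrightarrow> L n y \<in> H p"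
  unfolding L_eq L\<psi>_def LX_def using \<psi>_H[of _ "\<not> p"]  \<psi>_H[of _ p]
  by (intro cvec.subspace_add[OF H_subspace] cvec.subspace_scale[OF H_subspace]
      cvec.subspace_sum[OF H_subspace] nop_mem H_subspace X_H) auto

lemma G_H: "y \<in> H p \<Longrightarrow> G r y \<in> H (\<not> p)"
  unfolding G_eq
  by (intro cvec.subspace_add[OF H_subspace] cvec.subspace_scale[OF H_subspace]
      cvec.subspace_sum[OF H_subspace] nop_mem H_subspace X_H S_H \<psi>_H)

text \<open>The creation operators in \<open>x\<close> are moved to the other side one by one, which
  preserves the difference in parity. When a vector of \<open>W\<close> is left, a word of odd
  parity has at least one creation operator, and its adjoint kills that vector.\<close>

lemma H_orthogonal_cword: "cword p x \<Longrightarrow> y \<in> H (\<not> p) \<Longrightarrow> cinner x y = 0"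
proof (induction arbitrary: y rule: cword.induct)
  case (base w)
  have "cinner w y = 0" if "cword True y" for y
    using that
  proof (cases rule: cword.cases)
    case base
    then show ?thesis by simp
  next
    case (step p z k a)
    have "cinner (\<psi> a (- k - 1) w) z = cinner w (\<psi> a k z)"
      using adj_\<psi>[of a "- k - 1"] by (simp add: adjoint_pair_def)
    then show ?thesis using step W_\<psi>[OF base(1), of "- k - 1" a] by simp
  qed
  moreover have "cvec.subspace {y. cinner w y = 0}"
    by (auto simp: cvec.subspace_def cinner_simps)
  ultimately show ?case
    by (intro cvec.span_induct[OF base(2)[unfolded H_def], of "\<lambda>y. cinner w y = 0"]) auto
next
  case (step p x k a)
  have "\<psi> a (- k - 1) y \<in> H (\<not> p)" using \<psi>_H[OF step.prems] by simp
  then show ?case using step.IH adj_\<psi>[of a k] by (simp add: adjoint_pair_def)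
qed

lemma cword_total: "cvec.span ({y. \<exists>p. cword p y}) = UNIV"
proof (rule W_generates)
  let ?U = "cvec.span ({y. \<exists>p. cword p y})"
  show "W \<subseteq> ?U" by (auto intro: cvec.span_base cword.base)
  have "H p \<subseteq> ?U" for p unfolding H_def by (rule cvec.span_mono) auto
  then have 1: "\<psi> a k y \<in> ?U" if "cword p y" for a k y p
    using \<psi>_H[OF H_mem[OF that]] by blast
  have [simp]: "cvec.subspace {y. \<psi> a k y \<in> ?U}" for a k
    by (auto simp: cvec.subspace_def lin_\<psi> cvec.span_add cvec.span_scale cvec.span_zero)
  then show "\<psi> a k y \<in> ?U" if "y \<in> ?U" for a k y
    by (rule cvec.span_induct[OF that]) (use 1 in auto)
qed simp

lemma kernel_subspace: "clinear E \<Longrightarrow> cvec.subspace {v. E v = 0}"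
  by (auto simp: cvec.subspace_def clinear_simps)

text \<open>An odd operator which supercommutes with all fermions maps \<open>W\<close> to vectors which are killed
  by all annihilation operators, hence orthogonal to everything but \<open>W\<close>, and which are orthogonal
  to \<open>W\<close> by parity.\<close>

lemma odd_vanishes:
  assumes E: "clinear E" and comm: "\<And>a k v. E (\<psi> a k v) = - \<psi> a k (E v)"
    and odd: "\<And>y. y \<in> H False \<Longrightarrow> E y \<in> H True"
  shows "E v = 0"
proof -
  have "E w = 0" if w: "w \<in> W" for w
  proof -
    have Ew: "\<psi> a k (E w) = 0" if "k \<ge> 0" for a k
      using comm[of a k w] W_\<psi>[OF w that] by (simp add: clinear_zero[OF E])
    have "E w \<in> H True" by (rule odd[OF H_mem[OF cword.base[OF w]]])
    have "cinner y (E w) = 0" if "cword p y" for p y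
      using that
    proof cases
      case base
      then show ?thesis using H_orthogonal_cword[of False y "E w"] \<open>E w \<in> H True\<close> cword.base[of y] by simp
    next
      case (step p z k a)
      then show ?thesis using adj_\<psi>[of a k] Ew[of "- k - 1" a] by (simp add: adjoint_pair_def)
    qed
    moreover have "cvec.subspace {y. cinner y (E w) = 0}"
      by (auto simp: cvec.subspace_def cinner_simps)
    ultimately have "cinner (E w) (E w) = 0"
      using cvec.span_induct[of "E w" "{y. \<exists>p. cword p y}" "\<lambda>y. cinner y (E w) = 0"] cword_total by auto
    then show ?thesis by (rule cinner_eq_zero)
  qed
  then have "{v. E v = 0} = UNIV"
    by (intro W_generates kernel_subspace E) (auto simp: comm lin_\<psi>)
  then show ?thesis by auto
qed

section \<open>Brackets of \<open>G\<close> with the total current and with \<open>L\<close>\<close>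

lemma \<kappa>_level: "\<kappa> * of_real (real \<l> + g) = of_real (sqrt (real \<l> + g))"
  unfolding of_real_mult[symmetric] using level_pos by (simp add: real_div_sqrt)

text \<open>The defect \<open>E\<close> satisfies \<open>odd_vanishes\<close>: in its anticommutator
  with a fermion, the terms containing currents cancel, and what remains is \<open>\<kappa>\<close>
  times the central term of \<open>J_J\<close>. The fermionic summand of \<open>E\<close> contracts
  to exactly its negative because \<open>\<kappa>\<close> times the level \<open>\<l> + g\<close> is
  the square root of that level.\<close>

lemma G_J: "G r (J b n v) = J b n (G r v) - (of_int n * of_real (sqrt (real \<l> + g))) *\<^sub>C \<psi> b (r + n) v"
proof -
  let ?s = "of_real (sqrt (real \<l> + g)) :: complex"
  define E where "E v = G r (J b n v) - J b n (G r v) + (of_int n * ?s) *\<^sub>C \<psi> b (r + n) v" for v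
  have "E v = 0"
  proof (rule odd_vanishes[of E])
    show "clinear E"
      by (rule clinearI) (simp_all add: E_def lin_G lin_J lin_\<psi> algebra_simps)
    show "E y \<in> H True" if "y \<in> H False" for y
      unfolding E_def using that J_H[of _ True] G_H[of _ False] \<psi>_H[of _ False] J_H[of _ False]
      by (intro cvec.subspace_add[OF H_subspace] cvec.subspace_diff[OF H_subspace] cvec.subspace_scale[OF H_subspace]) auto
    fix a k v
    let ?F = "\<Sum>c\<in>UNIV. \<gamma> b a c *\<^sub>C \<psi> c (n + k) (G r v)"
    let ?I = "\<Sum>c\<in>UNIV. \<gamma> b a c *\<^sub>C J c (r + (n + k) + 1) v"
    let ?Z = "if a = b \<and> r + k + 1 + n = 0 then v else 0"
    have i: "r + k + 1 + n = r + (n + k) + 1" by simp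
    have 1: "G r (J b n (\<psi> a k v)) = - \<psi> a k (G r (J b n v)) + \<kappa> *\<^sub>C J a (r + k + 1) (J b n v)
      - \<i> *\<^sub>C ?F + (\<i> * \<kappa>) *\<^sub>C ?I"
      by (simp add: J_\<psi> lin_G G_\<psi> scaleC_add_right sum.distrib sum_negf cvec.scale_sum_right mult_ac
          cvec.scale_right_diff_distrib sum_subtractf)
    have 2: "J b n (G r (\<psi> a k v)) = - \<psi> a k (J b n (G r v)) - \<i> *\<^sub>C ?F + \<kappa> *\<^sub>C J b n (J a (r + k + 1) v)"
      by (simp add: J_\<psi> lin_J G_\<psi>)
    have 3: "J a (r + k + 1) (J b n v) = J b n (J a (r + k + 1) v) - \<i> *\<^sub>C ?I +
      (- of_int n * of_real (real \<l> + g)) *\<^sub>C ?Z"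
    proof -
      have "(\<Sum>c\<in>UNIV. \<gamma> a b c *\<^sub>C J c (r + (n + k) + 1) v) = - ?I"
        unfolding sum_negf[symmetric] by (intro sum.cong refl) (subst \<gamma>_swap12, simp)
      moreover have "(if a = b \<and> r + k + 1 + n = 0 then (of_int (r + k + 1) * of_real (real \<l> + g)) *\<^sub>C v else 0) =
        (- of_int n * of_real (real \<l> + g)) *\<^sub>C ?Z"
      proof (cases "a = b \<and> r + k + 1 + n = 0")
        case True
        then have "r + k + 1 = - n" by simp
        then show ?thesis using True by (simp only: of_int_minus) simp
      qed auto
      ultimately show ?thesis
        unfolding J_J[of a "r + k + 1" b n v] by (simp only: i) simp
    qed
    have 4: "\<psi> b (r + n) (\<psi> a k v) = - \<psi> a k (\<psi> b (r + n) v) + ?Z"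
      unfolding \<psi>_\<psi>[of b "r + n"] by (auto simp: add_ac)
    have 5: "\<kappa> *\<^sub>C (- of_int n * of_real (real \<l> + g)) *\<^sub>C ?Z = - ((of_int n * ?s) *\<^sub>C ?Z)"
      unfolding scaleC_scaleC \<kappa>_level[symmetric] by (simp add: mult_ac)
    show "E (\<psi> a k v) = - \<psi> a k (E v)"
      unfolding E_def 1 2 3 4 scaleC_add_right 5
      by (simp only: lin_\<psi> scaleC_add_right cvec.scale_right_diff_distrib scaleC_scaleC) (simp add: mult_ac)
  qed
  then show ?thesis by (simp add: E_def algebra_simps add_eq_0_iff)
qed

text \<open>Again by \<open>odd_vanishes\<close>. The coefficient \<open>\<beta>\<close> is forced:
  in the anticommutator with \<open>\<psi> a k\<close>, the bracket of \<open>L n\<close> with the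
  current of index \<open>r + k + 1\<close> yields the factor \<open>r + k + 1\<close>, of which the
  bracket with the fermion accounts for \<open>\<mu>\<close>.\<close>

lemma G_L: "G r (L n v) = L n (G r v) + (of_int r + 1 / 2 - of_int n / 2) *\<^sub>C G (r + n) v"
proof -
  define \<beta> :: complex where "\<beta> = of_int r + 1 / 2 - of_int n / 2"
  define E where "E v = G r (L n v) - L n (G r v) - \<beta> *\<^sub>C G (r + n) v" for v
  have "E v = 0"
  proof (rule odd_vanishes[of E])
    show "clinear E"
      by (rule clinearI) (simp_all add: E_def lin_G lin_L algebra_simps)
    show "E y \<in> H True" if "y \<in> H False" for y
      unfolding E_def using that L_H[of _ True] G_H[of _ False] L_H[of _ False]
      by (intro cvec.subspace_add[OF H_subspace] cvec.subspace_diff[OF H_subspace] cvec.subspace_scale[OF H_subspace]) auto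
    fix a k v
    define \<mu> :: complex where "\<mu> = of_int k + 1 / 2 + of_int n / 2"
    have i: "r + (n + k) + 1 = r + n + k + 1" "r + k + 1 + n = r + n + k + 1" by simp_all
    have c: "of_int (r + k + 1) = \<mu> + \<beta>" by (simp add: \<mu>_def \<beta>_def)
    have 1: "G r (L n (\<psi> a k v)) = - \<psi> a k (G r (L n v)) + \<kappa> *\<^sub>C J a (r + k + 1) (L n v)
      - \<mu> *\<^sub>C (- \<psi> a (n + k) (G r v) + \<kappa> *\<^sub>C J a (r + n + k + 1) v)"
      unfolding L_\<psi> lin_G G_\<psi> \<mu>_def[symmetric] i ..
    have 2: "L n (G r (\<psi> a k v)) = - (\<psi> a k (L n (G r v)) - \<mu> *\<^sub>C \<psi> a (n + k) (G r v)) +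
      \<kappa> *\<^sub>C (J a (r + k + 1) (L n v) - (\<mu> + \<beta>) *\<^sub>C J a (r + n + k + 1) v)"
      unfolding G_\<psi> lin_L L_\<psi> L_J \<mu>_def[symmetric] i c ..
    show "E (\<psi> a k v) = - \<psi> a k (E v)"
      unfolding E_def 1 2 G_\<psi>[of "r + n"]
      by (simp add: lin_\<psi> algebra_simps)
  qed
  then show ?thesis by (simp add: E_def \<beta>_def[symmetric] algebra_simps)
qed


section \<open>Operators commuting with all modes, and lowest energy vectors\<close>

lemma commute_L:
  assumes Q: "clinear Q" and X: "\<And>a n v. Q (X a n v) = X a n (Q v)" and \<psi>: "\<And>a k v. Q (\<psi> a k v) = \<psi> a k (Q v)"
  shows "Q (L n v) = L n (Q v)"
proof -
  have "Q (nop \<sigma> (X a) (X a) f c N w) = (1 * 1) *\<^sub>C nop \<sigma> (X a) (X a) f c N (Q w)" for \<sigma> a f c N w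
    by (rule nop_commute) (simp_all add: field_X Q X)
  moreover have "Q (nop \<sigma> (\<psi> a) (\<psi> a) f c N w) = (1 * 1) *\<^sub>C nop \<sigma> (\<psi> a) (\<psi> a) f c N (Q w)" for \<sigma> a f c N w
    by (rule nop_commute) (simp_all add: field_\<psi> Q \<psi>)
  ultimately show ?thesis
    unfolding L_eq L\<psi>_def LX_def clinear_add[OF Q] clinear_scaleC[OF Q] clinear_sum[OF Q] by simp
qed

text \<open>The kernel is stable under all modes, hence everything as soon as it contains the lowest
  energy vectors. Identities between operators are thereby reduced to evaluations on
  \<open>W0\<close>.\<close>

lemma even_vanishes:
  assumes Q: "clinear Q" and X: "\<And>a n v. Q (X a n v) = X a n (Q v)" and \<psi>: "\<And>a k v. Q (\<psi> a k v) = \<psi> a k (Q v)"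
    and "\<And>u. u \<in> W0 \<Longrightarrow> Q u = 0"
  shows "Q v = 0"
proof -
  have "{v. Q v = 0} = UNIV"
    by (intro W0_generates kernel_subspace Q) (auto simp: X \<psi> lin_X lin_\<psi> assms(4))
  then show ?thesis by auto
qed

lemma W0_\<psi>: "u \<in> W0 \<Longrightarrow> k \<ge> 0 \<Longrightarrow> \<psi> a k u = 0"
  using W_\<psi> W0_W by auto

lemma W0_S: "u \<in> W0 \<Longrightarrow> n \<ge> 0 \<Longrightarrow> S a n u = 0"
  unfolding S_eq by (simp add: nop_eq_0 W0_\<psi> lin_\<psi>)

lemma W0_L: assumes "u \<in> W0" "n > 0" shows "L n u = 0"
proof -
  have "nop1 1 (X a) (X a) n u = 0" for a
  proof (rule nop_eq_0)
    show "1 *\<^sub>C X a (n - j) (X a j u) = 0" if "j \<ge> 0" for j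
      using assms that by (cases "j = 0") (simp_all add: W0_X W0_X0 lin_X)
  qed (use assms in \<open>simp add: W0_X lin_X\<close>)
  moreover have "nop (- 1) (\<psi> a) (\<psi> a) f 0 (n - 1) u = 0" for a f
    by (rule nop_eq_0) (use assms in \<open>simp_all add: W0_\<psi> lin_\<psi>\<close>)
  ultimately show ?thesis by (simp add: L_eq L\<psi>_def LX_def)
qed

lemma W0_G: assumes "u \<in> W0" "r \<ge> 0" shows "G r u = 0"
proof -
  have "nop1 1 (\<psi> a) (X a) r u = 0" for a
    by (rule nop_eq_0) (use assms in \<open>simp_all add: W0_\<psi> W0_X lin_X lin_\<psi>\<close>)
  moreover have "nop1 1 (\<psi> a) (S a) r u = 0" for a
    by (rule nop_eq_0) (use assms in \<open>simp_all add: W0_\<psi> W0_S lin_S lin_\<psi>\<close>)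
  ultimately show ?thesis by (simp add: G_eq)
qed

definition hw :: real where "hw = cV / (2 * (real \<l> + g))"

lemma W0_L0: assumes "u \<in> W0" shows "L 0 u = of_real hw *\<^sub>C u"
proof -
  have "nop1 1 (X a) (X a) 0 u = X a 0 (X a 0 u)" for a
  proof -
    have "nop1 1 (X a) (X a) 0 u = (\<Sum>j\<in>{0}. nterm 1 (X a) (X a) (\<lambda>j. 1) 0 0 u j)"
    proof (rule nop_finite_sum)
      show "nterm 1 (X a) (X a) (\<lambda>j. 1) 0 0 u j = 0" if "j \<notin> {0}" for j
        using assms that by (simp add: nterm_def W0_X lin_X)
    qed simp
    then show ?thesis by (simp add: nterm_def)
  qed
  moreover have "nop (- 1) (\<psi> a) (\<psi> a) f 0 (0 - 1) u = 0" for a f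
    by (rule nop_eq_0) (use assms in \<open>simp_all add: W0_\<psi> lin_\<psi>\<close>)
  ultimately show ?thesis by (simp add: L_eq L\<psi>_def LX_def W0_casimir[OF assms] hw_def)
qed

text \<open>The defect commutes with all modes. For \<open>n > 0\<close> both products kill
  \<open>W0\<close>, so \<open>even_vanishes\<close> applies; for \<open>n < 0\<close> the defect is
  minus the adjoint of one already known to vanish, and the inner product is definite. This provides
  the grading before any relation among general \<open>L m\<close> and \<open>L n\<close> is
  available.\<close>

lemma L0_L: "L 0 (L n v) = L n (L 0 v) - of_int n *\<^sub>C L n v"
proof -
  define K where "K n v = L 0 (L n v) - L n (L 0 v) + of_int n *\<^sub>C L n v" for n v
  have lin: "clinear (K n)" for n
    by (rule clinearI) (simp_all add: K_def lin_L algebra_simps)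
  have X: "K n (X a m v) = X a m (K n v)" for n a m v
    by (simp add: K_def lin_L L_X lin_X) (simp add: algebra_simps)
  have \<psi>: "K n (\<psi> a k v) = \<psi> a k (K n v)" for n a k v
  proof -
    define p q :: complex where "p = of_int k + 1 / 2" and "q = of_int k + 1 / 2 + of_int n / 2"
    have c: "of_int (n + k) + 1 / 2 + of_int 0 / 2 = p + of_int n" "of_int k + 1 / 2 + of_int 0 / 2 = p"
      by (simp_all add: p_def)
    show ?thesis
      unfolding K_def L_\<psi> lin_L lin_\<psi> add_0 c q_def[symmetric] by (simp add: algebra_simps)
  qed
  have pos: "K n v = 0" if "n > 0" for n v
  proof (rule even_vanishes[of "K n"])
    show "K n u = 0" if "u \<in> W0" for u
      using that \<open>n > 0\<close> by (simp add: K_def W0_L W0_L0 lin_L)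
  qed (rule lin X \<psi>)+
  have "K n v = 0"
  proof (cases n "0 :: int" rule: linorder_cases)
    case less
    have "cinner (K n v) y = - cinner v (K (- n) y)" for y
      using adj_L[of n] adj_L[of 0] by (simp add: K_def adjoint_pair_def cinner_simps)
    then have "cinner (K n v) (K n v) = 0" using pos[of "- n"] less by simp
    then show ?thesis by (rule cinner_eq_zero)
  next
    case equal
    then show ?thesis by (simp add: K_def)
  next
    case greater
    then show ?thesis by (rule pos)
  qed
  then show ?thesis by (simp add: K_def algebra_simps add_eq_0_iff)
qed

section \<open>The anticommutators of \<open>G\<close>\<close>

definition D :: "int \<Rightarrow> int \<Rightarrow> 't \<Rightarrow> 't" where
  "D r s v = G r (G s v) + G s (G r v) - 2 *\<^sub>C L (r + s + 1) v"

lemma D_linear: "clinear (D r s)"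
  by (rule clinearI) (simp_all add: D_def lin_L lin_G algebra_simps)

lemma \<kappa>_sqrt: "\<kappa> * of_real (sqrt (real \<l> + g)) = 1"
  unfolding of_real_mult[symmetric] using level_pos by simp

text \<open>In the auxiliary formula \<open>1\<close>, the terms with one \<open>G\<close> and one
  fermion change sign under exchanging \<open>r\<close> and \<open>s\<close>, so symmetrization
  removes them. The remaining term occurs twice and matches the bracket of \<open>2 * L\<close> with
  the current. The argument for fermions is the same.\<close>

lemma D_J: "D r s (J a n v) = J a n (D r s v)"
proof -
  let ?s = "of_real (sqrt (real \<l> + g)) :: complex"
  have 1: "G r (G s (J a n v)) = J a n (G r (G s v)) - (of_int n * ?s) *\<^sub>C \<psi> a (r + n) (G s v) +
      (of_int n * ?s) *\<^sub>C \<psi> a (s + n) (G r v) - of_int n *\<^sub>C J a (n + (r + s + 1)) v" for r s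
  proof -
    have i: "r + (s + n) + 1 = n + (r + s + 1)" by simp
    have k: "(of_int n * ?s) *\<^sub>C \<kappa> *\<^sub>C x = of_int n *\<^sub>C x" for x :: 't
      unfolding scaleC_scaleC mult.assoc mult.commute[of ?s] \<kappa>_sqrt by simp
    show ?thesis
      unfolding G_J lin_G G_\<psi> i scaleC_add_right k by simp
  qed
  have i: "s + r + 1 = r + s + 1" by simp
  have two: "2 *\<^sub>C of_int n *\<^sub>C x = of_int n *\<^sub>C x + of_int n *\<^sub>C x" for x :: 't
    unfolding scaleC_add_left[symmetric] by simp
  show ?thesis
    unfolding D_def 1[of r s] 1[of s r] L_J lin_J i cvec.scale_right_diff_distrib two by simp
qed

lemma D_\<psi>: "D r s (\<psi> a k v) = \<psi> a k (D r s v)"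
proof -
  let ?s = "of_real (sqrt (real \<l> + g)) :: complex"
  have 1: "G r (G s (\<psi> a k v)) = \<psi> a k (G r (G s v)) - \<kappa> *\<^sub>C J a (r + k + 1) (G s v) +
      \<kappa> *\<^sub>C J a (s + k + 1) (G r v) - of_int (s + k + 1) *\<^sub>C \<psi> a (r + s + 1 + k) v" for r s
  proof -
    have i: "r + (s + k + 1) = r + s + 1 + k" by simp
    have k: "\<kappa> *\<^sub>C (of_int m * ?s) *\<^sub>C x = of_int m *\<^sub>C x" for x :: 't and m
      unfolding scaleC_scaleC mult.left_commute[of \<kappa>] \<kappa>_sqrt by simp
    show ?thesis
      unfolding G_\<psi> lin_G G_J i cvec.scale_right_diff_distrib k by simp
  qed
  have i: "s + r + 1 = r + s + 1" by simp
  have 2: "of_int (s + k + 1) *\<^sub>C x + of_int (r + k + 1) *\<^sub>C x =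
    2 *\<^sub>C (of_int k + 1 / 2 + of_int (r + s + 1) / 2) *\<^sub>C x" for x :: 't
    unfolding scaleC_scaleC scaleC_add_left[symmetric]
    by (rule arg_cong[where f = "\<lambda>k. k *\<^sub>C x"]) simp
  show ?thesis
    unfolding D_def 1[of r s] 1[of s r] L_\<psi> lin_\<psi> i cvec.scale_right_diff_distrib 2[symmetric] by simp
qed

text \<open>The brackets with \<open>G\<close> only involve the total current, but \<open>S\<close>
  is quadratic in the fermions, with which \<open>D r s\<close> commutes, so
  \<open>X = J - S\<close> can be separated afterwards.\<close>

lemma D_X: "D r s (X a n v) = X a n (D r s v)"
proof -
  have "D r s (S a n v) = S a n (D r s v)"
    by (rule commute_S[OF D_linear, of _ _ 1]) (simp_all add: D_\<psi>)
  with D_J[of r s a n v] show ?thesis by (simp add: J_def clinear_add[OF D_linear])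
qed

lemma L_G: "L n (G r v) = G r (L n v) - (of_int r + 1 / 2 - of_int n / 2) *\<^sub>C G (r + n) v"
  by (simp add: G_L)

text \<open>\<open>D r s\<close> commutes with all modes, hence with \<open>L 0\<close>, but it is homogeneous of degree
  \<open>r + s + 1\<close>.\<close>

lemma D_off_diagonal:
  assumes "r + s + 1 \<noteq> 0" shows "D r s v = 0"
proof -
  define p q :: complex where "p = of_int r + 1 / 2" and "q = of_int s + 1 / 2"
  have pq: "of_int r + 1 / 2 - of_int 0 / 2 = p" "of_int s + 1 / 2 - of_int 0 / 2 = q"
    "of_int (r + s + 1) = p + q" by (simp_all add: p_def q_def)
  have "L 0 (D r s v) = D r s (L 0 v) - (p + q) *\<^sub>C D r s v"
    unfolding D_def lin_L L_G L0_L pq lin_G by (simp add: algebra_simps)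
  moreover have "L 0 (D r s v) = D r s (L 0 v)"
    by (rule commute_L[symmetric]) (simp_all add: D_linear D_X D_\<psi>)
  ultimately have "of_int (r + s + 1) *\<^sub>C D r s v = 0" unfolding pq by simp
  moreover have "complex_of_int (r + s + 1) \<noteq> 0" using assms by (simp only: of_int_eq_0_iff simp_thms)
  ultimately show ?thesis by (simp only: cvec.scale_eq_0_iff simp_thms)
qed

text \<open>The diagonal case: \<open>- 1 - r\<close> is the index of the mode number opposite to
  \<open>r + 1/2\<close>.\<close>

definition f :: "int \<Rightarrow> 't \<Rightarrow> 't" where
  "f r v = G r (G (- 1 - r) v) + G (- 1 - r) (G r v)"

lemma f_D: "f r v = D r (- 1 - r) v + 2 *\<^sub>C L 0 v"
  by (simp add: D_def f_def)

lemma f_sym: "f (- 1 - r) v = f r v"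
  by (simp add: f_def add.commute)

lemma L_GG: "L m (G r (G s v) + G s (G r v)) - (G r (G s (L m v)) + G s (G r (L m v))) =
   - ((of_int r + 1 / 2 - of_int m / 2) *\<^sub>C (G (r + m) (G s v) + G s (G (r + m) v)))
   - (of_int s + 1 / 2 - of_int m / 2) *\<^sub>C (G r (G (s + m) v) + G (s + m) (G r v))"
proof -
  define p q :: complex where "p = of_int r + 1 / 2 - of_int m / 2" and "q = of_int s + 1 / 2 - of_int m / 2"
  show ?thesis
    unfolding lin_L L_G lin_G p_def[symmetric] q_def[symmetric] by (simp add: algebra_simps)
qed

text \<open>With \<open>s\<close> chosen such that \<open>r + s + 1 = - m\<close>, the off-diagonal
  result says that \<open>{G r, G s}\<close> is \<open>2 * L (- m)\<close>; bracketing with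
  \<open>L m\<close> leads to two diagonal anticommutators. The left side does not involve
  \<open>r\<close>, so comparing different \<open>r\<close> gives a recursion for
  \<open>f\<close>.\<close>

lemma L_commutator_f:
  assumes "m \<noteq> 0"
  shows "2 *\<^sub>C (L m (L (- m) v) - L (- m) (L m v)) =
    (of_int r + 1 / 2 + 3 * of_int m / 2) *\<^sub>C f r v - (of_int r + 1 / 2 - of_int m / 2) *\<^sub>C f (r + m) v"
proof -
  define s where "s = - 1 - r - m"
  have s: "r + s + 1 = - m" "s = - 1 - (r + m)" "s + m = - 1 - r" by (simp_all add: s_def)
  have D: "G r (G s w) + G s (G r w) = 2 *\<^sub>C L (- m) w" for w
    using D_off_diagonal[of r s w] assms s(1) by (simp add: D_def)
  define p q :: complex where "p = of_int r + 1 / 2 + 3 * of_int m / 2" and "q = of_int r + 1 / 2 - of_int m / 2"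
  have 2: "of_int s + 1 / 2 - of_int m / 2 = - p"
    by (simp add: s_def p_def)
  have "2 *\<^sub>C L m (L (- m) v) - 2 *\<^sub>C L (- m) (L m v) = - (q *\<^sub>C f (r + m) v) - - p *\<^sub>C f r v"
    using L_GG[of m r s v] unfolding D 2 s(3) lin_L q_def[symmetric] f_def s(2)[symmetric] by (simp add: add.commute)
  then show ?thesis
    unfolding p_def[symmetric] q_def[symmetric] by (simp add: cvec.scale_right_diff_distrib)
qed

text \<open>The mode numbers are 1/2 and -1/2. On \<open>u\<close> in \<open>W0\<close> only the
  order \<open>G 0 (G (- 1) u)\<close> survives; it produces the Casimir operator with factor
  \<open>\<kappa> * \<kappa>\<close>, whose value is \<open>2 * hw\<close>.\<close>

lemma f_0: "f 0 v = 2 *\<^sub>C L 0 v"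
proof -
  have "D 0 (- 1) v = 0"
  proof (rule even_vanishes[of "D 0 (- 1)"])
    fix u assume u: "u \<in> W0"
    have "nop1 1 (\<psi> a) (X a) (- 1) u = \<psi> a (- 1) (X a 0 u)" for a
    proof -
      have "nop1 1 (\<psi> a) (X a) (- 1) u = (\<Sum>j\<in>{- 1}. nterm 1 (\<psi> a) (X a) (\<lambda>j. 1) 0 (- 1) u j)"
      proof (rule nop_finite_sum)
        show "nterm 1 (\<psi> a) (X a) (\<lambda>j. 1) 0 (- 1) u j = 0" if "j \<notin> {- 1}" for j
          using u that by (simp add: nterm_def W0_X W0_\<psi> lin_X lin_\<psi>)
      qed simp
      then show ?thesis by (simp add: nterm_def)
    qed
    moreover have "nop1 1 (\<psi> a) (S a) (- 1) u = 0" for a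
      by (rule nop_eq_0) (use u in \<open>simp_all add: W0_S W0_\<psi> lin_S lin_\<psi>\<close>)
    ultimately have "G (- 1) u = \<kappa> *\<^sub>C (\<Sum>a\<in>UNIV. \<psi> a (- 1) (X a 0 u))"
      by (simp add: G_eq)
    moreover have "G 0 (\<psi> a (- 1) (X a 0 u)) = \<kappa> *\<^sub>C X a 0 (X a 0 u)" for a
      using W0_G[OF W0_X0[OF u]] W0_S[OF W0_X0[OF u]] by (simp add: G_\<psi> lin_\<psi> J_def)
    ultimately have "G 0 (G (- 1) u) = (\<kappa> * \<kappa> * of_real cV) *\<^sub>C u"
      unfolding lin_G by (simp only: cvec.scale_sum_right[symmetric] lin_G W0_casimir[OF u] scaleC_scaleC mult.assoc)
    moreover have "\<kappa> * \<kappa> * of_real cV = of_real (2 * hw)"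
    proof -
      have y: "1 / sqrt y * (1 / sqrt y) * cV = 2 * (cV / (2 * y))" if "y > 0" for y
        using that by (simp add: field_simps)
      show ?thesis by (simp only: of_real_mult[symmetric] hw_def y[OF level_pos])
    qed
    ultimately show "D 0 (- 1) u = 0"
      using W0_G[OF u, of 0] W0_L0[OF u] by (simp add: D_def lin_G)
  qed (simp_all add: D_linear D_X D_\<psi>)
  then show ?thesis using f_D[of 0 v] by simp
qed

definition cc :: real where "cc = (3 / 2) * ((real \<l> + g / 3) / (real \<l> + g)) * real (card (UNIV :: 'n set))"

text \<open>The second evaluation, which produces the central charge. The Casimir terms add up to
  \<open>4 * hw\<close>; each index contributes 1/4 from the fermions and
  \<open>\<l> / (2 * (\<l> + g))\<close> from the central term of the bosons, and these sum up to
  \<open>cc / 2\<close>.\<close>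

lemma L_2_L_neg2: assumes u: "u \<in> W0" shows "L 2 (L (- 2) u) = of_real (4 * hw + cc / 2) *\<^sub>C u"
proof -
  have X: "nop1 1 (X a) (X a) (- 2) u = 2 *\<^sub>C X a (- 2) (X a 0 u) + X a (- 1) (X a (- 1) u)" for a
  proof -
    have "nop1 1 (X a) (X a) (- 2) u = (\<Sum>j\<in>{- 2, - 1, 0}. nterm 1 (X a) (X a) (\<lambda>j. 1) 0 (- 2) u j)"
    proof (rule nop_finite_sum)
      show "nterm 1 (X a) (X a) (\<lambda>j. 1) 0 (- 2) u j = 0" if "j \<notin> {- 2, - 1, 0}" for j
        using u that by (simp add: nterm_def W0_X lin_X)
    qed simp
    then show ?thesis by (simp add: nterm_def scaleC_add_left[of 1 1, simplified])
  qed
  have \<psi>: "nop (- 1) (\<psi> a) (\<psi> a) (\<lambda>j. of_int (- 1 - j)) 0 (- 2 - 1) u = \<psi> a (- 2) (\<psi> a (- 1) u)" for a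
  proof -
    have "nop (- 1) (\<psi> a) (\<psi> a) (\<lambda>j. of_int (- 1 - j)) 0 (- 3) u =
      (\<Sum>j\<in>{- 2, - 1}. nterm (- 1) (\<psi> a) (\<psi> a) (\<lambda>j. of_int (- 1 - j)) 0 (- 3) u j)"
    proof (rule nop_finite_sum)
      show "nterm (- 1) (\<psi> a) (\<psi> a) (\<lambda>j. of_int (- 1 - j)) 0 (- 3) u j = 0" if "j \<notin> {- 2, - 1}" for j
        using u that by (simp add: nterm_def W0_\<psi> lin_\<psi>)
    qed simp
    then show ?thesis by (simp add: nterm_def)
  qed
  have X1: "L 2 (X a (- 2) (X a 0 u)) = 2 *\<^sub>C X a 0 (X a 0 u)" for a
    using W0_L[OF W0_X0[OF u], of 2] by (simp add: L_X lin_X)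
  have X2: "L 2 (X a (- 1) (X a (- 1) u)) = of_nat \<l> *\<^sub>C u" for a
  proof -
    have "X a 1 (X a (- 1) u) = of_nat \<l> *\<^sub>C u"
      using u by (simp add: X_X[of a 1] W0_X lin_X \<gamma>_diag)
    then show ?thesis
      using W0_L[OF u, of 2] u by (simp add: L_X lin_X lin_L W0_X)
  qed
  have \<psi>1: "L 2 (\<psi> a (- 2) (\<psi> a (- 1) u)) = (1 / 2) *\<^sub>C u" for a
  proof -
    have "\<psi> a 0 (\<psi> a (- 1) u) = u" using u by (simp add: \<psi>_\<psi>[of a 0] W0_\<psi> lin_\<psi>)
    then show ?thesis
      using W0_L[OF u, of 2] u by (simp add: L_\<psi> lin_\<psi> lin_L W0_\<psi>)
  qed
  have "L 2 (L (- 2) u) = (1 / 2) *\<^sub>C (\<Sum>a\<in>(UNIV :: 'n set). (1 / 2) *\<^sub>C u) +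
    of_real (1 / (2 * (real \<l> + g))) *\<^sub>C (4 *\<^sub>C (\<Sum>a\<in>UNIV. X a 0 (X a 0 u)) + (\<Sum>a\<in>(UNIV :: 'n set). of_nat \<l> *\<^sub>C u))"
    unfolding L_eq[of "- 2"] L\<psi>_def LX_def X \<psi> lin_L X1 X2 \<psi>1 by (simp add: sum.distrib cvec.scale_sum_right)
  also have "\<dots> = ((1 / 2) * (of_nat (card (UNIV :: 'n set)) * (1 / 2)) + of_real (1 / (2 * (real \<l> + g))) * (4 * of_real cV + of_nat (card (UNIV :: 'n set)) * of_nat \<l>)) *\<^sub>C u"
    unfolding W0_casimir[OF u] cvec.sum_constant_scale
    by (simp only: scaleC_scaleC scaleC_add_left scaleC_add_right distrib_left mult.assoc)
  also have "(1 / 2) * (of_nat (card (UNIV :: 'n set)) * (1 / 2)) + of_real (1 / (2 * (real \<l> + g))) * (4 * of_real cV + of_nat (card (UNIV :: 'n set)) * of_nat \<l>) =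
    complex_of_real ((1 / 2) * (real (card (UNIV :: 'n set)) * (1 / 2)) + (1 / (2 * (real \<l> + g))) * (4 * cV + real (card (UNIV :: 'n set)) * real \<l>))"
    by simp
  also have "(1 / 2) * (real (card (UNIV :: 'n set)) * (1 / 2)) + (1 / (2 * (real \<l> + g))) * (4 * cV + real (card (UNIV :: 'n set)) * real \<l>) = 4 * hw + cc / 2"
  proof -
    define y N where "y = real \<l> + g" and "N = real (card (UNIV :: 'n set))"
    have y: "y \<noteq> 0" "real \<l> = y - g" using level_pos by (simp_all add: y_def)
    show ?thesis
      unfolding cc_def hw_def y_def[symmetric] N_def[symmetric] unfolding y(2) using y(1) by (simp add: field_simps)
  qed
  finally show ?thesis .
qed

text \<open>For \<open>m = 1\<close> the coefficient of \<open>f (r + 1)\<close> is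
  \<open>r\<close>, so the recursion cannot pass from \<open>f 0\<close> to \<open>f 1\<close>. The
  value at 1 is therefore obtained separately from \<open>m = 2\<close>; the recursion covers larger
  indices, and the symmetry \<open>r -> - 1 - r\<close> the negative ones.\<close>

lemma f_eq: "f r v = 2 *\<^sub>C L 0 v + (of_real cc / 3 * (of_int r * (of_int r + 1))) *\<^sub>C v"
proof -
  let ?c = "of_real cc :: complex"
  have one: "f 1 v = 2 *\<^sub>C L 0 v + (?c / 3 * 2) *\<^sub>C v" for v
  proof -
    let ?Q = "\<lambda>v. D 1 (- 2) v - (?c / 3 * 2) *\<^sub>C v"
    have "?Q v = 0"
    proof (rule even_vanishes[of ?Q])
      show "clinear ?Q" by (rule clinearI) (simp_all add: clinear_simps[OF D_linear] algebra_simps)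
      fix u assume u: "u \<in> W0"
      \<comment> \<open>The case \<open>m = 2\<close>, \<open>r = - 1\<close>: here
        \<open>f (- 1)\<close> equals \<open>f 0\<close>, and \<open>r + m\<close> is 1. The summand
        \<open>L (- 2) (L 2 u)\<close> vanishes.\<close>
      have "(3 / 2) *\<^sub>C f 1 u = 2 *\<^sub>C L 2 (L (- 2) u) - (5 / 2) *\<^sub>C f 0 u"
        using L_commutator_f[of 2 u "- 1"] f_sym[of 0 u] W0_L[OF u, of 2] by (simp add: lin_L field_simps)
      also have "\<dots> = (2 * of_real (4 * hw + cc / 2) - 5 * of_real hw) *\<^sub>C u"
        unfolding L_2_L_neg2[OF u] f_0 W0_L0[OF u]
        by (simp add: cvec.scale_left_diff_distrib del: of_real_add)
      also have "2 * of_real (4 * hw + cc / 2) - 5 * of_real hw = (3 / 2) * (2 * of_real hw + ?c / 3 * 2)"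
        by (simp add: field_simps)
      finally have "(3 / 2) *\<^sub>C f 1 u = (3 / 2) *\<^sub>C (2 * of_real hw + ?c / 3 * 2) *\<^sub>C u"
        by simp
      then have "f 1 u = (2 * of_real hw + ?c / 3 * 2) *\<^sub>C u"
        unfolding cvec.scale_cancel_left by simp
      then show "?Q u = 0"
        using f_D[of 1 u] unfolding W0_L0[OF u] by (simp add: algebra_simps)
    qed (simp_all add: D_X D_\<psi> lin_X lin_\<psi>)
    then show ?thesis using f_D[of 1 v] by simp
  qed
  have nat: "f (int n + 1) v = 2 *\<^sub>C L 0 v + (?c / 3 * (of_nat (n + 1) * of_nat (n + 2))) *\<^sub>C v" for n v
  proof (induction n)
    case 0
    then show ?case using one[of v] by simp
  next
    case (Suc n)
    define t :: complex where "t = of_nat (n + 1)"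
    have t0: "t \<noteq> 0" unfolding t_def using of_nat_neq_0[of n] by simp
    \<comment> \<open>Comparison of \<open>r = 0\<close> with \<open>r = n + 1\<close> for
      \<open>m = 1\<close>; at \<open>r = 0\<close> the term with \<open>f 1\<close> drops
      out.\<close>
    have "2 *\<^sub>C f 0 v = (t + 2) *\<^sub>C f (int n + 1) v - t *\<^sub>C f (int n + 2) v"
    proof -
      have 1: "2 *\<^sub>C (L 1 (L (- 1) v) - L (- 1) (L 1 v)) = 2 *\<^sub>C f 0 v"
        using L_commutator_f[of 1 v 0] by simp
      have 2: "of_int (int n + 1) + 1 / 2 + 3 * of_int 1 / 2 = t + 2" "of_int (int n + 1) + 1 / 2 - of_int 1 / 2 = t"
        "int n + 1 + 1 = int n + 2"
        by (simp_all add: t_def)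
      show ?thesis using L_commutator_f[of 1 v "int n + 1"] unfolding 1 2 by simp
    qed
    then have "t *\<^sub>C f (int n + 2) v = (t + 2) *\<^sub>C f (int n + 1) v - 2 *\<^sub>C f 0 v"
      by (simp add: algebra_simps)
    also have "\<dots> = t *\<^sub>C (2 *\<^sub>C L 0 v + (?c / 3 * ((t + 1) * (t + 2))) *\<^sub>C v)"
    proof -
      have gen: "(t + 2) *\<^sub>C (2 *\<^sub>C y + k *\<^sub>C w) - 2 *\<^sub>C 2 *\<^sub>C y = t *\<^sub>C (2 *\<^sub>C y + k' *\<^sub>C w)"
        if "(t + 2) * k = t * k'" for k k' and y w :: 't
      proof -
        have "((t + 2) * 2) *\<^sub>C y - (2 * 2) *\<^sub>C y = (t * 2) *\<^sub>C y"
          unfolding cvec.scale_left_diff_distrib[symmetric]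
          by (rule arg_cong[where f = "\<lambda>k. k *\<^sub>C y"]) (simp add: algebra_simps)
        then show ?thesis
          unfolding scaleC_add_right scaleC_scaleC that by (simp add: algebra_simps)
      qed
      show ?thesis
        unfolding Suc.IH f_0
      proof (rule gen)
        have t: "of_nat (n + 1) = t" "of_nat (n + 2) = t + 1" by (simp_all add: t_def)
        show "(t + 2) * (?c / 3 * (of_nat (n + 1) * of_nat (n + 2))) = t * (?c / 3 * ((t + 1) * (t + 2)))"
          unfolding t by (simp only: mult_ac)
      qed
    qed
    finally have "f (int n + 2) v = 2 *\<^sub>C L 0 v + (?c / 3 * ((t + 1) * (t + 2))) *\<^sub>C v"
      using t0 unfolding cvec.scale_cancel_left by simp
    then show ?case by (simp add: t_def algebra_simps)
  qed
  consider "r = 0" | "r = - 1" | n where "r = int n + 1" | n where "r = - 1 - (int n + 1)"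
  proof -
    have "r = 0 \<or> r = - 1 \<or> r = int (nat (r - 1)) + 1 \<or> r = - 1 - (int (nat (- r - 2)) + 1)" by auto
    then show ?thesis using that by blast
  qed
  then show ?thesis
  proof cases
    case 1 then show ?thesis by (simp add: f_0)
  next
    case 2 then show ?thesis using f_sym[of 0 v] by (simp add: f_0)
  next
    case 3 then show ?thesis using nat[of n v] by (simp add: add.commute)
  next
    case (4 n)
    then show ?thesis unfolding 4 f_sym nat by (simp add: algebra_simps)
  qed
qed

section \<open>The Neveu-Schwarz relations\<close>

lemma G_G: "G r (G s v) + G s (G r v) = 2 *\<^sub>C L (r + s + 1) v +
    (if r + s + 1 = 0 then (((of_int r + 1 / 2) ^ 2 - 1 / 4) / 3) *\<^sub>C of_real cc *\<^sub>C v else 0)"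
proof (cases "r + s + 1 = 0")
  case True
  then have s: "s = - 1 - r" by simp
  have e: "((of_int r + 1 / 2) ^ 2 - 1 / 4) / 3 * of_real cc = of_real cc / 3 * (of_int r * (of_int r + 1) :: complex)"
    by (simp add: power2_eq_square field_simps)
  show ?thesis unfolding s scaleC_scaleC e using f_eq[of r v] by (simp add: f_def)
next
  case False
  then show ?thesis using D_off_diagonal[OF False, of v] by (simp add: D_def)
qed

text \<open>Every \<open>L n\<close> is half of \<open>{G 0, G (n - 1)}\<close>, without central
  term since \<open>(1/2)^2 - 1/4 = 0\<close>. So the bracket with \<open>L m\<close> follows from
  \<open>L_GG\<close> and the anticommutators already computed.\<close>

lemma L_L: "L m (L n v) - L n (L m v) = of_int (m - n) *\<^sub>C L (m + n) v +
    (if m + n = 0 then (of_int (m ^ 3 - m) / 12) *\<^sub>C of_real cc *\<^sub>C v else 0)"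
proof -
  have n: "G 0 (G (n - 1) w) + G (n - 1) (G 0 w) = 2 *\<^sub>C L n w" for w n
    unfolding G_G by (simp add: power2_eq_square)
  define z :: complex where "z = (of_int m - 1) / 2"
  have z: "of_int 0 + 1 / 2 - of_int m / 2 = - z" "of_int (n - 1) + 1 / 2 - of_int m / 2 = of_int n - 1 - z"
    by (simp_all add: z_def field_simps)
  have e: "(((of_int m + 1 / 2)\<^sup>2 - 1 / 4) / 3) = (of_int m * (of_int m + 1) / 3 :: complex)"
    by (simp add: power2_eq_square field_simps)
  have i: "0 + m = m" "n - 1 + m = (m + n) - 1" "m + (n - 1) + 1 = m + n" by simp_all
  have "2 *\<^sub>C (L m (L n v) - L n (L m v)) = z *\<^sub>C (2 *\<^sub>C L (m + n) v +
     (if m + n = 0 then (of_int m * (of_int m + 1) / 3) *\<^sub>C of_real cc *\<^sub>C v else 0)) - (of_int n - 1 - z) *\<^sub>C 2 *\<^sub>C L (m + n) v"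
    using L_GG[of m 0 "n - 1" v] unfolding n z i lin_L unfolding G_G[of m] e i
    by (simp only: cvec.scale_right_diff_distrib cvec.scale_minus_left minus_minus)
  also have "\<dots> = 2 *\<^sub>C (of_int (m - n) *\<^sub>C L (m + n) v +
    (if m + n = 0 then (of_int (m ^ 3 - m) / 12) *\<^sub>C of_real cc *\<^sub>C v else 0))"
  proof -
    have c: "z * 2 - (of_int n - 1 - z) * 2 = 2 * of_int (m - n)"
      and c': "z * (of_int m * (of_int m + 1) / 3) = 2 * (of_int (m ^ 3 - m) / 12)"
      by (simp_all add: z_def field_simps power3_eq_cube)
    have gen: "z *\<^sub>C (2 *\<^sub>C t + k *\<^sub>C w) - y *\<^sub>C 2 *\<^sub>C t = 2 *\<^sub>C (d *\<^sub>C t + k' *\<^sub>C w)"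
      if "z * 2 - y * 2 = 2 * d" "z * k = 2 * k'" for z y k d k' and t w :: 't
      unfolding scaleC_add_right scaleC_scaleC that[symmetric] cvec.scale_left_diff_distrib by simp
    show ?thesis
    proof (cases "m + n = 0")
      case True
      show ?thesis unfolding if_P[OF True] by (rule gen[OF c c'])
    next
      case False
      show ?thesis
        unfolding if_not_P[OF False] using gen[OF c, where k = 0 and k' = 0 and t = "L (m + n) v" and w = 0] by simp
    qed
  qed
  finally show ?thesis unfolding cvec.scale_cancel_left by simp
qed

theorem unitary_ns: "unitary_ns_action L G (\<lambda>x. of_real cc *\<^sub>C x)"
  unfolding unitary_ns_action_def ns_action_def ns_relations_def
proof (intro conjI allI ballI)
  show "clinear T" if "T \<in> ns_ops L G (\<lambda>x. of_real cc *\<^sub>C x)" for T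
  proof -
    have "clinear (\<lambda>x::'t. of_real cc *\<^sub>C x)" by (rule clinearI) (simp_all add: algebra_simps)
    then show ?thesis
      using that field_linear[OF field_L] field_linear[OF field_G] by (auto simp: ns_ops_def)
  qed
  show "G r (L n v) - L n (G r v) - (of_int r + 1 / 2 - of_int n / 2) *\<^sub>C G (r + n) v \<in> {0}" for r n v
    by (simp add: G_L)
  show "adjoint_pair (L n) (L (- n))" for n by (rule adj_L)
  show "adjoint_pair (G r) (G (- r - 1))" for r by (rule adj_G)
  show "adjoint_pair (\<lambda>x. of_real cc *\<^sub>C x) (\<lambda>x :: 't. of_real cc *\<^sub>C x)"
    by (simp add: adjoint_pair_def cinner_simps)
qed (simp_all add: L_L G_G lin_L lin_G)

end

section \<open>Highest weight vectors and Verma modules\<close>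

definition lin_ext :: "('w \<Rightarrow> 'b::complex_vector) \<Rightarrow> ('w \<Rightarrow>\<^sub>0 complex) \<Rightarrow> 'b" where
  "lin_ext f t = (\<Sum>w\<in>Poly_Mapping.keys t. Poly_Mapping.lookup t w *\<^sub>C f w)"

lemma lookup_scaleC [simp]: "Poly_Mapping.lookup (a *\<^sub>C x) k = a *\<^sub>C Poly_Mapping.lookup x k"
  by (simp add: scaleC_poly_mapping_def Poly_Mapping.map.rep_eq when_def)

lemma lin_ext_superset:
  assumes "finite A" "Poly_Mapping.keys t \<subseteq> A"
  shows "lin_ext f t = (\<Sum>w\<in>A. Poly_Mapping.lookup t w *\<^sub>C f w)"
  unfolding lin_ext_def using assms by (intro sum.mono_neutral_left) (auto simp: in_keys_iff)

lemma lin_ext_linear: "clinear (lin_ext f)"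
proof (rule clinearI)
  fix x y :: "'a \<Rightarrow>\<^sub>0 complex" and a
  let ?A = "Poly_Mapping.keys x \<union> Poly_Mapping.keys y"
  show "lin_ext f (x + y) = lin_ext f x + lin_ext f y"
    using Poly_Mapping.keys_add[of x y]
    by (simp add: lin_ext_superset[of ?A] lookup_add scaleC_add_left sum.distrib)
  have "Poly_Mapping.keys (a *\<^sub>C x) \<subseteq> Poly_Mapping.keys x"
    by (auto simp: in_keys_iff scaleC_complex_def)
  then show "lin_ext f (a *\<^sub>C x) = a *\<^sub>C lin_ext f x"
    by (simp add: lin_ext_superset[of "Poly_Mapping.keys x"] scaleC_complex_def cvec.scale_sum_right)
qed

lemma lin_ext_single [simp]: "lin_ext f (Poly_Mapping.single w 1) = f w"
  by (simp add: lin_ext_def)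

lemma lin_ext_compose: "clinear T \<Longrightarrow> T (lin_ext f t) = lin_ext (\<lambda>w. T (f w)) t"
  by (simp add: lin_ext_def clinear_simps)

lemma lin_ext_id: "lin_ext (\<lambda>w. Poly_Mapping.single w 1) t = t"
proof (rule poly_mapping_eqI)
  fix k
  have l: "Poly_Mapping.lookup (\<Sum>w\<in>A. F w) k = (\<Sum>w\<in>A. Poly_Mapping.lookup (F w) k)" for A and F :: "'a \<Rightarrow> 'a \<Rightarrow>\<^sub>0 complex"
    by (induction A rule: infinite_finite_induct) (auto simp: lookup_add)
  have "Poly_Mapping.lookup (lin_ext (\<lambda>w. Poly_Mapping.single w 1) t) k =
    (\<Sum>w\<in>Poly_Mapping.keys t. if w = k then Poly_Mapping.lookup t w else 0)"
    unfolding lin_ext_def l by (intro sum.cong) (auto simp: lookup_single when_def scaleC_complex_def)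
  then show "Poly_Mapping.lookup (lin_ext (\<lambda>w. Poly_Mapping.single w 1) t) k = Poly_Mapping.lookup t k"
    by (simp add: in_keys_iff)
qed

lemma left_mult_eq: "left_mult x = lin_ext (\<lambda>w. Poly_Mapping.single (x # w) 1)"
proof
  fix t
  have "Poly_Mapping.single w k = k *\<^sub>C Poly_Mapping.single w 1" for w :: "ns_gen list" and k
    by (rule poly_mapping_eqI) (simp add: lookup_single when_def scaleC_complex_def)
  then show "left_mult x t = lin_ext (\<lambda>w. Poly_Mapping.single (x # w) 1) t"
    unfolding left_mult_def lin_ext_def by (intro sum.cong refl)
qed

lemma left_mult_linear: "clinear (left_mult x)"
  unfolding left_mult_eq by (rule lin_ext_linear)

lemma left_mult_single [simp]: "left_mult x (Poly_Mapping.single w 1) = Poly_Mapping.single (x # w) 1"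
  by (simp add: left_mult_eq)

section \<open>Evaluation of words on a highest weight vector\<close>

locale ns_highest_weight =
  fixes L G :: "int \<Rightarrow> 't::complex_prehilbert \<Rightarrow> 't" and c h :: real and \<omega> :: 't
  assumes unitary: "unitary_ns_action L G (\<lambda>x. of_real c *\<^sub>C x)"
    and norm_\<omega>: "cinner \<omega> \<omega> = 1" and L0_\<omega>: "L 0 \<omega> = of_real h *\<^sub>C \<omega>"
    and L_\<omega>: "n > 0 \<Longrightarrow> L n \<omega> = 0" and G_\<omega>: "r \<ge> 0 \<Longrightarrow> G r \<omega> = 0"
begin

abbreviation C :: "'t \<Rightarrow> 't" where "C \<equiv> \<lambda>x. of_real c *\<^sub>C x"

fun gen_op :: "ns_gen \<Rightarrow> 't \<Rightarrow> 't" where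
  "gen_op (Lgen n) = L n"
| "gen_op (Ggen r) = G r"
| "gen_op Cgen = C"

fun gen_adj :: "ns_gen \<Rightarrow> ns_gen" where
  "gen_adj (Lgen n) = Lgen (- n)"
| "gen_adj (Ggen r) = Ggen (- r - 1)"
| "gen_adj Cgen = Cgen"

fun lowering :: "ns_gen \<Rightarrow> bool" where
  "lowering (Lgen n) = (n < 0)"
| "lowering (Ggen r) = (r < 0)"
| "lowering Cgen = False"

lemma gen_op_linear: "clinear (gen_op x)"
  using unitary by (cases x) (auto simp: unitary_ns_action_def ns_action_def ns_ops_def)

lemma gen_op_adjoint: "cinner (gen_op x u) v = cinner u (gen_op (gen_adj x) v)"
  using unitary by (cases x) (auto simp: unitary_ns_action_def adjoint_pair_def)

definition \<phi> :: "ns_free \<Rightarrow> 't" where "\<phi> = lin_ext (\<lambda>w. foldr gen_op w \<omega>)"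

lemma \<phi>_linear: "clinear \<phi>"
  unfolding \<phi>_def by (rule lin_ext_linear)

lemmas lin_\<phi> = clinear_simps[OF \<phi>_linear]
lemmas lin_left_mult = clinear_simps[OF left_mult_linear]

lemma \<phi>_left_mult: "\<phi> (left_mult x t) = gen_op x (\<phi> t)"
  unfolding left_mult_eq lin_ext_compose[OF \<phi>_linear]
  unfolding \<phi>_def lin_ext_compose[OF gen_op_linear] by simp

lemma \<phi>_one: "\<phi> free_one = \<omega>"
  by (simp add: \<phi>_def free_one_def)

abbreviation I where "I \<equiv> verma_ideal c h"

lemma I_subspace: "cvec.subspace I"
  unfolding verma_ideal_def by (rule cvec.subspace_Inter) (auto simp: invariant_under_def)

lemma I_left_mult: "t \<in> I \<Longrightarrow> left_mult x t \<in> I"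
  unfolding verma_ideal_def by (cases x) (auto simp: invariant_under_def ns_ops_def)

lemma I_relations: "ns_relations I free_L free_G free_C"
  unfolding verma_ideal_def ns_relations_def by blast

lemma I_one:
  "free_L 0 free_one - of_real h *\<^sub>C free_one \<in> I" "free_C free_one - of_real c *\<^sub>C free_one \<in> I"
  "n > 0 \<Longrightarrow> free_L n free_one \<in> I" "r \<ge> 0 \<Longrightarrow> free_G r free_one \<in> I"
  unfolding verma_ideal_def by blast+

text \<open>The kernel of \<open>\<phi>\<close> is itself one of the left ideals whose intersection
  is \<open>I\<close>; the relations hold in the target because the action there satisfies them
  exactly.\<close>

lemma I_\<phi>: assumes "t \<in> I" shows "\<phi> t = 0"
proof -
  have "I \<subseteq> {t. \<phi> t = 0}"
    unfolding verma_ideal_def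
  proof (rule Inter_lower, intro CollectI conjI)
    show "invariant_under (ns_ops free_L free_G free_C) {t. \<phi> t = 0}"
      by (auto simp: invariant_under_def cvec.subspace_def lin_\<phi> ns_ops_def \<phi>_left_mult clinear_zero[OF gen_op_linear]
          simp del: gen_op.simps)
    show "ns_relations {t. \<phi> t = 0} free_L free_G free_C"
      using unitary
      by (simp add: ns_relations_def unitary_ns_action_def ns_action_def lin_\<phi> \<phi>_left_mult if_distrib[of \<phi>] cong: if_cong)
  qed (auto simp: lin_\<phi> \<phi>_left_mult \<phi>_one L0_\<omega> L_\<omega> G_\<omega>)
  with assms show ?thesis by auto
qed

section \<open>The Verma module as a quotient of the free algebra\<close>

definition \<pi> :: "ns_free \<Rightarrow> ns_free set" where
  "\<pi> t = ns_coset (ns_subspace free_L free_G free_C UNIV) I t"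

lemma \<pi>_eq: "\<pi> t = {t + k | k. k \<in> I}"
  by (simp add: \<pi>_def ns_coset_def ns_subspace_def)

lemma \<pi>_mem: "s \<in> \<pi> t \<longleftrightarrow> s - t \<in> I"
  unfolding \<pi>_eq by (auto intro: exI[of _ "s - t"])

lemma \<pi>_eq_iff: "\<pi> s = \<pi> t \<longleftrightarrow> s - t \<in> I"
proof
  assume "\<pi> s = \<pi> t"
  then show "s - t \<in> I" using cvec.subspace_0[OF I_subspace] \<pi>_mem[of s s] \<pi>_mem[of s t] by simp
next
  assume st: "s - t \<in> I"
  have "u - s \<in> I \<longleftrightarrow> u - t \<in> I" for u
    using cvec.subspace_add[OF I_subspace _ st, of "u - s"] cvec.subspace_diff[OF I_subspace _ st, of "u - t"] by auto
  then show "\<pi> s = \<pi> t" by (auto simp: \<pi>_mem)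
qed

lemma \<pi>_\<phi>: "s \<in> \<pi> t \<Longrightarrow> \<phi> s = \<phi> t"
  using I_\<phi>[of "s - t"] by (simp add: \<pi>_mem lin_\<phi>)

lemma \<pi>_self: "t \<in> \<pi> t"
  by (simp add: \<pi>_mem cvec.subspace_0[OF I_subspace])

text \<open>Operations of the quotient are unions over all representatives; if \<open>F\<close>
  respects congruence modulo \<open>I\<close>, all cosets in the union coincide.\<close>

lemma \<pi>_UN:
  assumes "\<And>u. u \<in> \<pi> t \<Longrightarrow> F u - F t \<in> I"
  shows "(\<Union>u\<in>\<pi> t. \<pi> (F u)) = \<pi> (F t)"
proof -
  have "\<pi> (F u) = \<pi> (F t)" if "u \<in> \<pi> t" for u using assms[OF that] by (simp add: \<pi>_eq_iff)
  then have "(\<Union>u\<in>\<pi> t. \<pi> (F u)) = (\<Union>u\<in>\<pi> t. \<pi> (F t))" by (intro SUP_cong refl)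
  also have "\<dots> = \<pi> (F t)" using \<pi>_self[of t] by blast
  finally show ?thesis .
qed

lemma verma_ops:
  "ns_carrier (verma c h) = range \<pi>"
  "ns_add (verma c h) (\<pi> s) (\<pi> t) = \<pi> (s + t)"
  "ns_smult (verma c h) a (\<pi> t) = \<pi> (a *\<^sub>C t)"
  "ns_L (verma c h) n (\<pi> t) = \<pi> (free_L n t)"
  "ns_G (verma c h) r (\<pi> t) = \<pi> (free_G r t)"
  "ns_C (verma c h) (\<pi> t) = \<pi> (free_C t)"
proof -
  note sub = I_subspace
  have p: "ns_coset (ns_subspace free_L free_G free_C UNIV) I = \<pi>" by (auto simp: \<pi>_def)
  have m: "left_mult x u - left_mult x t \<in> I" if "u \<in> \<pi> t" for x u t
    using I_left_mult[of "u - t" x] that by (simp add: \<pi>_mem lin_left_mult)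
  show "ns_carrier (verma c h) = range \<pi>"
    by (simp add: verma_def ns_quotient_def p) (simp add: ns_subspace_def)
  show "ns_add (verma c h) (\<pi> s) (\<pi> t) = \<pi> (s + t)"
  proof -
    have "(\<Union>v\<in>\<pi> t. \<pi> (u + v)) = \<pi> (u + t)" for u
      by (rule \<pi>_UN) (simp add: \<pi>_mem)
    moreover have "(\<Union>u\<in>\<pi> s. \<pi> (u + t)) = \<pi> (s + t)"
      by (rule \<pi>_UN) (simp add: \<pi>_mem)
    ultimately show ?thesis
      by (simp add: verma_def ns_quotient_def p) (simp add: ns_subspace_def)
  qed
  show "ns_smult (verma c h) a (\<pi> t) = \<pi> (a *\<^sub>C t)"
    using \<pi>_UN[of t "\<lambda>u. a *\<^sub>C u"] cvec.subspace_scale[OF sub]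
    by (simp add: verma_def ns_quotient_def p) (simp add: ns_subspace_def \<pi>_mem cvec.scale_right_diff_distrib[symmetric])
  show "ns_L (verma c h) n (\<pi> t) = \<pi> (free_L n t)"
    using \<pi>_UN[of t "free_L n", OF m] by (simp add: verma_def ns_quotient_def p) (simp add: ns_subspace_def)
  show "ns_G (verma c h) r (\<pi> t) = \<pi> (free_G r t)"
    using \<pi>_UN[of t "free_G r", OF m] by (simp add: verma_def ns_quotient_def p) (simp add: ns_subspace_def)
  show "ns_C (verma c h) (\<pi> t) = \<pi> (free_C t)"
    using \<pi>_UN[of t "free_C", OF m] by (simp add: verma_def ns_quotient_def p) (simp add: ns_subspace_def)
qed

section \<open>Existence and uniqueness of the canonical form\<close>

lemma verma_vector_eq: "verma_vector c h = \<pi> free_one"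
  by (simp add: verma_vector_def \<pi>_def)

text \<open>The pullback of the inner product. An arbitrary representative may be chosen in each
  coset because \<open>\<phi>\<close> is constant on it.\<close>

lemma canonical_exists: "\<exists>B. canonical_form (verma c h) (\<pi> free_one) B"
proof -
  define B where "B A A' = cinner (\<phi> (SOME s. s \<in> A)) (\<phi> (SOME s. s \<in> A'))" for A A'
  have [simp]: "\<phi> (SOME s. s \<in> \<pi> t) = \<phi> t" for t
    using \<pi>_self[of t] by (intro \<pi>_\<phi> someI)
  have "canonical_form (verma c h) (\<pi> free_one) B"
    using gen_op_adjoint[of "Lgen _"] gen_op_adjoint[of "Ggen _"] gen_op_adjoint[of Cgen]
    by (auto simp: canonical_form_def verma_ops B_def lin_\<phi> \<phi>_left_mult \<phi>_one norm_\<omega> cinner_simps)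
  then show ?thesis by blast
qed

text \<open>A uniform shape for all brackets: the exchange costs a sign \<open>\<epsilon>\<close>,
  which is -1 just for two odd generators, plus one generator \<open>z\<close> and a multiple of the
  central one. When no bracket term occurs, \<open>Cgen\<close> with coefficient 0 fills the place
  of \<open>z\<close>.\<close>

lemma left_mult_swap:
  assumes "x \<noteq> Cgen"
  obtains \<epsilon> a b z where "\<And>t. left_mult x (left_mult y t) - (\<epsilon> *\<^sub>C left_mult y (left_mult x t) +
    (a *\<^sub>C left_mult z t + b *\<^sub>C free_C t)) \<in> I"
proof -
  note rel = I_relations[unfolded ns_relations_def]
  have rLC: "free_L n (free_C t) - free_C (free_L n t) \<in> I" for n t using rel by blast
  have rGC: "free_G n (free_C t) - free_C (free_G n t) \<in> I" for n t using rel by blast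
  have rLL: "free_L m (free_L n v) - free_L n (free_L m v) - (of_int (m - n) *\<^sub>C free_L (m + n) v
           + (if m + n = 0 then (of_int (m ^ 3 - m) / 12) *\<^sub>C free_C v else 0)) \<in> I" for m n v using rel by blast
  have rGL: "free_G r (free_L n v) - free_L n (free_G r v)
        - ((of_int r + 1 / 2) - of_int n / 2) *\<^sub>C free_G (r + n) v \<in> I" for r n v using rel by blast
  have rGG: "free_G r (free_G s v) + free_G s (free_G r v) - (2 *\<^sub>C free_L (r + s + 1) v
           + (if r + s + 1 = 0 then (((of_int r + 1 / 2) ^ 2 - 1 / 4) / 3) *\<^sub>C free_C v else 0)) \<in> I" for r s v using rel by blast
  have neg: "- t \<in> I" if "t \<in> I" for t using that by (rule cvec.subspace_neg[OF I_subspace])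
  show thesis
  proof (cases x)
    case x: (Lgen m)
    show thesis
    proof (cases y)
      case (Lgen n)
      show thesis
        by (rule that[of 1 "of_int (m - n)" "Lgen (m + n)" "if m + n = 0 then of_int (m ^ 3 - m) / 12 else 0"])
          (use rLL[of m n] x Lgen in \<open>auto simp: diff_diff_eq split: if_splits\<close>)
    next
      case (Ggen r)
      show thesis
      proof (rule that[of 1 "- ((of_int r + 1 / 2) - of_int m / 2)" "Ggen (r + m)" 0])
        show "left_mult x (left_mult y t) - (1 *\<^sub>C left_mult y (left_mult x t) +
          (- ((of_int r + 1 / 2) - of_int m / 2) *\<^sub>C free_G (r + m) t + 0 *\<^sub>C free_C t)) \<in> I" for t
          using neg[OF rGL[of r m t]] x Ggen by (simp add: algebra_simps)
      qed
    next
      case Cgen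
      show thesis by (rule that[of 1 0 Cgen 0]) (use rLC x Cgen in auto)
    qed
  next
    case x: (Ggen r)
    show thesis
    proof (cases y)
      case (Lgen n)
      show thesis
        by (rule that[of 1 "(of_int r + 1 / 2) - of_int n / 2" "Ggen (r + n)" 0])
          (use rGL[of r n] x Lgen in \<open>auto simp: diff_diff_eq\<close>)
    next
      case (Ggen s)
      show thesis
      proof (rule that[of "- 1" 2 "Lgen (r + s + 1)" "if r + s + 1 = 0 then ((of_int r + 1 / 2) ^ 2 - 1 / 4) / 3 else 0"])
        show "left_mult x (left_mult y t) - (- 1 *\<^sub>C left_mult y (left_mult x t) +
          (2 *\<^sub>C free_L (r + s + 1) t + (if r + s + 1 = 0 then ((of_int r + 1 / 2) ^ 2 - 1 / 4) / 3 else 0) *\<^sub>C free_C t)) \<in> I" for t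
          using rGG[of r s t] x Ggen by (auto simp: algebra_simps split: if_splits)
      qed
    next
      case Cgen
      show thesis by (rule that[of 1 0 Cgen 0]) (use rGC x Cgen in auto)
    qed
  qed (use assms in simp)
qed

lemma foldr_left_mult_linear: "clinear (foldr left_mult u)"
proof (induction u)
  case Nil
  then show ?case by (auto intro: clinearI)
next
  case (Cons x u)
  then show ?case by (auto intro!: clinearI simp: clinear_simps lin_left_mult)
qed

lemma foldr_left_mult_single: "foldr left_mult u (Poly_Mapping.single w 1) = Poly_Mapping.single (u @ w) 1"
  by (induction u) auto

lemma foldr_left_mult_I: "t \<in> I \<Longrightarrow> foldr left_mult u t \<in> I"
  by (induction u) (auto intro: I_left_mult)

text \<open>Any other generator can be moved to the right until it reaches \<open>\<Omega>\<close>, at the cost of shorter words.\<close>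

lemma functional_vanishes:
  fixes \<beta> :: "ns_free \<Rightarrow> complex"
  assumes add: "\<And>s t. \<beta> (s + t) = \<beta> s + \<beta> t" and scale: "\<And>a t. \<beta> (a *\<^sub>C t) = cnj a * \<beta> t"
    and I: "\<And>t. t \<in> I \<Longrightarrow> \<beta> t = 0" and one: "\<beta> free_one = 0"
    and low: "\<And>x t. lowering x \<Longrightarrow> \<beta> (left_mult x t) = 0"
    and L0: "\<And>t. \<beta> (free_L 0 t) = of_real h * \<beta> t" and C: "\<And>t. \<beta> (free_C t) = of_real c * \<beta> t"
  shows "\<beta> t = 0"
proof -
  let ?W = "\<lambda>w. Poly_Mapping.single w 1 :: ns_free"
  have zero: "\<beta> 0 = 0" using scale[of 0 0] by simp
  have diff: "\<beta> (s - t) = \<beta> s - \<beta> t" for s t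
    using add[of "s - t" t] by (simp add: algebra_simps)
  have words: "\<forall>w. length w \<le> n \<longrightarrow> \<beta> (?W w) = 0" for n
  proof (induction n)
    case 0
    then show ?case using one by (simp add: free_one_def)
  next
    case (Suc n)
    have raise: "\<beta> (?W (u @ x # w)) = 0"
      if x: "left_mult x free_one \<in> I" "x \<noteq> Cgen" and len: "length u + length w \<le> n" for u x w
      using len
    proof (induction w arbitrary: u)
      case Nil
      have "?W (u @ [x]) = foldr left_mult u (left_mult x free_one)"
        by (simp add: free_one_def foldr_left_mult_single)
      then show ?case using I[OF foldr_left_mult_I[OF x(1), of u]] by simp
    next
      case (Cons y w)
      obtain \<epsilon> a b z where sw: "\<And>t. left_mult x (left_mult y t) - (\<epsilon> *\<^sub>C left_mult y (left_mult x t) +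
          (a *\<^sub>C left_mult z t + b *\<^sub>C free_C t)) \<in> I"
        by (rule left_mult_swap[OF x(2), of y]) (rule that)
      have "\<beta> (foldr left_mult u (left_mult x (left_mult y (?W w)) - (\<epsilon> *\<^sub>C left_mult y (left_mult x (?W w)) +
          (a *\<^sub>C left_mult z (?W w) + b *\<^sub>C free_C (?W w))))) = 0"
        by (rule I[OF foldr_left_mult_I[OF sw]])
      then have "\<beta> (?W (u @ x # y # w)) = cnj \<epsilon> * \<beta> (?W ((u @ [y]) @ x # w)) +
          (cnj a * \<beta> (?W (u @ z # w)) + cnj b * \<beta> (?W (u @ Cgen # w)))"
        by (simp add: clinear_simps[OF foldr_left_mult_linear] foldr_left_mult_single diff add scale)
      moreover have "\<beta> (?W ((u @ [y]) @ x # w)) = 0" using Cons.prems by (intro Cons.IH) simp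
      moreover have "\<beta> (?W (u @ z # w)) = 0" "\<beta> (?W (u @ Cgen # w)) = 0"
        using Cons.prems Suc.IH by simp_all
      ultimately show ?case by simp
    qed
    show ?case
    proof (intro allI impI)
      fix w :: "ns_gen list" assume "length w \<le> Suc n"
      then consider "w = []" | x w' where "w = x # w'" "length w' \<le> n" by (cases w) auto
      then show "\<beta> (?W w) = 0"
      proof cases
        case 1
        then show ?thesis using one by (simp add: free_one_def)
      next
        case (2 x w')
        then have e: "\<beta> (?W w) = \<beta> (left_mult x (?W w'))" and w': "\<beta> (?W w') = 0" using Suc.IH by auto
        \<comment> \<open>For the leftmost generator there are three immediate cases: lowering
          generators are killed by assumption, and \<open>L 0\<close> and the central element act by
          scalars. Any other one annihilates the generating vector and is moved to the right by
          \<open>raise\<close>.\<close>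
        consider "lowering x" | "x = Lgen 0" | "x = Cgen" | "x \<noteq> Cgen" "left_mult x free_one \<in> I"
        proof (cases x)
          case (Lgen n)
          then show ?thesis using I_one(3)[of n] that by (cases n "0 :: int" rule: linorder_cases) auto
        next
          case (Ggen r)
          then show ?thesis using I_one(4)[of r] that by (cases "r < 0") auto
        qed (use that in simp)
        then show ?thesis
        proof cases
          case 4
          then show ?thesis using raise[of x "[]" w'] 2 by simp
        next
          case 1
          then show ?thesis using low[of x "?W w'"] e by simp
        next
          case 2
          then show ?thesis unfolding e using L0[of "?W w'"] w' by simp
        next
          case 3
          then show ?thesis unfolding e using C[of "?W w'"] w' by simp
        qed
      qed
    qed
  qed
  have "\<beta> (?W w) = 0" for w using words[of "length w"] by blast
  moreover have s: "\<beta> (\<Sum>w\<in>A. F w) = (\<Sum>w\<in>A. \<beta> (F w))" for A :: "ns_gen list set" and F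
    by (induction A rule: infinite_finite_induct) (auto simp: zero add)
  ultimately have "\<beta> (lin_ext ?W t) = 0"
    unfolding lin_ext_def s scale by simp
  then show ?thesis by (simp add: lin_ext_id)
qed

text \<open>With the generating vector in the first slot, both forms vanish on the image of every
  lowering operator, since its adjoint kills that vector; \<open>functional_vanishes\<close> applies
  to their difference, which is conjugate-linear as a function of the second slot. Words in the
  first slot are then moved across, letter by letter.\<close>

lemma canonical_unique:
  assumes "canonical_form (verma c h) (\<pi> free_one) B"
  shows "B (\<pi> s) (\<pi> t) = cinner (\<phi> s) (\<phi> t)"
proof -
  have one: "B (\<pi> free_one) (\<pi> free_one) = 1"
    and addl: "\<And>s s' t. B (\<pi> (s + s')) (\<pi> t) = B (\<pi> s) (\<pi> t) + B (\<pi> s') (\<pi> t)"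
    and addr: "\<And>s s' t. B (\<pi> t) (\<pi> (s + s')) = B (\<pi> t) (\<pi> s) + B (\<pi> t) (\<pi> s')"
    and sl: "\<And>a s t. B (\<pi> (a *\<^sub>C s)) (\<pi> t) = a * B (\<pi> s) (\<pi> t)"
    and sr: "\<And>a s t. B (\<pi> s) (\<pi> (a *\<^sub>C t)) = cnj a * B (\<pi> s) (\<pi> t)"
    using assms unfolding canonical_form_def verma_ops(1)
    by (auto simp: verma_ops)
  have adj: "B (\<pi> (left_mult x s)) (\<pi> t) = B (\<pi> s) (\<pi> (left_mult (gen_adj x) t))" for x s t
    using assms unfolding canonical_form_def verma_ops(1) by (cases x) (auto simp: verma_ops)
  have adj_adj: "gen_adj (gen_adj x) = x" for x by (cases x) auto
  have z: "\<pi> s = \<pi> 0" if "s \<in> I" for s using that by (simp add: \<pi>_eq_iff)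
  have zl: "B (\<pi> 0) (\<pi> t) = 0" and zr: "B (\<pi> t) (\<pi> 0) = 0" for t
    using sl[of 0 0 t] sr[of t 0 0] by simp_all
  have first: "B (\<pi> free_one) (\<pi> t) - cinner \<omega> (\<phi> t) = 0" for t
  proof (rule functional_vanishes[of "\<lambda>t. B (\<pi> free_one) (\<pi> t) - cinner \<omega> (\<phi> t)"])
    fix x t assume x: "lowering x"
    have "left_mult (gen_adj x) free_one \<in> I"
      using x by (cases x) (auto intro: I_one)
    then have "B (\<pi> free_one) (\<pi> (left_mult x t)) = 0"
      using adj[of "gen_adj x" free_one t] by (simp add: adj_adj z zl)
    moreover have "cinner \<omega> (gen_op x (\<phi> t)) = 0"
      using gen_op_adjoint[of "gen_adj x" \<omega> "\<phi> t"] x by (cases x) (auto simp: L_\<omega> G_\<omega>)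
    ultimately show "B (\<pi> free_one) (\<pi> (left_mult x t)) - cinner \<omega> (\<phi> (left_mult x t)) = 0"
      by (simp add: \<phi>_left_mult)
  next
    fix t
    have e: "\<pi> (free_L 0 free_one) = \<pi> (of_real h *\<^sub>C free_one)" using I_one(1) by (simp add: \<pi>_eq_iff)
    have "B (\<pi> free_one) (\<pi> (free_L 0 t)) = of_real h * B (\<pi> free_one) (\<pi> t)"
      using adj[of "Lgen 0" free_one t] by (simp add: e sl)
    moreover have "cinner \<omega> (L 0 (\<phi> t)) = of_real h * cinner \<omega> (\<phi> t)"
      using gen_op_adjoint[of "Lgen 0" \<omega> "\<phi> t"] by (simp add: L0_\<omega> cinner_simps)
    ultimately show "B (\<pi> free_one) (\<pi> (free_L 0 t)) - cinner \<omega> (\<phi> (free_L 0 t)) =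
        of_real h * (B (\<pi> free_one) (\<pi> t) - cinner \<omega> (\<phi> t))"
      by (simp add: \<phi>_left_mult algebra_simps)
    have e: "\<pi> (free_C free_one) = \<pi> (of_real c *\<^sub>C free_one)" using I_one(2) by (simp add: \<pi>_eq_iff)
    have "B (\<pi> free_one) (\<pi> (free_C t)) = of_real c * B (\<pi> free_one) (\<pi> t)"
      using adj[of Cgen free_one t] by (simp add: e sl)
    then show "B (\<pi> free_one) (\<pi> (free_C t)) - cinner \<omega> (\<phi> (free_C t)) =
        of_real c * (B (\<pi> free_one) (\<pi> t) - cinner \<omega> (\<phi> t))"
      by (simp add: \<phi>_left_mult cinner_simps algebra_simps)
  qed (simp_all add: addr sr lin_\<phi> cinner_simps z zr I_\<phi> one \<phi>_one norm_\<omega> algebra_simps)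
  have "B (\<pi> (Poly_Mapping.single w 1)) (\<pi> t) = cinner (\<phi> (Poly_Mapping.single w 1)) (\<phi> t)" for w t
  proof (induction w arbitrary: t)
    case Nil
    then show ?case using first[of t] \<phi>_one by (simp add: free_one_def)
  next
    case (Cons x w)
    have "B (\<pi> (Poly_Mapping.single (x # w) 1)) (\<pi> t) = B (\<pi> (Poly_Mapping.single w 1)) (\<pi> (left_mult (gen_adj x) t))"
      using adj[of x "Poly_Mapping.single w 1" t] by simp
    also have "\<dots> = cinner (\<phi> (left_mult x (Poly_Mapping.single w 1))) (\<phi> t)"
      unfolding Cons.IH \<phi>_left_mult gen_op_adjoint ..
    finally show ?case by simp
  qed
  moreover have "B (\<pi> (\<Sum>w\<in>A. F w)) (\<pi> t) = (\<Sum>w\<in>A. B (\<pi> (F w)) (\<pi> t))" for A :: "ns_gen list set" and F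
    by (induction A rule: infinite_finite_induct) (auto simp: zl addl)
  ultimately have "B (\<pi> (lin_ext (\<lambda>w. Poly_Mapping.single w 1) s)) (\<pi> t) =
     cinner (\<phi> (lin_ext (\<lambda>w. Poly_Mapping.single w 1) s)) (\<phi> t)"
    unfolding lin_ext_def by (simp add: sl lin_\<phi> cinner_simps)
  then show ?thesis by (simp add: lin_ext_id)
qed

section \<open>The irreducible quotient and the cyclic submodule\<close>

lemma verma_form_eq: "verma_form c h (\<pi> s) (\<pi> t) = cinner (\<phi> s) (\<phi> t)"
  unfolding verma_form_def verma_vector_eq
  by (rule canonical_unique[OF someI_ex[OF canonical_exists]])

lemma verma_kernel_eq: "verma_kernel c h = \<pi> ` {t. \<phi> t = 0}"
proof -
  have "(\<forall>t. cinner (\<phi> s) (\<phi> t) = 0) \<longleftrightarrow> \<phi> s = 0" for s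
    using cinner_eq_zero[of "\<phi> s"] by auto
  then show ?thesis
    unfolding verma_kernel_def verma_ops(1) by (auto simp: verma_form_eq)
qed

text \<open>Elements of \<open>ns_irreducible c h\<close> are cosets of cosets. The fibre of
  \<open>\<phi>\<close> over a vector of the cyclic submodule, projected to the Verma module, is
  precisely one of them, so the isomorphism is written down without choosing preimages.\<close>

definition \<Theta> :: "'t \<Rightarrow> ns_free set set" where "\<Theta> v = \<pi> ` {t. \<phi> t = v}"

lemma verma_coset: "ns_coset (verma c h) (verma_kernel c h) (\<pi> t) = \<Theta> (\<phi> t)"
proof -
  have "ns_coset (verma c h) (verma_kernel c h) (\<pi> t) = (\<lambda>k. \<pi> (t + k)) ` {k. \<phi> k = 0}"
  proof -
    have "{F k | k. k \<in> \<pi> ` Z} = (\<lambda>s. F (\<pi> s)) ` Z" for F :: "ns_free set \<Rightarrow> ns_free set" and Z by blast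
    then show ?thesis unfolding ns_coset_def verma_kernel_eq by (simp only: verma_ops)
  qed
  also have "\<dots> = \<pi> ` ((\<lambda>k. t + k) ` {k. \<phi> k = 0})" by (simp add: image_image)
  also have "(\<lambda>k. t + k) ` {k. \<phi> k = 0} = {s. \<phi> s = \<phi> t}"
  proof -
    have "s \<in> (\<lambda>k. t + k) ` {k. \<phi> k = 0}" if "\<phi> s = \<phi> t" for s
      by (rule image_eqI[of _ _ "s - t"]) (use that in \<open>simp_all add: lin_\<phi>\<close>)
    then show ?thesis by (auto simp: lin_\<phi>)
  qed
  finally show ?thesis by (simp add: \<Theta>_def)
qed

lemma \<Theta>_mem: "\<pi> s \<in> \<Theta> v \<longleftrightarrow> \<phi> s = v"
  unfolding \<Theta>_def using \<pi>_\<phi>[of s] \<pi>_self by (auto simp: image_iff)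

lemma \<Theta>_UN:
  assumes "\<And>u. F' (\<pi> u) = \<pi> (F u)" "\<And>u. \<phi> u = \<phi> t \<Longrightarrow> \<phi> (F u) = w"
  shows "(\<Union>A\<in>\<Theta> (\<phi> t). ns_coset (verma c h) (verma_kernel c h) (F' A)) = \<Theta> w"
  using assms by (auto simp: \<Theta>_def[of "\<phi> t"] verma_coset)

lemma generated_eq: "generated_by (ns_ops L G C) \<omega> = range \<phi>"
proof (intro antisym)
  have "invariant_under (ns_ops L G C) (range \<phi>)"
    unfolding invariant_under_def
  proof (intro conjI ballI)
    show "cvec.subspace (range \<phi>)"
      by (auto simp: cvec.subspace_def) (metis lin_\<phi>(3) rangeI, metis lin_\<phi>(1) rangeI, metis lin_\<phi>(2) rangeI)
    show "T v \<in> range \<phi>" if "T \<in> ns_ops L G C" "v \<in> range \<phi>" for T v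
    proof -
      have "\<exists>x. T = gen_op x"
        using \<open>T \<in> ns_ops L G C\<close> unfolding ns_ops_def
        by (metis UnE gen_op.simps imageE singletonD)
      then obtain x where "T = gen_op x" by blast
      moreover obtain t where "v = \<phi> t" using \<open>v \<in> range \<phi>\<close> by auto
      ultimately have "T v = \<phi> (left_mult x t)" by (simp add: \<phi>_left_mult)
      then show ?thesis by simp
    qed
  qed
  moreover have "\<omega> \<in> range \<phi>" by (metis \<phi>_one rangeI)
  ultimately show "generated_by (ns_ops L G C) \<omega> \<subseteq> range \<phi>" by (auto simp: generated_by_def)
  show "range \<phi> \<subseteq> generated_by (ns_ops L G C) \<omega>"
    unfolding generated_by_def
  proof (intro Inter_greatest subsetI)
    fix S v assume S: "S \<in> {S. invariant_under (ns_ops L G C) S \<and> \<omega> \<in> S}" and "v \<in> range \<phi>"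
    have "gen_op x v \<in> S" if "v \<in> S" for x v
      using S that by (cases x) (auto simp: invariant_under_def ns_ops_def)
    then have "foldr gen_op w \<omega> \<in> S" for w using S by (induction w) auto
    then have "\<phi> t \<in> S" for t
      unfolding \<phi>_def lin_ext_def using S
      by (intro cvec.subspace_sum cvec.subspace_scale) (auto simp: invariant_under_def)
    then show "v \<in> S" using \<open>v \<in> range \<phi>\<close> by auto
  qed
qed

theorem generated_isomorphic:
  "ns_isomorphic (ns_subspace L G C (generated_by (ns_ops L G C) \<omega>)) (ns_irreducible c h)"
proof -
  let ?M = "ns_subspace L G C (range \<phi>)" and ?N = "ns_irreducible c h"
  have M: "ns_carrier ?M = range \<phi>" "ns_add ?M = (+)" "ns_smult ?M = scaleC" "ns_L ?M = L" "ns_G ?M = G" "ns_C ?M = C"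
    by (simp_all add: ns_subspace_def)
  have N: "ns_carrier ?N = \<Theta> ` range \<phi>"
    by (simp add: ns_irreducible_def ns_quotient_def verma_ops(1) image_image verma_coset)
  have inj: "inj_on \<Theta> (range \<phi>)"
  proof (rule inj_onI)
    fix v w assume "v \<in> range \<phi>" "w \<in> range \<phi>" "\<Theta> v = \<Theta> w"
    then obtain s where "v = \<phi> s" by auto
    then show "v = w" using \<Theta>_mem[of s v] \<Theta>_mem[of s w] \<open>\<Theta> v = \<Theta> w\<close> by simp
  qed
  have add: "\<Theta> (\<phi> s + \<phi> t) = ns_add ?N (\<Theta> (\<phi> s)) (\<Theta> (\<phi> t))" for s t
  proof -
    have 1: "(\<Union>B\<in>\<Theta> (\<phi> t). ns_coset (verma c h) (verma_kernel c h) (ns_add (verma c h) (\<pi> u) B)) = \<Theta> (\<phi> u + \<phi> t)" for u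
      by (rule \<Theta>_UN[of _ "\<lambda>v. u + v"]) (simp_all add: verma_ops lin_\<phi>)
    have "ns_add ?N (\<Theta> (\<phi> s)) (\<Theta> (\<phi> t)) = (\<Union>A\<in>\<Theta> (\<phi> s). \<Union>B\<in>\<Theta> (\<phi> t). ns_coset (verma c h) (verma_kernel c h) (ns_add (verma c h) A B))"
      by (simp add: ns_irreducible_def ns_quotient_def)
    also have "\<dots> = \<Theta> (\<phi> s + \<phi> t)"
      unfolding \<Theta>_def[of "\<phi> s"] using 1 by auto
    finally show ?thesis ..
  qed
  have smult: "\<Theta> (a *\<^sub>C \<phi> t) = ns_smult ?N a (\<Theta> (\<phi> t))" for a t
    using \<Theta>_UN[of "ns_smult (verma c h) a" "\<lambda>u. a *\<^sub>C u" t]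
    by (simp add: ns_irreducible_def ns_quotient_def verma_ops lin_\<phi>)
  have opL: "\<Theta> (L n (\<phi> t)) = ns_L ?N n (\<Theta> (\<phi> t))" for n t
    using \<Theta>_UN[of "ns_L (verma c h) n" "free_L n" t]
    by (simp add: ns_irreducible_def ns_quotient_def verma_ops \<phi>_left_mult)
  have opG: "\<Theta> (G r (\<phi> t)) = ns_G ?N r (\<Theta> (\<phi> t))" for r t
    using \<Theta>_UN[of "ns_G (verma c h) r" "free_G r" t]
    by (simp add: ns_irreducible_def ns_quotient_def verma_ops \<phi>_left_mult)
  have opC: "\<Theta> (C (\<phi> t)) = ns_C ?N (\<Theta> (\<phi> t))" for t
    using \<Theta>_UN[of "ns_C (verma c h)" "free_C" t]
    by (simp add: ns_irreducible_def ns_quotient_def verma_ops \<phi>_left_mult)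
  show ?thesis
    unfolding generated_eq ns_isomorphic_def
  proof (intro exI[of _ \<Theta>] conjI)
    show "bij_betw \<Theta> (ns_carrier ?M) (ns_carrier ?N)"
      unfolding M N using inj by (rule inj_on_imp_bij_betw)
  qed (auto simp: M add smult opL opG opC[unfolded smult])
qed

end

section \<open>Tensor products\<close>

interpretation cvec_pair: vector_space_pair
  "scaleC :: complex \<Rightarrow> 'a \<Rightarrow> 'a::complex_vector" "scaleC :: complex \<Rightarrow> 'b \<Rightarrow> 'b::complex_vector"
  by unfold_locales

lemma tensor_linear:
  assumes "tensor_product ten"
  shows "clinear (ten x)" "clinear (\<lambda>x. ten x y)"
  using assms by (auto simp: tensor_product_def cbilinear_def)

lemma tensor_induct:
  assumes ten: "tensor_product ten" and U: "cvec.subspace U" and "\<And>x y. ten x y \<in> U"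
  shows "v \<in> U"
proof -
  have "cvec.span {ten x y | x y. True} \<subseteq> U"
    by (rule cvec.span_minimal) (use assms in auto)
  then show ?thesis using ten by (auto simp: tensor_product_def)
qed

lemma cvec_basis_exists: "\<exists>A. cvec.independent A \<and> cvec.span A = (UNIV :: 'a::complex_vector set)"
proof -
  obtain B where "B \<subseteq> (UNIV :: 'a set)" "cvec.independent B" "UNIV \<subseteq> cvec.span B"
    using cvec.maximal_independent_subset .
  then show ?thesis by (intro exI[of _ B]) auto
qed

text \<open>The universal property, derived from independence of the products of two bases:
  \<open>T\<close> is prescribed on these products, and agreement with \<open>F\<close> is extended
  to all vectors in one variable at a time.\<close>

lemma tensor_lift:
  fixes ten :: "'a::complex_prehilbert \<Rightarrow> 'b::complex_prehilbert \<Rightarrow> 'c::complex_prehilbert" and F :: "'a \<Rightarrow> 'b \<Rightarrow> 'd::complex_vector"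
  assumes ten: "tensor_product ten" and F: "\<And>x. clinear (F x)" "\<And>y. clinear (\<lambda>x. F x y)"
  shows "\<exists>T. clinear T \<and> (\<forall>x y. T (ten x y) = F x y)"
proof -
  obtain A :: "'a set" where A: "cvec.independent A" "cvec.span A = UNIV"
    using cvec_basis_exists by blast
  obtain B :: "'b set" where B: "cvec.independent B" "cvec.span B = UNIV"
    using cvec_basis_exists by blast
  let ?t = "\<lambda>(x, y). ten x y"
  have inj: "inj_on ?t (A \<times> B)" and ind: "cvec.independent (?t ` (A \<times> B))"
    using ten A(1) B(1) by (auto simp: tensor_product_def)
  have "\<exists>T. clinear T \<and> (\<forall>p\<in>?t ` (A \<times> B). T p = (\<lambda>(x, y). F x y) (inv_into (A \<times> B) ?t p))"
    by (rule cvec_pair.linear_independent_extend[OF ind])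
  then obtain T where T: "clinear T" "\<forall>p\<in>?t ` (A \<times> B). T p = (\<lambda>(x, y). F x y) (inv_into (A \<times> B) ?t p)"
    by blast
  have AB: "T (ten x y) = F x y" if "x \<in> A" "y \<in> B" for x y
  proof -
    have "ten x y \<in> ?t ` (A \<times> B)" by (rule image_eqI[of _ _ "(x, y)"]) (use that in auto)
    moreover have "inv_into (A \<times> B) ?t (ten x y) = (x, y)"
      using inv_into_f_f[OF inj, of "(x, y)"] that by simp
    ultimately show ?thesis using T(2) by (metis (mono_tags, lifting) case_prod_conv)
  qed
  have A': "T (ten x y) = F x y" if "x \<in> A" for x y
  proof -
    have "cvec.subspace {y. T (ten x y) = F x y}"
      by (auto simp: cvec.subspace_def clinear_simps[OF T(1)] clinear_simps[OF tensor_linear(1)[OF ten]] clinear_simps[OF F(1)])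
    then have "y \<in> cvec.span B \<Longrightarrow> T (ten x y) = F x y"
      by (rule cvec.span_induct[rotated]) (auto simp: AB that)
    then show ?thesis by (simp add: B(2))
  qed
  have "T (ten x y) = F x y" for x y
  proof -
    have "cvec.subspace {x. T (ten x y) = F x y}"
      by (auto simp: cvec.subspace_def clinear_simps[OF T(1)] clinear_simps[OF tensor_linear(2)[OF ten]] clinear_simps[OF F(2)])
    then have "x \<in> cvec.span A \<Longrightarrow> T (ten x y) = F x y"
      by (rule cvec.span_induct[rotated]) (auto simp: A')
    then show ?thesis by (simp add: A(2))
  qed
  with T(1) show ?thesis by blast
qed

lemma tensor_ext:
  assumes "tensor_product ten" "clinear S" "clinear T" "\<And>x y. S (ten x y) = T (ten x y)"
  shows "S v = T v"
proof -
  have "cvec.subspace {v. S v = T v}"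
    by (auto simp: cvec.subspace_def clinear_simps[OF assms(2)] clinear_simps[OF assms(3)])
  from tensor_induct[OF assms(1) this, of v] show ?thesis using assms(4) by auto
qed

text \<open>This justifies the definite description: existence is the universal property, and
  uniqueness holds because the pure tensors span.\<close>

lemma act_fst:
  assumes ten: "tensor_product ten" and T: "clinear T"
  shows "clinear (act_fst ten T)" "act_fst ten T (ten x y) = ten (T x) y"
proof -
  have "\<exists>T'. clinear T' \<and> (\<forall>x y. T' (ten x y) = ten (T x) y)"
  proof (rule tensor_lift[OF ten, of "\<lambda>x y. ten (T x) y"])
    show "clinear (ten (T x))" for x by (rule tensor_linear(1)[OF ten])
    show "clinear (\<lambda>x. ten (T x) y)" for y
      by (rule clinearI) (simp_all add: clinear_simps[OF T] clinear_simps[OF tensor_linear(2)[OF ten]])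
  qed
  then obtain T' where T': "clinear T'" "\<forall>x y. T' (ten x y) = ten (T x) y" by blast
  have "\<exists>!T'. clinear T' \<and> (\<forall>x y. T' (ten x y) = ten (T x) y)"
  proof (rule ex1I[of _ T'])
    fix S assume S: "clinear S \<and> (\<forall>x y. S (ten x y) = ten (T x) y)"
    show "S = T'"
      by (rule ext, rule tensor_ext[OF ten]) (use S T' in auto)
  qed (use T' in auto)
  from theI'[OF this] show "clinear (act_fst ten T)" "act_fst ten T (ten x y) = ten (T x) y"
    by (auto simp: act_fst_def)
qed

lemma act_snd:
  assumes ten: "tensor_product ten" and T: "clinear T"
  shows "clinear (act_snd ten T)" "act_snd ten T (ten x y) = ten x (T y)"
proof -
  have "\<exists>T'. clinear T' \<and> (\<forall>x y. T' (ten x y) = ten x (T y))"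
  proof (rule tensor_lift[OF ten, of "\<lambda>x y. ten x (T y)"])
    show "clinear (\<lambda>x. ten x (T y))" for y by (rule tensor_linear(2)[OF ten])
    show "clinear (\<lambda>y. ten x (T y))" for x
      by (rule clinearI) (simp_all add: clinear_simps[OF T] clinear_simps[OF tensor_linear(1)[OF ten]])
  qed
  then obtain T' where T': "clinear T'" "\<forall>x y. T' (ten x y) = ten x (T y)" by blast
  have "\<exists>!T'. clinear T' \<and> (\<forall>x y. T' (ten x y) = ten x (T y))"
  proof (rule ex1I[of _ T'])
    fix S assume S: "clinear S \<and> (\<forall>x y. S (ten x y) = ten x (T y))"
    show "S = T'"
      by (rule ext, rule tensor_ext[OF ten]) (use S T' in auto)
  qed (use T' in auto)
  from theI'[OF this] show "clinear (act_snd ten T)" "act_snd ten T (ten x y) = ten x (T y)"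
    by (auto simp: act_snd_def)
qed

lemma adjoint_tensor:
  assumes ten: "tensor_product ten" and "clinear S" "clinear T"
    and "\<And>x y x' y'. cinner (S (ten x y)) (ten x' y') = cinner (ten x y) (T (ten x' y'))"
  shows "adjoint_pair S T"
proof -
  have "cinner (S (ten x y)) v = cinner (ten x y) (T v)" for x y v
  proof -
    have "cvec.subspace {v. cinner (S (ten x y)) v = cinner (ten x y) (T v)}"
      by (auto simp: cvec.subspace_def clinear_simps[OF assms(3)] cinner_simps)
    from tensor_induct[OF ten this, of v] show ?thesis using assms(4) by auto
  qed
  note 1 = this
  have "cinner (S u) v = cinner u (T v)" for u v
  proof -
    have "cvec.subspace {u. cinner (S u) v = cinner u (T v)}"
      by (auto simp: cvec.subspace_def clinear_simps[OF assms(2)] cinner_simps)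
    from tensor_induct[OF ten this, of u] show ?thesis using 1 by auto
  qed
  then show ?thesis by (simp add: adjoint_pair_def)
qed

lemma adjoint_act_fst:
  assumes ten: "tensor_product ten" and lin: "clinear S" "clinear T" and "adjoint_pair S T"
  shows "adjoint_pair (act_fst ten S) (act_fst ten T)"
  using assms(4) ten by (intro adjoint_tensor[OF ten] act_fst(1)[OF ten] lin)
    (simp add: act_fst(2)[OF ten] lin adjoint_pair_def tensor_product_def)

lemma adjoint_act_snd:
  assumes ten: "tensor_product ten" and lin: "clinear S" "clinear T" and "adjoint_pair S T"
  shows "adjoint_pair (act_snd ten S) (act_snd ten T)"
  using assms(4) ten by (intro adjoint_tensor[OF ten] act_snd(1)[OF ten] lin)
    (simp add: act_snd(2)[OF ten] lin adjoint_pair_def tensor_product_def)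

section \<open>Local finiteness from gradings and on tensor products\<close>

lemma locally_finite_subspace:
  assumes lin: "\<And>n :: int. clinear (A n)"
  shows "cvec.subspace {v. \<exists>M. \<forall>n\<ge>M. A n v = 0}" (is "cvec.subspace ?V")
  unfolding cvec.subspace_def
proof (intro conjI ballI allI)
  fix x y assume "x \<in> ?V" "y \<in> ?V"
  then obtain M N where "\<forall>n\<ge>M. A n x = 0" "\<forall>n\<ge>N. A n y = 0" by auto
  then have "\<forall>n\<ge>max M N. A n (x + y) = 0" by (simp add: clinear_add[OF lin])
  then show "x + y \<in> ?V" by blast
next
  fix k x assume "x \<in> ?V"
  then obtain M where "\<forall>n\<ge>M. A n x = 0" by auto
  then have "\<forall>n\<ge>M. A n (k *\<^sub>C x) = 0" by (simp add: clinear_scaleC[OF lin])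
  then show "k *\<^sub>C x \<in> ?V" by blast
qed (simp add: clinear_zero[OF lin])

text \<open>Modes of large index would lower the degree below 0, where the grading is trivial. The
  drop \<open>p * n + q\<close> is \<open>n\<close> for bosons and \<open>2 * n + 1\<close>, in half
  units of energy, for fermions.\<close>

lemma field_of_grading:
  assumes lin: "\<And>n. clinear (A n)" and E: "energy_grading E"
    and A: "\<And>n j. A n ` E j \<subseteq> E (j - (p * n + q))" and p: "p > 0"
  shows "field A"
proof (rule fieldI[OF lin])
  fix v
  let ?V = "{v. \<exists>M. \<forall>n\<ge>M. A n v = 0}"
  have "(\<Union>j. E j) \<subseteq> ?V"
  proof safe
    fix j v assume v: "v \<in> E j"
    have "A n v = 0" if n: "n \<ge> \<bar>j\<bar> + \<bar>q\<bar> + 1" for n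
    proof -
      have "n \<le> p * n" using mult_right_mono[of 1 p n] p n by simp
      then have "j - (p * n + q) < 0" using n by linarith
      then have "E (j - (p * n + q)) = {0}" using E by (auto simp: energy_grading_def)
      then show ?thesis using A[of n j] v by auto
    qed
    then show "\<exists>M. \<forall>n\<ge>M. A n v = 0" by blast
  qed
  then have "cvec.span (\<Union>j. E j) \<subseteq> ?V" by (rule cvec.span_minimal[OF _ locally_finite_subspace[OF lin]])
  then show "\<exists>M. \<forall>n\<ge>M. A n v = 0" using E by (auto simp: energy_grading_def)
qed

lemma field_tensor:
  assumes ten: "tensor_product ten" and lin: "\<And>n. clinear (A n)"
    and loc: "\<And>x y. \<exists>M. \<forall>n\<ge>M. A n (ten x y) = 0"
  shows "field A"
proof (rule fieldI[OF lin])
  fix v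
  have "v \<in> {v. \<exists>M. \<forall>n\<ge>M. A n v = 0}"
    by (rule tensor_induct[OF ten locally_finite_subspace[OF lin]]) (use loc in auto)
  then show "\<exists>M. \<forall>n\<ge>M. A n v = 0" by simp
qed

section \<open>Casimir operators\<close>

definition poly_op :: "('v::complex_vector \<Rightarrow> 'v) \<Rightarrow> complex poly \<Rightarrow> 'v \<Rightarrow> 'v" where
  "poly_op T p v = (\<Sum>i\<le>degree p. coeff p i *\<^sub>C (T ^^ i) v)"

lemma poly_op_superset: "degree p \<le> n \<Longrightarrow> poly_op T p v = (\<Sum>i\<le>n. coeff p i *\<^sub>C (T ^^ i) v)"
  unfolding poly_op_def by (rule sum.mono_neutral_left) (auto simp: coeff_eq_0)

lemma poly_op_linear_factor:
  assumes T: "clinear T"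
  shows "poly_op T ([:- a, 1:] * q) v = poly_op T q (T v - a *\<^sub>C v)"
proof -
  have pow: "clinear (T ^^ i)" for i
    by (induction i) (auto intro!: clinearI simp: clinear_simps[OF T] clinear_simps)
  define n where "n = degree q"
  have d: "degree ([:- a, 1:] * q) \<le> Suc n"
    using degree_mult_le[of "[:- a, 1:]" q] by (simp add: n_def)
  have c: "coeff ([:- a, 1:] * q) i = (if i = 0 then 0 else coeff q (i - 1)) - a * coeff q i" for i
    by (cases i) simp_all
  have "poly_op T ([:- a, 1:] * q) v =
    (\<Sum>i\<le>Suc n. (if i = 0 then 0 else coeff q (i - 1)) *\<^sub>C (T ^^ i) v) - (\<Sum>i\<le>Suc n. (a * coeff q i) *\<^sub>C (T ^^ i) v)"
    unfolding poly_op_superset[OF d] c by (simp only: cvec.scale_left_diff_distrib sum_subtractf)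
  also have "(\<Sum>i\<le>Suc n. (if i = 0 then 0 else coeff q (i - 1)) *\<^sub>C (T ^^ i) v) = (\<Sum>i\<le>n. coeff q i *\<^sub>C (T ^^ i) (T v))"
    by (subst sum.atMost_Suc_shift) (simp add: funpow_swap1)
  also have "(\<Sum>i\<le>Suc n. (a * coeff q i) *\<^sub>C (T ^^ i) v) = (\<Sum>i\<le>n. coeff q i *\<^sub>C (T ^^ i) (a *\<^sub>C v))"
    by (simp add: n_def coeff_eq_0 clinear_scaleC[OF pow] mult.commute)
  finally show ?thesis
    by (simp add: poly_op_def n_def clinear_diff[OF pow] cvec.scale_right_diff_distrib sum_subtractf)
qed

text \<open>One linear factor is split off at a time. Either \<open>v\<close> is already an
  eigenvector for the root \<open>a\<close>, or \<open>T v - a *\<^sub>C v\<close> is a nonzero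
  vector killed by a polynomial of smaller degree.\<close>

lemma eigenvector_of_poly:
  assumes T: "clinear T"
  shows "p \<noteq> 0 \<Longrightarrow> v \<noteq> 0 \<Longrightarrow> poly_op T p v = 0 \<Longrightarrow> \<exists>a w. w \<noteq> 0 \<and> T w = a *\<^sub>C w"
proof (induction "degree p" arbitrary: p v)
  case 0
  then obtain k where "p = [:k:]" by (metis degree_eq_zeroE)
  with 0 show ?case by (simp add: poly_op_def)
next
  case (Suc n)
  then have "\<not> constant (poly p)" by (simp add: constant_degree)
  then obtain a where "poly p a = 0" using fundamental_theorem_of_algebra by blast
  then obtain q where q: "p = [:- a, 1:] * q" by (metis dvdE poly_eq_0_iff_dvd)
  show ?case
  proof (cases "T v = a *\<^sub>C v")
    case True
    then show ?thesis using Suc.prems by blast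
  next
    case False
    have "q \<noteq> 0" using Suc.prems q by auto
    then have "degree p = Suc (degree q)" unfolding q by (subst degree_mult_eq) auto
    then show ?thesis
      using Suc.hyps(1)[of q "T v - a *\<^sub>C v"] Suc.hyps(2) \<open>q \<noteq> 0\<close> False Suc.prems(3)
      unfolding q poly_op_linear_factor[OF T] by simp
  qed
qed

lemma eigenvector_exists:
  assumes T: "clinear (T :: 'v \<Rightarrow> 'v::complex_vector)" and fin: "finite_dim (UNIV :: 'v set)" and v: "(v :: 'v) \<noteq> 0"
  shows "\<exists>a w. w \<noteq> 0 \<and> T w = a *\<^sub>C w"
proof -
  obtain B :: "'v set" where B: "finite B" "cvec.span B = UNIV" using fin by (auto simp: finite_dim_def)
  define f where "f i = (T ^^ i) v" for i
  have "\<exists>p. p \<noteq> 0 \<and> poly_op T p v = 0"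
  \<comment> \<open>The dimension count needs \<open>card B + 1\<close> distinct iterates. If two
    iterates coincide, the difference of the two monomials annihilates \<open>v\<close>
    directly.\<close>
  proof (cases "inj_on f {..card B}")
    case False
    then obtain i j where ij: "i \<noteq> j" "f i = f j" by (auto simp: inj_on_def)
    let ?p = "monom 1 i - monom 1 j :: complex poly"
    have "coeff ?p i \<noteq> 0" using ij(1) by simp
    then have "?p \<noteq> 0" by (metis coeff_0)
    moreover have "poly_op T ?p v = 0"
    proof -
      have "degree ?p \<le> i + j" by (intro degree_diff_le) (auto intro: order_trans[OF degree_monom_le])
      then have "poly_op T ?p v = (\<Sum>k\<le>i + j. (if k = i then f k else 0) - (if k = j then f k else 0))"
        unfolding poly_op_superset[OF \<open>degree ?p \<le> i + j\<close>] by (intro sum.cong) (auto simp: f_def)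
      then show ?thesis using ij(2) by (simp add: sum_subtractf)
    qed
    ultimately show ?thesis by blast
  next
    case True
    have "cvec.dependent (f ` {..card B})"
    proof (rule ccontr)
      assume "cvec.independent (f ` {..card B})"
      then have "card (f ` {..card B}) \<le> card B"
        using cvec.independent_span_bound[OF B(1)] B(2) by auto
      then show False using card_image[OF True] by simp
    qed
    then obtain u where u: "\<exists>x\<in>f ` {..card B}. u x \<noteq> 0" "(\<Sum>x\<in>f ` {..card B}. u x *\<^sub>C x) = 0"
      using cvec.dependent_finite[of "f ` {..card B}"] by auto
    define p where "p = (\<Sum>i\<le>card B. monom (u (f i)) i)"
    have cp: "coeff p i = (if i \<le> card B then u (f i) else 0)" for i
      by (auto simp: p_def coeff_sum)
    obtain i where "i \<le> card B" "u (f i) \<noteq> 0" using u(1) by auto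
    then have "coeff p i \<noteq> 0" by (simp add: cp)
    then have "p \<noteq> 0" by (metis coeff_0)
    moreover have "degree p \<le> card B" by (rule degree_le) (simp add: cp)
    then have "poly_op T p v = (\<Sum>i\<le>card B. u (f i) *\<^sub>C f i)"
      by (simp add: poly_op_superset cp f_def)
    then have "poly_op T p v = 0" using u(2) by (simp add: sum.reindex[OF True])
    ultimately show ?thesis by blast
  qed
  then show ?thesis using eigenvector_of_poly[OF T _ v] by blast
qed

lemma schur:
  assumes T: "clinear (T :: 'v \<Rightarrow> 'v::complex_vector)" and fin: "finite_dim (UNIV :: 'v set)" and irr: "irreducible_under ops"
    and ops: "\<And>A. A \<in> ops \<Longrightarrow> clinear A" and comm: "\<And>A v. A \<in> ops \<Longrightarrow> T (A v) = A (T v)"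
  obtains a where "\<And>v. T v = a *\<^sub>C v"
proof -
  obtain v :: 'v where "v \<noteq> 0" using irr by (auto simp: irreducible_under_def)
  then obtain a w where w: "w \<noteq> 0" "T w = a *\<^sub>C w" using eigenvector_exists[OF T fin] by blast
  have "invariant_under ops {v. T v = a *\<^sub>C v}"
    by (auto simp: invariant_under_def cvec.subspace_def clinear_simps[OF T] comm ops clinear_scaleC[OF ops] algebra_simps)
  then have "{v. T v = a *\<^sub>C v} = UNIV"
    using irr w unfolding irreducible_under_def by (metis (mono_tags, lifting) mem_Collect_eq singletonD)
  then show thesis by (intro that) auto
qed

section \<open>The Casimir scalar\<close>

definition casimir :: "('n::finite \<Rightarrow> 'g::complex_vector) \<Rightarrow> ('g \<Rightarrow> 'v::complex_vector \<Rightarrow> 'v) \<Rightarrow> 'v \<Rightarrow> 'v" where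
  "casimir X \<rho> v = (\<Sum>a\<in>UNIV. \<rho> (X a) (\<rho> (X a) v))"

lemma casimir_scalar_eqI:
  assumes "\<And>v. casimir X \<rho> v = of_real r *\<^sub>C v" "(w :: 'v::complex_vector) \<noteq> 0"
  shows "casimir_scalar X (\<rho> :: 'g::complex_vector \<Rightarrow> 'v \<Rightarrow> 'v) = r"
  unfolding casimir_scalar_def
proof (rule the_equality)
  show "\<forall>v. (\<Sum>a\<in>UNIV. \<rho> (X a) (\<rho> (X a) v)) = of_real r *\<^sub>C v"
    using assms(1) by (simp add: casimir_def)
  show "c = r" if "\<forall>v. (\<Sum>a\<in>UNIV. \<rho> (X a) (\<rho> (X a) v)) = of_real c *\<^sub>C v" for c
  proof -
    have "of_real c *\<^sub>C w = of_real r *\<^sub>C w" using that assms(1)[of w] by (simp add: casimir_def)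
    then show ?thesis using assms(2) by simp
  qed
qed

text \<open>For a basis element, commuting past the two factors gives two double sums that are
  negatives of each other after relabelling, because \<open>\<Gamma>\<close> is antisymmetric in its
  last two indices. Linearity does the rest.\<close>

lemma casimir_commutes:
  assumes basis: "structure_basis br X \<Gamma>" and bil: "cbilinear \<rho>"
    and rep: "\<And>x y v. \<rho> (br x y) v = \<rho> x (\<rho> y v) - \<rho> y (\<rho> x v)"
  shows "casimir X \<rho> (\<rho> x v) = \<rho> x (casimir X \<rho> v)"
proof -
  have lin: "clinear (\<rho> x)" "clinear (\<lambda>x. \<rho> x v)" for x v using bil by (auto simp: cbilinear_def)
  have basis_case: "casimir X \<rho> (\<rho> (X b) v) = \<rho> (X b) (casimir X \<rho> v)" for b
  proof -
    have br: "\<rho> (br (X b) (X a)) v = \<i> *\<^sub>C (\<Sum>c\<in>UNIV. of_real (\<Gamma> b a c) *\<^sub>C \<rho> (X c) v)" for a v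
    proof -
      have "br (X b) (X a) = \<i> *\<^sub>C (\<Sum>c\<in>UNIV. of_real (\<Gamma> b a c) *\<^sub>C X c)"
        using basis unfolding structure_basis_def by blast
      then show ?thesis by (simp add: clinear_simps[OF lin(2)])
    qed
    have comm: "\<rho> (X b) (\<rho> (X a) v) = \<rho> (X a) (\<rho> (X b) v) + \<i> *\<^sub>C (\<Sum>c\<in>UNIV. of_real (\<Gamma> b a c) *\<^sub>C \<rho> (X c) v)" for a v
      using rep[of "X b" "X a" v] unfolding br by (simp add: algebra_simps)
    let ?t = "\<lambda>a c. of_real (\<Gamma> b a c) *\<^sub>C \<rho> (X c) (\<rho> (X a) v)"
    have "\<rho> (X b) (casimir X \<rho> v) = (\<Sum>a\<in>UNIV. \<rho> (X a) (\<rho> (X a) (\<rho> (X b) v)) +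
        (\<i> *\<^sub>C (\<Sum>c\<in>UNIV. of_real (\<Gamma> b a c) *\<^sub>C \<rho> (X a) (\<rho> (X c) v)) + \<i> *\<^sub>C (\<Sum>c\<in>UNIV. ?t a c)))"
      by (simp add: casimir_def clinear_simps[OF lin(1)] comm add.assoc)
    also have "\<dots> = casimir X \<rho> (\<rho> (X b) v) +
       \<i> *\<^sub>C ((\<Sum>a\<in>UNIV. \<Sum>c\<in>UNIV. of_real (\<Gamma> b a c) *\<^sub>C \<rho> (X a) (\<rho> (X c) v)) + (\<Sum>a\<in>UNIV. \<Sum>c\<in>UNIV. ?t a c))"
      by (simp add: casimir_def sum.distrib scaleC_add_right cvec.scale_sum_right)
    also have "(\<Sum>a\<in>UNIV. \<Sum>c\<in>UNIV. of_real (\<Gamma> b a c) *\<^sub>C \<rho> (X a) (\<rho> (X c) v)) = - (\<Sum>a\<in>UNIV. \<Sum>c\<in>UNIV. ?t a c)"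
      unfolding sum_negf[symmetric]
    proof (subst sum.swap, intro sum.cong refl)
      fix a c
      have "\<Gamma> b c a = - \<Gamma> b a c" using basis unfolding structure_basis_def by blast
      then show "of_real (\<Gamma> b c a) *\<^sub>C \<rho> (X c) (\<rho> (X a) v) = - ?t a c" by simp
    qed
    finally show ?thesis by simp
  qed
  have "clinear (casimir X \<rho>)"
    by (rule clinearI) (simp_all add: casimir_def clinear_simps[OF lin(1)] sum.distrib cvec.scale_sum_right)
  note linC = clinear_simps[OF this]
  have sub: "cvec.subspace {x. casimir X \<rho> (\<rho> x v) = \<rho> x (casimir X \<rho> v)}"
    by (auto simp: cvec.subspace_def clinear_simps[OF lin(2)] linC)
  have "x \<in> cvec.span (range X)" using basis by (auto simp only: structure_basis_def)
  then show ?thesis by (rule cvec.span_induct[OF _ sub]) (auto simp: basis_case)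
qed

lemma casimir_scalar_exists:
  assumes basis: "structure_basis br X \<Gamma>" and irr: "irreducible_rep br \<rho>"
  obtains a where "\<And>v. casimir X \<rho> v = a *\<^sub>C v"
proof -
  have bil: "cbilinear \<rho>" using irr by (simp add: irreducible_rep_def)
  then have lin: "clinear (\<rho> x)" for x by (simp add: cbilinear_def)
  show thesis
  proof (rule schur[of "casimir X \<rho>" "range \<rho>"])
    show "clinear (casimir X \<rho>)"
      by (rule clinearI) (simp_all add: casimir_def clinear_simps[OF lin] sum.distrib cvec.scale_sum_right)
    show "casimir X \<rho> (A v) = A (casimir X \<rho> v)" if "A \<in> range \<rho>" for A v
      using casimir_commutes[OF basis bil] irr that by (auto simp: irreducible_rep_def)
    show "clinear A" if "A \<in> range \<rho>" for A using lin that by auto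
    show thesis if "\<And>v. casimir X \<rho> v = a *\<^sub>C v" for a using that by (rule \<open>\<And>a. (\<And>v. casimir X \<rho> v = a *\<^sub>C v) \<Longrightarrow> thesis\<close>)
  qed (use irr in \<open>auto simp: irreducible_rep_def\<close>)
qed

section \<open>Identities for the structure constants\<close>

lemma structure_basis_coeff:
  assumes "structure_basis br X \<Gamma>" "(\<Sum>d\<in>UNIV. k d *\<^sub>C X d) = (\<Sum>d\<in>UNIV. k' d *\<^sub>C X d)"
  shows "k d = k' d"
proof -
  have inj: "inj X" and ind: "cvec.independent (range X)" using assms(1) by (auto simp: structure_basis_def)
  have "(\<Sum>y\<in>range X. (k (inv X y) - k' (inv X y)) *\<^sub>C y) = (\<Sum>d\<in>UNIV. (k d - k' d) *\<^sub>C X d)"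
    by (subst sum.reindex[OF inj]) (simp add: inv_f_f[OF inj])
  also have "\<dots> = 0" using assms(2) by (simp add: cvec.scale_left_diff_distrib sum_subtractf)
  finally have s: "(\<Sum>y\<in>range X. (k (inv X y) - k' (inv X y)) *\<^sub>C y) = 0" .
  have "k (inv X (X d)) - k' (inv X (X d)) = 0"
    by (rule cvec.independentD[OF ind _ _ s]) auto
  then show ?thesis by (simp add: inv_f_f[OF inj])
qed

lemma adjoint_rep:
  assumes "simple_lie_algebra br"
  shows "irreducible_rep br br"
proof -
  have lie: "lie_algebra br" using assms by (simp add: simple_lie_algebra_def)
  then have bil: "cbilinear br" and sq: "br x x = 0"
    and jac: "br x (br y z) + br y (br z x) + br z (br x y) = 0" for x y z by (auto simp: lie_algebra_def)
  have lin: "clinear (br x)" "clinear (\<lambda>x. br x y)" for x y using bil by (auto simp: cbilinear_def)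
  have anti: "br y x = - br x y" for x y
  proof -
    have "br (x + y) (x + y) = br x (x + y) + br y (x + y)" by (rule clinear_add[OF lin(2)])
    also have "\<dots> = br x y + br y x" by (simp add: clinear_add[OF lin(1)] sq)
    finally have "br (x + y) (x + y) = br x y + br y x" .
    then have "br y x + br x y = 0" by (metis sq add.commute)
    then show ?thesis by (simp only: eq_neg_iff_add_eq_0)
  qed
  have "br (br x y) z = br x (br y z) - br y (br x z)" for x y z
  proof -
    have "br z (br x y) = - br (br x y) z" "br y (br z x) = - br y (br x z)"
      using anti[of z "br x y"] anti[of x z] by (simp_all add: clinear_uminus[OF lin(1)])
    then show ?thesis using jac[of x y z] by (simp add: algebra_simps)
  qed
  moreover have "irreducible_under (range br)"
    unfolding irreducible_under_def
  proof (intro conjI allI impI)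
    obtain x y where "br x y \<noteq> 0" using assms by (auto simp: simple_lie_algebra_def)
    then show "\<exists>v. v \<noteq> (0 :: 'a)" by blast
    show "S = {0} \<or> S = UNIV" if "invariant_under (range br) S" for S
      using that assms by (auto simp: simple_lie_algebra_def invariant_under_def)
  qed
  ultimately show ?thesis
    using assms bil by (auto simp: irreducible_rep_def simple_lie_algebra_def)
qed

lemma structure_jacobi:
  assumes basis: "structure_basis br X \<Gamma>" and lie: "lie_algebra br"
  shows "(\<Sum>e\<in>UNIV. \<Gamma> a b e * \<Gamma> e c d + \<Gamma> b c e * \<Gamma> e a d + \<Gamma> c a e * \<Gamma> e b d) = 0"
proof -
  have lin: "clinear (br x)" for x using lie by (auto simp: lie_algebra_def cbilinear_def)
  have brX: "br (X a) (X b) = \<i> *\<^sub>C (\<Sum>c\<in>UNIV. of_real (\<Gamma> a b c) *\<^sub>C X c)" for a b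
    using basis unfolding structure_basis_def by blast
  have sw: "\<Gamma> b a c = - \<Gamma> a b c" for a b c using basis unfolding structure_basis_def by blast
  have brr: "br (X a) (br (X b) (X c)) = (\<Sum>d\<in>UNIV. of_real (\<Sum>e\<in>UNIV. \<Gamma> b c e * \<Gamma> e a d) *\<^sub>C X d)" for a b c
  proof -
    have "br (X a) (br (X b) (X c)) = (\<Sum>e\<in>UNIV. \<Sum>d\<in>UNIV. of_real (\<Gamma> b c e * \<Gamma> e a d) *\<^sub>C X d)"
      unfolding brX clinear_simps[OF lin]
      by (simp add: cvec.scale_sum_right sw[of a]) (simp add: mult_ac)
    also have "\<dots> = (\<Sum>d\<in>UNIV. \<Sum>e\<in>UNIV. of_real (\<Gamma> b c e * \<Gamma> e a d) *\<^sub>C X d)" by (rule sum.swap)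
    finally show ?thesis by (simp add: cvec.scale_sum_left)
  qed
  have "br (X a) (br (X b) (X c)) + br (X b) (br (X c) (X a)) + br (X c) (br (X a) (X b)) = 0"
    using lie by (simp add: lie_algebra_def)
  then have "(\<Sum>d\<in>UNIV. (of_real (\<Sum>e\<in>UNIV. \<Gamma> a b e * \<Gamma> e c d + \<Gamma> b c e * \<Gamma> e a d + \<Gamma> c a e * \<Gamma> e b d) :: complex) *\<^sub>C X d) =
     (\<Sum>d\<in>UNIV. 0 *\<^sub>C X d)"
    unfolding brr by (simp add: sum.distrib scaleC_add_left algebra_simps)
  from structure_basis_coeff[OF basis this, of d] show ?thesis by (simp only: of_real_eq_0_iff)
qed

text \<open>The contraction is the matrix \<open>M\<close> of the Casimir operator in the adjoint
  representation, which Schur's lemma makes scalar; the scalar is twice the dual Coxeter number by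
  definition. Diagonal entries are sums of squares, hence the sign, which yields positivity of
  \<open>\<l> + g\<close>.\<close>

lemma structure_contract:
  assumes basis: "structure_basis br X \<Gamma>" and simple: "simple_lie_algebra br"
  shows "(\<Sum>a\<in>UNIV. \<Sum>c\<in>UNIV. \<Gamma> a c b * \<Gamma> a c d) = (if b = d then 2 * dual_coxeter br X else 0)"
    and "dual_coxeter br X \<ge> 0"
proof -
  have lin: "clinear (br x)" for x using simple by (auto simp: simple_lie_algebra_def lie_algebra_def cbilinear_def)
  define M where "M b d = (\<Sum>a\<in>UNIV. \<Sum>c\<in>UNIV. \<Gamma> a c b * \<Gamma> a c d)" for b d
  have brX: "br (X a) (X b) = \<i> *\<^sub>C (\<Sum>c\<in>UNIV. of_real (\<Gamma> a b c) *\<^sub>C X c)" for a b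
    using basis unfolding structure_basis_def by blast
  have sw: "\<Gamma> a b c = - \<Gamma> a c b" for a b c using basis unfolding structure_basis_def by blast
  have cas: "casimir X br (X b) = (\<Sum>d\<in>UNIV. of_real (M b d) *\<^sub>C X d)" for b
  proof -
    have "br (X a) (br (X a) (X b)) = (\<Sum>c\<in>UNIV. \<Sum>d\<in>UNIV. of_real (\<Gamma> a c b * \<Gamma> a c d) *\<^sub>C X d)" for a
      unfolding brX clinear_simps[OF lin]
      by (simp add: cvec.scale_sum_right sw[of a b]) (simp add: mult_ac)
    then have "casimir X br (X b) = (\<Sum>a\<in>UNIV. \<Sum>c\<in>UNIV. \<Sum>d\<in>UNIV. of_real (\<Gamma> a c b * \<Gamma> a c d) *\<^sub>C X d)"
      by (simp add: casimir_def)
    also have "\<dots> = (\<Sum>a\<in>UNIV. \<Sum>d\<in>UNIV. \<Sum>c\<in>UNIV. of_real (\<Gamma> a c b * \<Gamma> a c d) *\<^sub>C X d)"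
      by (rule sum.cong[OF refl], rule sum.swap)
    also have "\<dots> = (\<Sum>d\<in>UNIV. \<Sum>a\<in>UNIV. \<Sum>c\<in>UNIV. of_real (\<Gamma> a c b * \<Gamma> a c d) *\<^sub>C X d)"
      by (rule sum.swap)
    finally show ?thesis by (simp add: M_def cvec.scale_sum_left)
  qed
  obtain k where k: "\<And>v. casimir X br v = k *\<^sub>C v"
    using casimir_scalar_exists[OF basis adjoint_rep[OF simple]] by blast
  have Mk: "complex_of_real (M b d) = (if d = b then k else 0)" for b d
  proof -
    have "(\<Sum>d\<in>UNIV. (if d = b then k else 0) *\<^sub>C X d) = (\<Sum>d\<in>UNIV. if d = b then k *\<^sub>C X d else 0)"
      by (intro sum.cong) auto
    then have "(\<Sum>d\<in>UNIV. of_real (M b d) *\<^sub>C X d) = (\<Sum>d\<in>UNIV. (if d = b then k else 0) *\<^sub>C X d)"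
      using cas[of b] k[of "X b"] by simp
    from structure_basis_coeff[OF basis this, of d] show ?thesis .
  qed
  then have kr: "k = of_real (M b b)" for b by (metis (full_types))
  obtain w :: 'a where "w \<noteq> 0"
    using simple by (auto simp: simple_lie_algebra_def)
  then have g: "2 * dual_coxeter br X = M b b" for b
    unfolding dual_coxeter_def using casimir_scalar_eqI[of X br "M b b"] k kr[of b] by auto
  show "(\<Sum>a\<in>UNIV. \<Sum>c\<in>UNIV. \<Gamma> a c b * \<Gamma> a c d) = (if b = d then 2 * dual_coxeter br X else 0)"
    using Mk[of b d] g[of b] unfolding M_def[symmetric] by (auto split: if_splits)
  have "M b b \<ge> 0" for b unfolding M_def by (intro sum_nonneg) simp
  then show "dual_coxeter br X \<ge> 0" using g by (metis mult_2 add_nonneg_eq_0_iff linorder_not_less add_neg_neg)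
qed

lemma structure_dim:
  assumes "structure_basis br (X :: 'n::finite \<Rightarrow> 'g::complex_vector) \<Gamma>"
  shows "cvec.dim (UNIV :: 'g set) = card (UNIV :: 'n set)"
proof -
  have "cvec.dim (UNIV :: 'g set) = card (range X)"
    using assms by (intro cvec.dim_unique) (auto simp: structure_basis_def)
  then show ?thesis using assms by (simp add: structure_basis_def card_image)
qed

section \<open>The action on the tensor product\<close>

lemma boson_module_simps:
  assumes "boson_module Xb \<Gamma> \<rho> \<l> X \<iota>"
  shows "clinear (X a n)" "clinear \<iota>" "adjoint_pair (X a n) (X a (- n))" "irreducible_under {X a n | a n. True}"
    and "X a 0 (\<iota> w) = \<iota> (\<rho> (Xb a) w)" and "field (X a)" and "n > 0 \<Longrightarrow> X a n (\<iota> w) = 0"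
    and "X a m (X b n v) = X b n (X a m v) + \<i> *\<^sub>C (\<Sum>c\<in>UNIV. of_real (\<Gamma> a b c) *\<^sub>C X c (m + n) v) +
        (if a = b \<and> m + n = 0 then (of_int m * of_nat \<l>) *\<^sub>C v else 0)"
proof -
  note bm = assms[unfolded boson_module_def boson_rep_def]
  show lin: "clinear (X a n)" for a n using bm by blast
  show "clinear \<iota>" "adjoint_pair (X a n) (X a (- n))" "irreducible_under {X a n | a n. True}"
    "X a 0 (\<iota> w) = \<iota> (\<rho> (Xb a) w)"
    using bm by (blast, blast, blast, metis)
  obtain E where E: "energy_grading E" "E 0 = range \<iota>" "\<And>a n j. X a n ` E j \<subseteq> E (j - n)"
    using bm[THEN conjunct2, THEN conjunct2, THEN conjunct2, THEN conjunct2, THEN conjunct2, THEN conjunct2] by auto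
  show "field (X a)"
    by (rule field_of_grading[of "X a" E 1 0]) (use lin E in auto)
  show "X a n (\<iota> w) = 0" if "n > 0"
  proof -
    have "X a n (\<iota> w) \<in> E (0 - n)" using E(2) E(3)[of a n 0] by auto
    moreover have "E (0 - n) = {0}" using E(1) that by (simp add: energy_grading_def)
    ultimately show ?thesis by simp
  qed
  show "X a m (X b n v) = X b n (X a m v) + \<i> *\<^sub>C (\<Sum>c\<in>UNIV. of_real (\<Gamma> a b c) *\<^sub>C X c (m + n) v) +
        (if a = b \<and> m + n = 0 then (of_int m * of_nat \<l>) *\<^sub>C v else 0)"
    using bm[THEN conjunct1, THEN conjunct2, rule_format, of a m b n v] by (simp add: algebra_simps)
qed

lemma fermion_module_simps:
  assumes "fermion_module \<psi> \<Omega>"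
  shows "clinear (\<psi> a k)" "adjoint_pair (\<psi> a k) (\<psi> a (- k - 1))" "generated_by {\<psi> a k | a k. True} \<Omega> = UNIV"
    and "cinner \<Omega> \<Omega> = 1" "k \<ge> 0 \<Longrightarrow> \<psi> a k \<Omega> = 0" and "field (\<psi> a)"
    and "\<psi> a k (\<psi> b j v) = - \<psi> b j (\<psi> a k v) + (if a = b \<and> k + j + 1 = 0 then v else 0)"
proof -
  note fm = assms[unfolded fermion_module_def fermion_rep_def]
  note fm1 = fm[THEN conjunct1] and fm2 = fm[THEN conjunct2]
  show lin: "clinear (\<psi> a k)" for a k using fm1[THEN conjunct1] by blast
  show "adjoint_pair (\<psi> a k) (\<psi> a (- k - 1))" using fm2[THEN conjunct1] by blast
  note fm4 = fm2[THEN conjunct2, THEN conjunct2]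
  show "generated_by {\<psi> a k | a k. True} \<Omega> = UNIV" by (rule fm4[THEN conjunct1])
  note fm5 = fm4[THEN conjunct2]
  show "cinner \<Omega> \<Omega> = 1" by (rule fm5[THEN conjunct1])
  show "k \<ge> 0 \<Longrightarrow> \<psi> a k \<Omega> = 0" using fm5[THEN conjunct2, THEN conjunct1] by blast
  obtain E where E: "energy_grading E" "\<And>a k j. \<psi> a k ` E j \<subseteq> E (j - (2 * k + 1))"
    using fm5[THEN conjunct2, THEN conjunct2] by auto
  show "field (\<psi> a)"
    by (rule field_of_grading[of "\<psi> a" E 2 1]) (use lin E in auto)
  show "\<psi> a k (\<psi> b j v) = - \<psi> b j (\<psi> a k v) + (if a = b \<and> k + j + 1 = 0 then v else 0)"
    using fm1[THEN conjunct2, rule_format, of a k b j v] by (simp add: algebra_simps)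
qed

text \<open>The point is reality of the Casimir scalar, since \<open>casimir_scalar\<close>
  describes a real number. \<open>V\<close> carries no inner product of its own, but in the boson
  module the zero modes are self-adjoint, and a self-adjoint sum acting on a unit vector by a scalar
  has a real one.\<close>

lemma boson_casimir:
  assumes basis: "structure_basis br Xb \<Gamma>" and irr: "irreducible_rep br \<rho>"
    and bos: "boson_module Xb \<Gamma> \<rho> \<l> X \<iota>" and unit: "cinner (\<iota> v) (\<iota> v) = 1"
  shows "(\<Sum>a\<in>UNIV. X a 0 (X a 0 (\<iota> w))) = of_real (casimir_scalar Xb \<rho>) *\<^sub>C \<iota> w"
proof -
  note b = boson_module_simps[OF bos]
  obtain k where k: "\<And>w. casimir Xb \<rho> w = k *\<^sub>C w" using casimir_scalar_exists[OF basis irr] by blast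
  have X: "(\<Sum>a\<in>UNIV. X a 0 (X a 0 (\<iota> w))) = k *\<^sub>C \<iota> w" for w
  proof -
    have "(\<Sum>a\<in>UNIV. X a 0 (X a 0 (\<iota> w))) = \<iota> (casimir Xb \<rho> w)"
      by (simp add: b(5) casimir_def clinear_sum[OF b(2)])
    then show ?thesis by (simp add: k clinear_scaleC[OF b(2)])
  qed
  have adj: "cinner (X a 0 x) y = cinner x (X a 0 y)" for a x y
    using b(3)[of a 0] by (simp add: adjoint_pair_def)
  have "cinner (\<Sum>a\<in>UNIV. X a 0 (X a 0 (\<iota> v))) (\<iota> v) = cinner (\<iota> v) (\<Sum>a\<in>UNIV. X a 0 (X a 0 (\<iota> v)))"
    unfolding cinner_sum_left cinner_sum_right adj ..
  then have "cnj k = k" unfolding X cinner_simps unit by simp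
  then have "k \<in> \<real>" by (simp add: Reals_cnj_iff)
  then obtain r where r: "k = of_real r" by (rule Reals_cases)
  have v: "v \<noteq> 0" using unit clinear_zero[OF b(2)] by auto
  have "casimir Xb \<rho> w = of_real r *\<^sub>C w" for w using k[of w] unfolding r .
  then have "casimir_scalar Xb \<rho> = r" by (rule casimir_scalar_eqI[OF _ v])
  then show ?thesis using X[of w] unfolding r by simp
qed

lemma tensor_super_current:
  fixes X :: "'n::finite \<Rightarrow> int \<Rightarrow> 'h::complex_prehilbert \<Rightarrow> 'h" and \<psi> :: "'n \<Rightarrow> int \<Rightarrow> 'f::complex_prehilbert \<Rightarrow> 'f"
    and ten :: "'h \<Rightarrow> 'f \<Rightarrow> 't::complex_prehilbert"
  assumes simple: "simple_lie_algebra br" and basis: "structure_basis br Xb \<Gamma>" and level: "\<l> \<ge> 1"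
    and irrep: "irreducible_rep br \<rho>" and bos: "boson_module Xb \<Gamma> \<rho> \<l> X \<iota>" and ferm: "fermion_module \<psi> \<Omega>"
    and ten: "tensor_product ten" and unit: "cinner (\<iota> v) (\<iota> v) = 1"
  shows "super_current \<Gamma> (dual_coxeter br Xb) (casimir_scalar Xb \<rho>) \<l> (\<lambda>a n. act_fst ten (X a n))
    (\<lambda>a k. act_snd ten (\<psi> a k)) {ten x \<Omega> | x. True} {ten (\<iota> w) \<Omega> | w. True}"
proof -
  note b = boson_module_simps[OF bos] and f = fermion_module_simps[OF ferm]
  let ?X = "\<lambda>a n. act_fst ten (X a n)" and ?\<psi> = "\<lambda>a k. act_snd ten (\<psi> a k)"
  note lX = act_fst(1)[OF ten b(1)] and l\<psi> = act_snd(1)[OF ten f(1)]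
  note X = act_fst(2)[OF ten b(1)] and \<psi> = act_snd(2)[OF ten f(1)]
  note tl = clinear_simps[OF tensor_linear(1)[OF ten]] and tr = clinear_simps[OF tensor_linear(2)[OF ten]]
  \<comment> \<open>For fixed \<open>x\<close>, the vectors \<open>y\<close> with
    \<open>ten x y\<close> in \<open>U\<close> form an invariant subspace of the fermion module
    containing the vacuum, and the vacuum generates that module.\<close>
  have fermion_generates: "ten x y \<in> U"
    if U: "cvec.subspace U" and \<Omega>: "ten x \<Omega> \<in> U" and inv: "\<And>a k y. y \<in> U \<Longrightarrow> ?\<psi> a k y \<in> U" for U x y
  proof -
    have "ten x (\<psi> a k y) \<in> U" if "ten x y \<in> U" for a k y using inv[OF that, of a k] by (simp add: \<psi>)
    then have "invariant_under {\<psi> a k | a k. True} {y. ten x y \<in> U}"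
      using U by (auto simp: invariant_under_def cvec.subspace_def tl)
    then have "generated_by {\<psi> a k | a k. True} \<Omega> \<subseteq> {y. ten x y \<in> U}"
      using \<Omega> by (auto simp: generated_by_def)
    then show ?thesis using f(3) by auto
  qed
  show ?thesis
  proof
    fix a b c d and m n k j :: int and u
    have sb: "\<forall>a b c. \<Gamma> b a c = - \<Gamma> a b c \<and> \<Gamma> a c b = - \<Gamma> a b c"
      using basis unfolding structure_basis_def by blast
    show "\<Gamma> b a c = - \<Gamma> a b c" "\<Gamma> a c b = - \<Gamma> a b c" using sb by blast+
    show "(\<Sum>e\<in>UNIV. \<Gamma> a b e * \<Gamma> e c d + \<Gamma> b c e * \<Gamma> e a d + \<Gamma> c a e * \<Gamma> e b d) = 0"
      by (rule structure_jacobi[OF basis]) (use simple in \<open>simp add: simple_lie_algebra_def\<close>)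
    show "(\<Sum>a\<in>UNIV. \<Sum>c\<in>UNIV. \<Gamma> a c b * \<Gamma> a c d) = (if b = d then 2 * dual_coxeter br Xb else 0)"
      by (rule structure_contract(1)[OF basis simple])
    show "real \<l> + dual_coxeter br Xb > 0"
      using structure_contract(2)[OF basis simple] level by linarith
    show "field (?X a)"
    proof (rule field_tensor[OF ten lX])
      fix x :: 'h and y :: 'f
      obtain M where "\<And>n. n \<ge> M \<Longrightarrow> X a n x = 0" by (rule field_bound[OF b(6), of a x]) auto
      then show "\<exists>M. \<forall>n\<ge>M. ?X a n (ten x y) = 0" by (intro exI[of _ M]) (simp add: X tr)
    qed
    show "field (?\<psi> a)"
    proof (rule field_tensor[OF ten l\<psi>])
      fix x :: 'h and y :: 'f
      obtain M where "\<And>n. n \<ge> M \<Longrightarrow> \<psi> a n y = 0" by (rule field_bound[OF f(6), of a y]) auto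
      then show "\<exists>M. \<forall>n\<ge>M. ?\<psi> a n (ten x y) = 0" by (intro exI[of _ M]) (simp add: \<psi> tl)
    qed
    let ?S = "\<lambda>u. ?X a m (?X b n u)"
      and ?T = "\<lambda>u. ?X b n (?X a m u) + \<i> *\<^sub>C (\<Sum>c\<in>UNIV. of_real (\<Gamma> a b c) *\<^sub>C ?X c (m + n) u) +
        (if a = b \<and> m + n = 0 then (of_int m * of_nat \<l>) *\<^sub>C u else 0)"
    show "?S u = ?T u"
    proof (rule tensor_ext[OF ten, of ?S ?T])
      show "clinear ?S"
        by (rule clinearI) (simp_all add: clinear_simps[OF lX])
      show "clinear ?T"
        by (rule clinearI) (simp_all add: clinear_simps[OF lX] algebra_simps sum.distrib cvec.scale_sum_right)
      show "?S (ten x y) = ?T (ten x y)" for x y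
        unfolding X b(8)[of a m b n x] by (simp add: tr)
    qed
    let ?S = "\<lambda>u. ?\<psi> a k (?\<psi> b j u)"
      and ?T = "\<lambda>u. - ?\<psi> b j (?\<psi> a k u) + (if a = b \<and> k + j + 1 = 0 then u else 0)"
    show "?S u = ?T u"
    proof (rule tensor_ext[OF ten, of ?S ?T])
      show "clinear ?S"
        by (rule clinearI) (simp_all add: clinear_simps[OF l\<psi>])
      show "clinear ?T"
        by (rule clinearI) (simp_all add: clinear_simps[OF l\<psi>] algebra_simps)
      show "?S (ten x y) = ?T (ten x y)" for x y
        unfolding \<psi> f(7)[of a k b j y] by (simp add: tl)
    qed
    let ?S = "\<lambda>u. ?X a m (?\<psi> b k u)"
      and ?T = "\<lambda>u. ?\<psi> b k (?X a m u)"
    show "?S u = ?T u"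
    proof (rule tensor_ext[OF ten, of ?S ?T])
      show "clinear ?S" "clinear ?T"
        by (rule clinearI; simp add: clinear_simps[OF l\<psi>] clinear_simps[OF lX])+
    qed (simp add: X \<psi>)
    show "adjoint_pair (?X a n) (?X a (- n))"
      by (rule adjoint_act_fst[OF ten b(1,1,3)])
    show "adjoint_pair (?\<psi> a k) (?\<psi> a (- k - 1))"
      by (rule adjoint_act_snd[OF ten f(1,1,2)])
  next
    fix w a and k n :: int assume "w \<in> {ten x \<Omega> | x. True}"
    then show "k \<ge> 0 \<Longrightarrow> ?\<psi> a k w = 0" "?X a n w \<in> {ten x \<Omega> | x. True}"
      by (auto simp: \<psi> X f(5) tl)
  next
    fix U assume U: "cvec.subspace U" and W: "{ten x \<Omega> | x. True} \<subseteq> U"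
      and inv\<psi>: "\<And>a k y. y \<in> U \<Longrightarrow> ?\<psi> a k y \<in> U"
    have "ten x y \<in> U" for x y
      by (rule fermion_generates[OF U _ inv\<psi>]) (use W in auto)
    then have "u \<in> U" for u by (rule tensor_induct[OF ten U])
    then show "U = UNIV" by blast
  next
    show "{ten (\<iota> w) \<Omega> | w. True} \<subseteq> {ten x \<Omega> | x. True}" by blast
  next
    fix u a and n :: int assume u: "u \<in> {ten (\<iota> w) \<Omega> | w. True}"
    then show "n > 0 \<Longrightarrow> ?X a n u = 0" "?X a 0 u \<in> {ten (\<iota> w) \<Omega> | w. True}"
      by (auto simp: X b(5,7) tr)
    from u show "(\<Sum>a\<in>UNIV. ?X a 0 (?X a 0 u)) = of_real (casimir_scalar Xb \<rho>) *\<^sub>C u"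
      using boson_casimir[OF basis irrep bos unit] by (auto simp: X tr[symmetric])
  next
    fix U assume U: "cvec.subspace U" and W0: "{ten (\<iota> w) \<Omega> | w. True} \<subseteq> U"
      and inv\<psi>: "\<And>a k y. y \<in> U \<Longrightarrow> ?\<psi> a k y \<in> U" and invX: "\<And>a n y. y \<in> U \<Longrightarrow> ?X a n y \<in> U"
    have "ten (X a n x) \<Omega> \<in> U" if "ten x \<Omega> \<in> U" for a n x using invX[OF that, of a n] by (simp add: X)
    then have "invariant_under {X a n | a n. True} {x. ten x \<Omega> \<in> U}"
      using U by (auto simp: invariant_under_def cvec.subspace_def tr)
    \<comment> \<open>Irreducibility of the boson module; the unit vector \<open>\<iota> v\<close>
      excludes the zero subspace.\<close>
    then have "{x. ten x \<Omega> \<in> U} = {0} \<or> {x. ten x \<Omega> \<in> U} = UNIV"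
      using b(4) unfolding irreducible_under_def by blast
    moreover have "\<iota> v \<in> {x. ten x \<Omega> \<in> U}" "\<iota> v \<noteq> 0" using W0 unit by auto
    ultimately have W: "ten x \<Omega> \<in> U" for x by blast
    have "ten x y \<in> U" for x y
      by (rule fermion_generates[OF U W inv\<psi>])
    then have "u \<in> U" for u by (rule tensor_induct[OF ten U])
    then show "U = UNIV" by blast
  qed
qed

theorem theorem4p49:
  fixes br :: "'g::complex_vector \<Rightarrow> 'g \<Rightarrow> 'g"
    and Xb :: "'n::finite \<Rightarrow> 'g" and \<Gamma> :: "'n \<Rightarrow> 'n \<Rightarrow> 'n \<Rightarrow> real"
    and \<hh> :: "'g set" and \<Delta> :: "('g \<Rightarrow> complex) set" and \<theta> \<Lambda> :: "'g \<Rightarrow> complex"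
    and \<rho> :: "'g \<Rightarrow> 'v::complex_vector \<Rightarrow> 'v" and v :: 'v
    and \<l> :: nat
    and X :: "'n \<Rightarrow> int \<Rightarrow> 'h::complex_prehilbert \<Rightarrow> 'h" and \<iota> :: "'v \<Rightarrow> 'h"
    and \<psi> :: "'n \<Rightarrow> int \<Rightarrow> 'f::complex_prehilbert \<Rightarrow> 'f" and \<Omega> :: 'f
    and ten :: "'h \<Rightarrow> 'f \<Rightarrow> 't::complex_prehilbert"
    and g c h :: real
    and L G :: "int \<Rightarrow> 't \<Rightarrow> 't" and C :: "'t \<Rightarrow> 't"
  assumes simple: "simple_lie_algebra br"
    and cartan: "cartan_subalgebra br \<hh>" "root_base br \<hh> \<Delta>" "highest_root br \<hh> \<Delta> \<theta>"
    and basis: "structure_basis br Xb \<Gamma>"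
    and normalization: "weight_form Xb \<hh> \<theta> \<theta> = 2"
    and g: "g = dual_coxeter br Xb"
    and level: "\<l> \<ge> 1"
    and irrep: "irreducible_rep br \<rho>"
    and highest_weight: "highest_weight_vector br \<hh> \<Delta> \<rho> \<Lambda> v"
    and weight_le: "Re (weight_form Xb \<hh> \<Lambda> \<theta>) \<le> real \<l>"
    and bosons: "boson_module Xb \<Gamma> \<rho> \<l> X \<iota>"
    and fermions: "fermion_module \<psi> \<Omega>"
    and tensor: "tensor_product ten"
    and unit: "cinner (\<iota> v) (\<iota> v) = 1"
    and c: "c = 3 / 2 * ((real \<l> + g / 3) / (real \<l> + g)) * real (cvec.dim (UNIV :: 'g set))"
    and h: "h = casimir_scalar Xb \<rho> / (2 * (real \<l> + g))"
    and L: "L = L_op g \<l> (\<lambda>a n. act_fst ten (X a n)) (\<lambda>a k. act_snd ten (\<psi> a k))"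
    and G: "G = G_op \<Gamma> g \<l> (\<lambda>a n. act_fst ten (X a n)) (\<lambda>a k. act_snd ten (\<psi> a k))"
    and C: "C = (\<lambda>x. of_real c *\<^sub>C x)"
  shows "unitary_ns_action L G C \<and>
     ns_isomorphic
       (ns_subspace L G C (generated_by (ns_ops L G C) (ten (\<iota> v) \<Omega>)))
       (ns_irreducible c h)"
proof -
  interpret sc: super_current \<Gamma> g "casimir_scalar Xb \<rho>" \<l> "\<lambda>a n. act_fst ten (X a n)"
    "\<lambda>a k. act_snd ten (\<psi> a k)" "{ten x \<Omega> | x. True}" "{ten (\<iota> w) \<Omega> | w. True}"
    unfolding g by (rule tensor_super_current[OF simple basis level irrep bosons fermions tensor unit])
  have cc: "sc.cc = c"
    using structure_dim[OF basis] by (simp add: c sc.cc_def)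
  have u: "ten (\<iota> v) \<Omega> \<in> {ten (\<iota> w) \<Omega> | w. True}" by blast
  have unitary: "unitary_ns_action L G C"
    using sc.unitary_ns unfolding L G C cc .
  have "ns_highest_weight L G c h (ten (\<iota> v) \<Omega>)"
  proof
    show "unitary_ns_action L G (\<lambda>x. of_real c *\<^sub>C x)" using unitary unfolding C .
    show "cinner (ten (\<iota> v) \<Omega>) (ten (\<iota> v) \<Omega>) = 1"
      using tensor unit fermion_module_simps(4)[OF fermions] by (simp add: tensor_product_def)
    show "L 0 (ten (\<iota> v) \<Omega>) = of_real h *\<^sub>C ten (\<iota> v) \<Omega>"
      using sc.W0_L0[OF u] unfolding L h sc.hw_def .
    show "L n (ten (\<iota> v) \<Omega>) = 0" if "n > 0" for n
      using sc.W0_L[OF u that] unfolding L .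
    show "G r (ten (\<iota> v) \<Omega>) = 0" if "r \<ge> 0" for r
      using sc.W0_G[OF u that] unfolding G .
  qed
  from ns_highest_weight.generated_isomorphic[OF this] unitary show ?thesis
    unfolding C by blast
qed

end
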